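(* Let $\mathfrak g_n$ be $\mathfrak{so}_n$ or $\mathfrak{sp}_n$ ($n\ge2$, with $n$ even for $\mathfrak{sp}_n$), let $m\ge1$, and let $\mathfrak f_m=\mathfrak{so}_{2m}$ or $\mathfrak{sp}_{2m}$ respectively. Fix $\nu=(\nu_1,\dots,\nu_m)$ with all $\nu_a\in\{1,\dots,n-1\}$. For $\mu\in\mathbb C^m$ put $\lambda=\mu+\nu-\kappa$, where $\kappa=(n/2,\dots,n/2)$. Let $J(\mu)$ be the operator-valued rational function of $\mu$ obtained by restricting $B(\mu)\,C(\mu)$ to the subspace $\Lambda^{\nu_1}(\mathbb C^n)\otimes\cdots\otimes\Lambda^{\nu_m}(\mathbb C^n)\subset(\mathbb C^n)^{\otimes N}$ and dividing by $\beta(\mu)\gamma(\mu)$, and in the case $\mathfrak g_n=\mathfrak{sp}_n$ also dividing by $\delta(\mu)$ (all defined in the context). Then $J(\mu)$ is regular at any point $\mu\in\mathbb C^m$ where the weight $\lambda+\rho$ of $\mathfrak f_m$ is dominant.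
   Context: Let $e_1,\dots,e_n$ be the standard basis of $\mathbb C^n$, $\tilde\imath=n-i+1$, $\theta_i=-1$ if $\mathfrak g_n=\mathfrak{sp}_n$ and $i>n/2$, $\theta_i=1$ otherwise. The form on $\mathbb C^n$ is $\langle e_i,e_j\rangle=\theta_i\delta_{\tilde\imath j}$, and conjugation relative to it is $\widetilde E_{ij}=\theta_i\theta_jE_{\tilde\jmath\,\tilde\imath}$ on matrix units. Weights of $\mathfrak f_m$ are identified with their label sequences in $\mathbb C^m$. $\rho_a=-a$ if $\mathfrak f_m=\mathfrak{sp}_{2m}$ and $\rho_a=1-a$ if $\mathfrak f_m=\mathfrak{so}_{2m}$. A weight $\omega$ is dominant if $\omega_a-\omega_b\neq-1,-2,\ldots$ and $\omega_a+\omega_b\ne1,2,\ldots$ for all $a<b$, and, in the case $\mathfrak f_m=\mathfrak{sp}_{2m}$, also $\omega_a\ne1,2,\ldots$ for all $a$. Put $N=\nu_1+\dots+\nu_m$ and split $1,\dots,N$ into consecutive segments of lengths $\nu_1,\dots,\nu_m$. For the $i$th element $p=\nu_1+\dots+\nu_{a-1}+i$ of the $a$th segment put $x_p=\mu_a+\rho_a+\frac12+\nu_a-i$. Let $1'',\dots,N''$ be obtained from $1,\dots,N$ by reversing the order within each segment while keeping the order of the segments. Let $P=\sum E_{ij}\otimes E_{ji}$, $\widetilde P=\sum\widetilde E_{ij}\otimes E_{ji}$ on $\mathbb C^n\otimes\mathbb C^n$, $R(x)=1-P\,x^{-1}$, $\widetilde R(x)=1-\widetilde P\,x^{-1}$;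 subscripts $pq$ mean acting in the $p$th and $q$th tensor factors of $(\mathbb C^n)^{\otimes N}$. Put $$B(\mu)=\prod_{(p,q)}^{\longrightarrow}R_{pq}(x_q-x_p),$$ the product over $p<q$ in different segments, arranged from left to right so that $(p,q)$ precedes $(r,s)$ if $p<r$, or if $p=r$ and $q$ precedes $s$ in $1'',\dots,N''$; and $$C(\mu)=\prod_{(p,q)}^{\longleftarrow}\widetilde R_{pq}(n-x_p-x_q),$$ the product over all $1\le p<q\le N$, with the lexicographically ordered pairs arranged from right to left. Both operators preserve the subspace $\Lambda^{\nu_1}(\mathbb C^n)\otimes\cdots\otimes\Lambda^{\nu_m}(\mathbb C^n)$. The scalar functions are $$\beta(\mu)=\prod_{a<b}\begin{cases}\dfrac{\lambda_a-\lambda_b+\rho_a-\rho_b+\nu_b}{\mu_a-\mu_b+\rho_a-\rho_b}&\text{if }\nu_a\le\nu_b,\\[2mm]\dfrac{\lambda_a-\lambda_b+\rho_a-\rho_b+\nu_b}{\lambda_a-\lambda_b+\rho_a-\rho_b}&\text{if }\nu_a\ge\nu_b,\end{cases}$$ $$\gamma(\mu)=\prod_{a<b}\begin{cases}\dfrac{\lambda_a+\lambda_b+\rho_a+\rho_b}{\mu_a+\mu_b+\rho_a+\rho_b}&\text{if }\nu_a+\nu_b\ge n,\\[2mm]1&\text{if }\nu_a+\nu_b\le n,\end{cases}\qquad \delta(\mu)=\prod_{a}\begin{cases}\dfrac{\lambda_a+\rho_a}{\mu_a+\rho_a}&\text{if }2\nu_a\ge n,\\[2mm]1&\text{if }2\nu_a\le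 n,\end{cases}$$ with $a,b\in\{1,\dots,m\}$ (overlapping cases agree). *)

theory Defs
  imports Complex_Main "HOL-Library.FuncSet" "HOL-Combinatorics.Transposition"
begin

section \<open>Rational functions of \<open>(z\<^sub>1, \<dots>, z\<^sub>m)\<close> and their regularity\<close>

text \<open>
  A point of \<open>\<complex>\<^sup>m\<close> is a function \<open>z :: nat \<Rightarrow> complex\<close> of which only the values
  \<open>z 1, \<dots>, z m\<close> matter; \<open>polyfun m\<close> is the ring of polynomial functions in these values.
\<close>

inductive_set polyfun :: "nat \<Rightarrow> ((nat \<Rightarrow> complex) \<Rightarrow> complex) set" for m :: nat where
  const: "(\<lambda>z. c) \<in> polyfun m"
| coord: "a \<in> {1..m} \<Longrightarrow> (\<lambda>z. z a) \<in> polyfun m"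
| add: "f \<in> polyfun m \<Longrightarrow> g \<in> polyfun m \<Longrightarrow> (\<lambda>z. f z + g z) \<in> polyfun m"
| mult: "f \<in> polyfun m \<Longrightarrow> g \<in> polyfun m \<Longrightarrow> (\<lambda>z. f z * g z) \<in> polyfun m"

text \<open>
  A rational function is given by an expression that is meaningful off a proper hypersurface,
  and two such expressions are the same rational function if they agree off a proper
  hypersurface \<open>r = 0\<close>.  In particular the values that the convention \<open>x / 0 = 0\<close> assigns on the
  zero sets of denominators play no role.
\<close>

definition same_rational_function ::
    "nat \<Rightarrow> ((nat \<Rightarrow> complex) \<Rightarrow> complex) \<Rightarrow> ((nat \<Rightarrow> complex) \<Rightarrow> complex) \<Rightarrow> bool" where
  "same_rational_function m f g \<longleftrightarrow>
     (\<exists>r\<in>polyfun m. (\<exists>z. r z \<noteq> 0) \<and> (\<forall>z. r z \<noteq> 0 \<longrightarrow> f z = g z))"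

definition regular_at :: "nat \<Rightarrow> ((nat \<Rightarrow> complex) \<Rightarrow> complex) \<Rightarrow> (nat \<Rightarrow> complex) \<Rightarrow> bool" where
  "regular_at m f z\<^sub>0 \<longleftrightarrow>
     (\<exists>p\<in>polyfun m. \<exists>q\<in>polyfun m. q z\<^sub>0 \<noteq> 0 \<and> same_rational_function m f (\<lambda>z. p z / q z))"


section \<open>Tensors\<close>

text \<open>
  A tensor in \<open>(\<complex>\<^sup>n)\<^sup>\<otimes>\<^sup>N\<close> is the family of its coordinates, indexed by the multi-indices
  \<open>I : {1..N} \<rightarrow> {1..n}\<close> and extended by \<open>0\<close>; \<open>e\<^bsub>I 1\<^esub> \<otimes> \<dots> \<otimes> e\<^bsub>I N\<^esub>\<close> corresponds to the
  multi-index \<open>I\<close>.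
\<close>

type_synonym tensor = "(nat \<Rightarrow> nat) \<Rightarrow> complex"
type_synonym matrix = "nat \<Rightarrow> nat \<Rightarrow> complex"

definition multi_indices :: "nat \<Rightarrow> nat \<Rightarrow> (nat \<Rightarrow> nat) set" where
  "multi_indices n N = {1..N} \<rightarrow>\<^sub>E {1..n}"

definition tensor_space :: "nat \<Rightarrow> nat \<Rightarrow> tensor set" where
  "tensor_space n N = {v. \<forall>I. I \<notin> multi_indices n N \<longrightarrow> v I = 0}"

text \<open>The matrix \<open>A\<close> acting in the \<open>p\<close>th tensor factor.\<close>

definition tensor_act :: "nat \<Rightarrow> nat \<Rightarrow> matrix \<Rightarrow> tensor \<Rightarrow> tensor" where
  "tensor_act n p A v = (\<lambda>I. \<Sum>k\<in>{1..n}. A (I p) k * v (I(p := k)))"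

text \<open>The operator-valued function \<open>F\<close>, restricted to the subspace \<open>U\<close>, is regular if all its
  coordinates are.\<close>

definition regular_operator_at ::
    "nat \<Rightarrow> (nat \<Rightarrow> nat) set \<Rightarrow> tensor set \<Rightarrow> ((nat \<Rightarrow> complex) \<Rightarrow> tensor \<Rightarrow> tensor)
       \<Rightarrow> (nat \<Rightarrow> complex) \<Rightarrow> bool" where
  "regular_operator_at m \<I> U F z\<^sub>0 \<longleftrightarrow>
     (\<forall>v\<in>U. \<forall>I\<in>\<I>. regular_at m (\<lambda>z. F z v I) z\<^sub>0)"


section \<open>The classical Lie algebras and the weights\<close>

text \<open>\<open>SO\<close> stands for the pair \<open>so\<^sub>n\<close>, \<open>so\<^bsub>2m\<^esub>\<close> and \<open>SP\<close> for the pair \<open>sp\<^sub>n\<close>, \<open>sp\<^bsub>2m\<^esub>\<close>.\<close>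

datatype lie_type = SO | SP

definition rho :: "lie_type \<Rightarrow> nat \<Rightarrow> complex" where
  "rho g a = (case g of SP \<Rightarrow> - of_nat a | SO \<Rightarrow> 1 - of_nat a)"

definition dominant :: "lie_type \<Rightarrow> nat \<Rightarrow> (nat \<Rightarrow> complex) \<Rightarrow> bool" where
  "dominant g m \<omega> \<longleftrightarrow>
     (\<forall>a\<in>{1..m}. \<forall>b\<in>{1..m}. a < b \<longrightarrow>
        (\<forall>k::nat. k \<ge> 1 \<longrightarrow> \<omega> a - \<omega> b \<noteq> - of_nat k \<and> \<omega> a + \<omega> b \<noteq> of_nat k)) \<and>
     (g = SP \<longrightarrow> (\<forall>a\<in>{1..m}. \<forall>k::nat. k \<ge> 1 \<longrightarrow> \<omega> a \<noteq> of_nat k))"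

definition lam :: "nat \<Rightarrow> (nat \<Rightarrow> nat) \<Rightarrow> (nat \<Rightarrow> complex) \<Rightarrow> nat \<Rightarrow> complex" where
  "lam n \<nu> \<mu> a = \<mu> a + of_nat (\<nu> a) - of_nat n / 2"


section \<open>The R-matrices\<close>

definition tilde :: "nat \<Rightarrow> nat \<Rightarrow> nat" where
  "tilde n i = n - i + 1"

definition theta :: "lie_type \<Rightarrow> nat \<Rightarrow> nat \<Rightarrow> complex" where
  "theta g n i = (if g = SP \<and> n < 2 * i then - 1 else 1)"

definition unit_matrix :: "nat \<Rightarrow> nat \<Rightarrow> matrix" where
  "unit_matrix i j = (\<lambda>k l. if k = i \<and> l = j then 1 else 0)"

text \<open>Conjugation relative to the form with \<open>\<langle>e\<^sub>i, e\<^sub>j\<rangle> = theta g n i\<close> if \<open>j = tilde n i\<close>, and \<open>0\<close> otherwise.\<close>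

definition unit_matrix_tilde :: "lie_type \<Rightarrow> nat \<Rightarrow> nat \<Rightarrow> nat \<Rightarrow> matrix" where
  "unit_matrix_tilde g n i j =
     (\<lambda>k l. theta g n i * theta g n j * unit_matrix (tilde n j) (tilde n i) k l)"

definition P_op :: "nat \<Rightarrow> nat \<Rightarrow> nat \<Rightarrow> tensor \<Rightarrow> tensor" where
  "P_op n p q v =
     (\<lambda>I. \<Sum>i\<in>{1..n}. \<Sum>j\<in>{1..n}.
       tensor_act n p (unit_matrix i j) (tensor_act n q (unit_matrix j i) v) I)"

definition P_tilde_op :: "lie_type \<Rightarrow> nat \<Rightarrow> nat \<Rightarrow> nat \<Rightarrow> tensor \<Rightarrow> tensor" where
  "P_tilde_op g n p q v =
     (\<lambda>I. \<Sum>i\<in>{1..n}. \<Sum>j\<in>{1..n}.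
       tensor_act n p (unit_matrix_tilde g n i j) (tensor_act n q (unit_matrix j i) v) I)"

definition R_op :: "nat \<Rightarrow> nat \<Rightarrow> nat \<Rightarrow> complex \<Rightarrow> tensor \<Rightarrow> tensor" where
  "R_op n p q x v = (\<lambda>I. v I - P_op n p q v I / x)"

definition R_tilde_op :: "lie_type \<Rightarrow> nat \<Rightarrow> nat \<Rightarrow> nat \<Rightarrow> complex \<Rightarrow> tensor \<Rightarrow> tensor" where
  "R_tilde_op g n p q x v = (\<lambda>I. v I - P_tilde_op g n p q v I / x)"


section \<open>The segments of \<open>1, \<dots>, N\<close>\<close>

text \<open>\<open>psum \<nu> a = \<nu>\<^sub>1 + \<dots> + \<nu>\<^sub>a\<close>, so that \<open>N = psum \<nu> m\<close> and the \<open>a\<close>th segment is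
  \<open>{psum \<nu> (a - 1) + 1..psum \<nu> a}\<close>.\<close>

definition psum :: "(nat \<Rightarrow> nat) \<Rightarrow> nat \<Rightarrow> nat" where
  "psum \<nu> a = (\<Sum>b\<in>{1..a}. \<nu> b)"

definition seg :: "(nat \<Rightarrow> nat) \<Rightarrow> nat \<Rightarrow> nat" where
  "seg \<nu> p = (LEAST a. p \<le> psum \<nu> a)"

definition spectral :: "lie_type \<Rightarrow> (nat \<Rightarrow> nat) \<Rightarrow> (nat \<Rightarrow> complex) \<Rightarrow> nat \<Rightarrow> complex" where
  "spectral g \<nu> \<mu> p =
     (let a = seg \<nu> p; i = p - psum \<nu> (a - 1)
      in \<mu> a + rho g a + 1 / 2 + of_nat (\<nu> a) - of_nat i)"

text \<open>The sequence \<open>1'', \<dots>, N''\<close>.\<close>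

definition reversed_segments :: "nat \<Rightarrow> (nat \<Rightarrow> nat) \<Rightarrow> nat list" where
  "reversed_segments m \<nu> =
     concat (map (\<lambda>a. rev [psum \<nu> (a - 1) + 1..<psum \<nu> a + 1]) [1..<m + 1])"

text \<open>The subspace \<open>\<Lambda>\<^bsup>\<nu>\<^sub>1\<^esup>(\<complex>\<^sup>n) \<otimes> \<dots> \<otimes> \<Lambda>\<^bsup>\<nu>\<^sub>m\<^esup>(\<complex>\<^sup>n)\<close> consists of the tensors that are
  antisymmetric in the tensor factors of each segment.\<close>

definition Lambda_space :: "nat \<Rightarrow> nat \<Rightarrow> (nat \<Rightarrow> nat) \<Rightarrow> tensor set" where
  "Lambda_space n m \<nu> =
     {v \<in> tensor_space n (psum \<nu> m).
        \<forall>p\<in>{1..psum \<nu> m}. \<forall>q\<in>{1..psum \<nu> m}. p \<noteq> q \<and> seg \<nu> p = seg \<nu> q \<longrightarrow>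
          (\<forall>I. v (I \<circ> transpose p q) = - v I)}"


section \<open>The operators \<open>B(\<mu>)\<close>, \<open>C(\<mu>)\<close>, \<open>J(\<mu>)\<close>\<close>

text \<open>\<open>ordered_prod [X\<^sub>1, \<dots>, X\<^sub>k] = X\<^sub>1 \<circ> \<dots> \<circ> X\<^sub>k\<close>\<close>

definition ordered_prod :: "('v \<Rightarrow> 'v) list \<Rightarrow> 'v \<Rightarrow> 'v" where
  "ordered_prod Xs = foldr (\<circ>) Xs id"

definition B_pairs :: "nat \<Rightarrow> (nat \<Rightarrow> nat) \<Rightarrow> (nat \<times> nat) list" where
  "B_pairs m \<nu> =
     [(p, q). p \<leftarrow> [1..<psum \<nu> m + 1], q \<leftarrow> reversed_segments m \<nu>, p < q \<and> seg \<nu> p \<noteq> seg \<nu> q]"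

definition C_pairs :: "nat \<Rightarrow> (nat \<Rightarrow> nat) \<Rightarrow> (nat \<times> nat) list" where
  "C_pairs m \<nu> = [(p, q). p \<leftarrow> [1..<psum \<nu> m + 1], q \<leftarrow> [p + 1..<psum \<nu> m + 1]]"

definition B_op :: "lie_type \<Rightarrow> nat \<Rightarrow> nat \<Rightarrow> (nat \<Rightarrow> nat) \<Rightarrow> (nat \<Rightarrow> complex) \<Rightarrow> tensor \<Rightarrow> tensor" where
  "B_op g n m \<nu> \<mu> = ordered_prod
     (map (\<lambda>(p, q). R_op n p q (spectral g \<nu> \<mu> q - spectral g \<nu> \<mu> p)) (B_pairs m \<nu>))"

definition C_op :: "lie_type \<Rightarrow> nat \<Rightarrow> nat \<Rightarrow> (nat \<Rightarrow> nat) \<Rightarrow> (nat \<Rightarrow> complex) \<Rightarrow> tensor \<Rightarrow> tensor" where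
  "C_op g n m \<nu> \<mu> = ordered_prod
     (map (\<lambda>(p, q). R_tilde_op g n p q (of_nat n - spectral g \<nu> \<mu> p - spectral g \<nu> \<mu> q))
        (rev (C_pairs m \<nu>)))"

definition beta_fun :: "lie_type \<Rightarrow> nat \<Rightarrow> nat \<Rightarrow> (nat \<Rightarrow> nat) \<Rightarrow> (nat \<Rightarrow> complex) \<Rightarrow> complex" where
  "beta_fun g n m \<nu> \<mu> = (let l = lam n \<nu> \<mu>; \<rho> = rho g in
     \<Prod>(a, b)\<in>{(a, b). 1 \<le> a \<and> a < b \<and> b \<le> m}.
       if \<nu> a \<le> \<nu> b
       then (l a - l b + \<rho> a - \<rho> b + of_nat (\<nu> b)) / (\<mu> a - \<mu> b + \<rho> a - \<rho> b)
       else (l a - l b + \<rho> a - \<rho> b + of_nat (\<nu> b)) / (l a - l b + \<rho> a - \<rho> b))"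

definition gamma_fun :: "lie_type \<Rightarrow> nat \<Rightarrow> nat \<Rightarrow> (nat \<Rightarrow> nat) \<Rightarrow> (nat \<Rightarrow> complex) \<Rightarrow> complex" where
  "gamma_fun g n m \<nu> \<mu> = (let l = lam n \<nu> \<mu>; \<rho> = rho g in
     \<Prod>(a, b)\<in>{(a, b). 1 \<le> a \<and> a < b \<and> b \<le> m}.
       if \<nu> a + \<nu> b \<ge> n
       then (l a + l b + \<rho> a + \<rho> b) / (\<mu> a + \<mu> b + \<rho> a + \<rho> b)
       else 1)"

definition delta_fun :: "lie_type \<Rightarrow> nat \<Rightarrow> nat \<Rightarrow> (nat \<Rightarrow> nat) \<Rightarrow> (nat \<Rightarrow> complex) \<Rightarrow> complex" where
  "delta_fun g n m \<nu> \<mu> = (let l = lam n \<nu> \<mu>; \<rho> = rho g in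
     \<Prod>a\<in>{1..m}. if 2 * \<nu> a \<ge> n then (l a + \<rho> a) / (\<mu> a + \<rho> a) else 1)"

definition J_op :: "lie_type \<Rightarrow> nat \<Rightarrow> nat \<Rightarrow> (nat \<Rightarrow> nat) \<Rightarrow> (nat \<Rightarrow> complex) \<Rightarrow> tensor \<Rightarrow> tensor" where
  "J_op g n m \<nu> \<mu> v =
     (\<lambda>I. B_op g n m \<nu> \<mu> (C_op g n m \<nu> \<mu> v) I /
          (beta_fun g n m \<nu> \<mu> * gamma_fun g n m \<nu> \<mu> * (if g = SP then delta_fun g n m \<nu> \<mu> else 1)))"

end

theory Submission
  imports Defs "HOL-Computational_Algebra.Polynomial"
begin

text \<open>
  Put \<open>\<omega> = \<lambda> + \<rho>\<close>.  Since factors acting in disjoint pairs of tensor factors commute, both products split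
  into blocks, one for each pair of segments (and, for \<open>C\<close>, one for each single segment).  By fusion, a
  row of a block acts on tensors that are antisymmetric in the second segment as \<open>1 - S / u\<close> with a
  single pole, where \<open>S\<close> is a sum of the operators \<open>P\<close> or \<open>P_tilde\<close>; the same holds for columns.
  For \<open>B\<close>, using rows if \<open>\<nu>\<^sub>a \<le> \<nu>\<^sub>b\<close> and columns otherwise, dominance excludes every pole except a
  simple one that \<open>1 / \<beta>\<close> cancels.

  For \<open>C\<close>, dominance excludes all poles, but \<open>1 / \<gamma>\<close> and \<open>1 / \<delta>\<close> contribute new ones at
  \<open>\<omega>\<^sub>a + \<omega>\<^sub>b = 0\<close> and \<open>\<omega>\<^sub>a = 0\<close>, so the block has to vanish there if \<open>\<nu>\<^sub>a + \<nu>\<^sub>b > n\<close>, respectively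
  \<open>2 \<nu>\<^sub>a > n\<close>.  At this point the kernel of the block, after lowering its input indices by the form, is a
  determinant (for two segments) or a Pfaffian (for one segment) that is antisymmetric in
  \<open>\<nu>\<^sub>a + \<nu>\<^sub>b\<close>, respectively \<open>2 \<nu>\<^sub>a\<close>, indices with values in \<open>{1..n}\<close>, hence zero.
  In the orthogonal case the block of a single segment acts trivially, because the contraction with a
  symmetric form kills antisymmetric tensors.
\<close>

section \<open>Generic identities and regularity\<close>

text \<open>The shifts in the data put every pole at an integer: with h = omega_a + omega_b the i-th
  row of a block of C has denominator i - h, and with d = omega_a - omega_b the reading of a block
  of B that is chosen has its poles at non-positive integers. The delicate point is the division by
  h. A block acts on a tensor that already depends on mu, so its vanishing cannot simply be
  evaluated at a point. Therefore the rows are freed of denominators and their product is split into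
  its value at h = 0 and h times an explicit remainder. The vanishing is proved for the denominators
  frozen at h = 0, applied to an arbitrary antisymmetric tensor, and the quotient by h is the
  remainder. Antisymmetry is needed afresh at the entrance of every block; reading a block by rows
  returns it in one segment only and reading it by columns in the other, so each block is fused both
  ways. Fusion fails where a single factor has a pole, hence identities are carried off proper
  hypersurfaces.\<close>

lemma polyfun_line:
  assumes "f \<in> polyfun m"
  shows "\<exists>P. \<forall>t. f (\<lambda>i. x i + t * y i) = poly P t"
  using assms
proof induction
  case (const c)
  show ?case by (rule exI[of _ "[:c:]"]) simp
next
  case (coord a)
  show ?case by (rule exI[of _ "[:x a, y a:]"]) simp
next
  case (add f g)
  then obtain P Q where "\<forall>t. f (\<lambda>i. x i + t * y i) = poly P t" "\<forall>t. g (\<lambda>i. x i + t * y i) = poly Q t"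
    by blast
  then show ?case by (intro exI[of _ "P + Q"]) simp
next
  case (mult f g)
  then obtain P Q where "\<forall>t. f (\<lambda>i. x i + t * y i) = poly P t" "\<forall>t. g (\<lambda>i. x i + t * y i) = poly Q t"
    by blast
  then show ?case by (intro exI[of _ "P * Q"]) simp
qed

lemma polyfun_diff:
  assumes "f \<in> polyfun m" "g \<in> polyfun m"
  shows "(\<lambda>z. f z - g z) \<in> polyfun m"
  using polyfun.add[OF assms(1) polyfun.mult[OF polyfun.const[of "-1"] assms(2)]] by simp

lemmas polyfun_intros = polyfun.intros polyfun_diff

text \<open>Truth on a nonempty Zariski-open set. It behaves like a filter, so that identities can
  be combined although each fails on a hypersurface of its own.\<close>

definition generically :: "nat \<Rightarrow> ((nat \<Rightarrow> complex) \<Rightarrow> bool) \<Rightarrow> bool" where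
  "generically m Q \<longleftrightarrow> (\<exists>r\<in>polyfun m. (\<exists>z. r z \<noteq> 0) \<and> (\<forall>z. r z \<noteq> 0 \<longrightarrow> Q z))"

lemma generically_nonzero:
  assumes "f \<in> polyfun m" "f z \<noteq> 0"
  shows "generically m (\<lambda>z. f z \<noteq> 0)"
  using assms unfolding generically_def by blast

lemma generically_mono: "generically m Q \<Longrightarrow> (\<And>z. Q z \<Longrightarrow> Q' z) \<Longrightarrow> generically m Q'"
  unfolding generically_def by blast

lemma generically_True: "generically m (\<lambda>z. True)"
  unfolding generically_def by (rule bexI[OF _ polyfun.const[of 1]]) auto

lemma generically_always: "(\<And>z. Q z) \<Longrightarrow> generically m Q"
  using generically_True generically_mono by blast

text \<open>Two nonempty Zariski-open sets meet: on the line through a point of each,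
  \<open>r\<close> and \<open>r'\<close> restrict to nonzero polynomials in one variable, and their
  product has only finitely many roots.\<close>

lemma generically_conj:
  assumes "generically m Q" "generically m Q'"
  shows "generically m (\<lambda>z. Q z \<and> Q' z)"
proof -
  obtain r x where r: "r \<in> polyfun m" "r x \<noteq> 0" "\<And>z. r z \<noteq> 0 \<Longrightarrow> Q z"
    using assms(1) unfolding generically_def by blast
  obtain r' x' where r': "r' \<in> polyfun m" "r' x' \<noteq> 0" "\<And>z. r' z \<noteq> 0 \<Longrightarrow> Q' z"
    using assms(2) unfolding generically_def by blast
  let ?l = "\<lambda>t i. x i + t * (x' i - x i)"
  obtain P where P: "\<And>t. r (?l t) = poly P t"
    using polyfun_line[OF r(1), of x "\<lambda>i. x' i - x i"] by blast
  obtain P' where P': "\<And>t. r' (?l t) = poly P' t"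
    using polyfun_line[OF r'(1), of x "\<lambda>i. x' i - x i"] by blast
  have "poly P 0 \<noteq> 0" "poly P' 1 \<noteq> 0"
    using r(2) r'(2) P[of 0] P'[of 1] by simp_all
  then have "P * P' \<noteq> 0" by auto
  then have "finite {t. poly (P * P') t = 0}" by (rule poly_roots_finite)
  then obtain t where "poly (P * P') t \<noteq> 0"
    using infinite_UNIV_char_0[where 'a = complex] by (metis (mono_tags, lifting) ex_new_if_finite mem_Collect_eq)
  then have "r (?l t) * r' (?l t) \<noteq> 0" by (simp add: P P')
  then show ?thesis
    unfolding generically_def using r(3) r'(3)
    by (intro bexI[OF _ polyfun.mult[OF r(1) r'(1)]]) auto
qed

lemma generically_ball:
  assumes "finite A" "\<And>x. x \<in> A \<Longrightarrow> generically m (Q x)"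
  shows "generically m (\<lambda>z. \<forall>x\<in>A. Q x z)"
  using assms
  by (induction A) (auto intro: generically_True generically_mono[OF generically_conj])

lemma same_rational_function_iff: "same_rational_function m f g \<longleftrightarrow> generically m (\<lambda>z. f z = g z)"
  unfolding same_rational_function_def generically_def ..

section \<open>Closure properties of regularity at a point\<close>

lemma regular_atI:
  assumes "p \<in> polyfun m" "q \<in> polyfun m" "q z0 \<noteq> 0" "generically m (\<lambda>z. f z = p z / q z)"
  shows "regular_at m f z0"
  using assms unfolding regular_at_def same_rational_function_iff by blast

lemma regular_at_polyfun: "f \<in> polyfun m \<Longrightarrow> regular_at m f z0"
  unfolding regular_at_def same_rational_function_iff
  by (rule bexI, rule bexI[OF _ polyfun.const[of 1]]) (auto intro: generically_always)

lemma regular_at_inverse: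
  "f \<in> polyfun m \<Longrightarrow> f z0 \<noteq> 0 \<Longrightarrow> regular_at m (\<lambda>z. 1 / f z) z0"
  unfolding regular_at_def same_rational_function_iff
  by (rule bexI[OF _ polyfun.const[of 1]], rule bexI[of _ f]) (auto intro: generically_always)

lemma regular_at_cong:
  assumes "generically m (\<lambda>z. f z = g z)" "regular_at m g z0"
  shows "regular_at m f z0"
proof -
  obtain p q where pq: "p \<in> polyfun m" "q \<in> polyfun m" "q z0 \<noteq> 0"
      "generically m (\<lambda>z. g z = p z / q z)"
    using assms(2) unfolding regular_at_def same_rational_function_iff by blast
  have "generically m (\<lambda>z. f z = p z / q z)"
    using generically_conj[OF assms(1) pq(4)] by (rule generically_mono) simp
  then show ?thesis unfolding regular_at_def same_rational_function_iff using pq by blast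
qed

lemma regular_at_add_mult:
  assumes "regular_at m f z0" "regular_at m g z0"
  shows regular_at_add: "regular_at m (\<lambda>z. f z + g z) z0"
    and regular_at_mult: "regular_at m (\<lambda>z. f z * g z) z0"
proof -
  obtain p q where pq: "p \<in> polyfun m" "q \<in> polyfun m" "q z0 \<noteq> 0"
      "generically m (\<lambda>z. f z = p z / q z)"
    using assms(1) unfolding regular_at_def same_rational_function_iff by blast
  obtain p' q' where pq': "p' \<in> polyfun m" "q' \<in> polyfun m" "q' z0 \<noteq> 0"
      "generically m (\<lambda>z. g z = p' z / q' z)"
    using assms(2) unfolding regular_at_def same_rational_function_iff by blast
  have gen: "generically m (\<lambda>z. (f z = p z / q z \<and> g z = p' z / q' z) \<and> q z \<noteq> 0 \<and> q' z \<noteq> 0)"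
    by (intro generically_conj pq(4) pq'(4) generically_nonzero[OF pq(2,3)] generically_nonzero[OF pq'(2,3)])
  have q: "(\<lambda>z. q z * q' z) \<in> polyfun m" "q z0 * q' z0 \<noteq> 0"
    using pq pq' by (auto intro: polyfun_intros)
  have "(\<lambda>z. p z * q' z + p' z * q z) \<in> polyfun m" "(\<lambda>z. p z * p' z) \<in> polyfun m"
    using pq pq' by (auto intro!: polyfun_intros)
  moreover have "generically m (\<lambda>z. f z + g z = (p z * q' z + p' z * q z) / (q z * q' z))"
    using gen by (rule generically_mono) (simp add: field_simps)
  moreover have "generically m (\<lambda>z. f z * g z = (p z * p' z) / (q z * q' z))"
    using gen by (rule generically_mono) simp
  ultimately show "regular_at m (\<lambda>z. f z + g z) z0" "regular_at m (\<lambda>z. f z * g z) z0"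
    by (auto intro: regular_atI[OF _ q])
qed

lemma regular_at_const: "regular_at m (\<lambda>z. c) z0"
  by (intro regular_at_polyfun polyfun.const)

lemma regular_at_diff:
  assumes "regular_at m f z0" "regular_at m g z0"
  shows "regular_at m (\<lambda>z. f z - g z) z0"
  using regular_at_add[OF assms(1) regular_at_mult[OF regular_at_const[of m "-1"] assms(2)]] by simp

lemma regular_at_divide:
  "regular_at m f z0 \<Longrightarrow> q \<in> polyfun m \<Longrightarrow> q z0 \<noteq> 0 \<Longrightarrow> regular_at m (\<lambda>z. f z / q z) z0"
  using regular_at_mult[OF _ regular_at_inverse, of m f z0 q] by simp

lemma regular_at_sum:
  "(\<And>x. x \<in> A \<Longrightarrow> regular_at m (f x) z0) \<Longrightarrow> regular_at m (\<lambda>z. \<Sum>x\<in>A. f x z) z0"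
  by (induction A rule: infinite_finite_induct) (auto intro: regular_at_const regular_at_add)

section \<open>Folding over partially commuting lists\<close>

lemma fold_commute_one:
  assumes "\<And>x v. x \<in> set xs \<Longrightarrow> f x (f y v) = f y (f x v)"
  shows "fold f xs (f y v) = f y (fold f xs v)"
  using assms by (induction xs arbitrary: v) auto

text \<open>The entries with \<open>Q\<close> are brought to the front; each of them has to pass
  only those entries without \<open>Q\<close> that stand before it. The relation \<open>R\<close>
  records who stands before whom.\<close>

lemma fold_filter_split:
  assumes "sorted_wrt R xs"
    and "\<And>x y v. \<lbrakk>x \<in> set xs; y \<in> set xs; R x y; \<not> Q x; Q y\<rbrakk> \<Longrightarrow> f x (f y v) = f y (f x v)"
  shows "fold f xs v = fold f (filter (\<lambda>x. \<not> Q x) xs) (fold f (filter Q xs) v)"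
  using assms
proof (induction xs arbitrary: v)
  case (Cons x xs)
  have IH: "fold f xs v = fold f (filter (\<lambda>x. \<not> Q x) xs) (fold f (filter Q xs) v)" for v
    using Cons by (intro Cons.IH) auto
  show ?case
  proof (cases "Q x")
    case False
    have "fold f (filter Q xs) (f x v) = f x (fold f (filter Q xs) v)"
      using Cons.prems False by (intro fold_commute_one) (auto intro: Cons.prems(2)[symmetric])
    then show ?thesis using False by (simp add: IH)
  qed (simp add: IH)
qed simp

text \<open>Stable sorting by \<open>key\<close>: only pairs whose order in the list contradicts the
  order of their keys have to commute. The groups are split off one after the other.\<close>

lemma fold_by_key:
  assumes "sorted_wrt R xs" "sorted_wrt K ks" "distinct ks" "key ` set xs \<subseteq> set ks"
    and "\<And>x y v. \<lbrakk>x \<in> set xs; y \<in> set xs; R x y; K (key y) (key x)\<rbrakk> \<Longrightarrow> f x (f y v) = f y (f x v)"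
  shows "fold f xs v = fold (\<lambda>k. fold f (filter (\<lambda>x. key x = k) xs)) ks v"
  using assms
proof (induction ks arbitrary: xs v)
  case (Cons k ks)
  let ?ys = "filter (\<lambda>x. key x \<noteq> k) xs"
  have "fold f xs v = fold f ?ys (fold f (filter (\<lambda>x. key x = k) xs) v)"
  proof (rule fold_filter_split[OF Cons.prems(1)])
    fix x y v assume "x \<in> set xs" "y \<in> set xs" "R x y" "key x \<noteq> k" "key y = k"
    then show "f x (f y v) = f y (f x v)"
      using Cons.prems by (intro Cons.prems(5)) auto
  qed
  also have "\<dots> = fold (\<lambda>k. fold f (filter (\<lambda>x. key x = k) ?ys)) ks (fold f (filter (\<lambda>x. key x = k) xs) v)"
    using Cons.prems by (intro Cons.IH) (auto simp: sorted_wrt_filter)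
  also have "\<dots> = fold (\<lambda>k. fold f (filter (\<lambda>x. key x = k) xs)) ks (fold f (filter (\<lambda>x. key x = k) xs) v)"
  proof (rule fold_cong[OF refl refl])
    fix l assume "l \<in> set ks"
    then have "l \<noteq> k" using Cons.prems by auto
    then have "filter (\<lambda>x. key x = l) ?ys = filter (\<lambda>x. key x = l) xs"
      by (auto intro: filter_cong)
    then show "fold f (filter (\<lambda>x. key x = l) ?ys) = fold f (filter (\<lambda>x. key x = l) xs)" by simp
  qed
  finally show ?case by simp
qed simp

text \<open>A composition applies its last factor first, while \<open>fold\<close> starts with the
  head; hence the reversal. \<open>C_op\<close>, whose list is already reversed, becomes a
  \<open>fold\<close> over \<open>C_pairs\<close> itself.\<close>

lemma ordered_prod_fold: "ordered_prod (map f xs) v = fold f (rev xs) v"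
  unfolding ordered_prod_def by (induction xs) (simp_all add: comp_def foldr_conv_fold)

section \<open>Operators on pairs of tensor factors\<close>

text \<open>The Gram matrix of the bilinear form with its arguments exchanged: this is the form at
  (e_j, e_i). Extension by 0 makes the coordinate formula of \<open>P_tilde_op\<close> true for
  arbitrary index functions.\<close>

definition form :: "lie_type \<Rightarrow> nat \<Rightarrow> nat \<Rightarrow> nat \<Rightarrow> complex" where
  "form g n i j = (if i \<in> {1..n} \<and> j \<in> {1..n} \<and> i = tilde n j then theta g n j else 0)"

lemma tilde_in: "i \<in> {1..n} \<Longrightarrow> tilde n i \<in> {1..n}"
  and tilde_tilde: "i \<in> {1..n} \<Longrightarrow> tilde n (tilde n i) = i"
  by (auto simp: tilde_def)

lemma tilde_eq_iff: "i \<in> {1..n} \<Longrightarrow> j \<in> {1..n} \<Longrightarrow> tilde n i = tilde n j \<longleftrightarrow> i = j"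
  by (auto simp: tilde_def)

lemma theta_square: "theta g n i * theta g n i = 1"
  by (simp add: theta_def)

lemma theta_tilde:
  assumes "g = SP \<longrightarrow> even n" "i \<in> {1..n}"
  shows "theta g n (tilde n i) = (if g = SP then - theta g n i else theta g n i)"
  using assms by (auto simp: theta_def tilde_def elim!: evenE)

lemma form_swap:
  assumes "g = SP \<longrightarrow> even n"
  shows "form g n i j = (if g = SP then - form g n j i else form g n j i)"
  using theta_tilde[OF assms, of j] tilde_tilde[of i n] tilde_tilde[of j n]
  by (auto simp: form_def)

text \<open>Up to the relabelling \<open>tilde\<close>, the signs \<open>theta\<close> invert the
  Gram matrix, because they square to 1. In the sums below a summation index thereby collapses to
  the one value paired with \<open>i\<close>.\<close>

lemma sum_theta_form:
  assumes "i \<in> {1..n}"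
  shows "(\<Sum>x\<in>{1..n}. theta g n x * form g n i x * \<phi> x) = \<phi> (tilde n i)"
proof -
  have "(\<Sum>x\<in>{1..n}. theta g n x * form g n i x * \<phi> x) = (\<Sum>x\<in>{1..n}. if tilde n i = x then \<phi> x else 0)"
    using assms tilde_tilde[of _ n] by (intro sum.cong) (auto simp: form_def theta_square)
  then show ?thesis using tilde_in[OF assms] by simp
qed

lemma sum_theta_form':
  assumes "j \<in> {1..n}"
  shows "(\<Sum>x\<in>{1..n}. theta g n x * form g n (tilde n x) j * \<phi> x) = \<phi> j"
proof -
  have "(\<Sum>x\<in>{1..n}. theta g n x * form g n (tilde n x) j * \<phi> x) = (\<Sum>x\<in>{1..n}. if j = x then \<phi> x else 0)"
    using assms tilde_in[of _ n]
    by (intro sum.cong) (auto simp: form_def theta_square tilde_eq_iff[unfolded atLeastAtMost_iff])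
  then show ?thesis using assms by simp
qed

section \<open>Coordinate formulas for P and P_tilde\<close>

lemma P_op_eq:
  assumes "p \<noteq> q"
  shows "P_op n p q v I = (if I p \<in> {1..n} \<and> I q \<in> {1..n} then v (I \<circ> transpose p q) else 0)"
proof -
  have "P_op n p q v I = (\<Sum>i\<in>{1..n}. \<Sum>j\<in>{1..n}. if I p = i \<and> I q = j then v (I(p := j, q := i)) else 0)"
    unfolding P_op_def tensor_act_def unit_matrix_def using assms
    by (intro sum.cong refl)
       (auto simp: sum.delta if_distrib[of "\<lambda>x. x * _"] cong: if_cong)
  also have "\<dots> = (\<Sum>i\<in>{1..n}. if I p = i then (\<Sum>j\<in>{1..n}. if I q = j then v (I(p := j, q := i)) else 0) else 0)"
    by (intro sum.cong refl) auto
  also have "\<dots> = (if I p \<in> {1..n} \<and> I q \<in> {1..n} then v (I(p := I q, q := I p)) else 0)"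
    by simp
  also have "I(p := I q, q := I p) = I \<circ> transpose p q"
    using assms by (auto simp: transpose_def)
  finally show ?thesis .
qed

text \<open>On its two tensor factors \<open>P_tilde_op\<close> has rank one: it contracts them with
  the invariant form and multiplies by the invariant tensor. The double sum over matrix units
  therefore separates.\<close>

lemma P_tilde_op_eq:
  assumes "p \<noteq> q"
  shows "P_tilde_op g n p q v I =
    form g n (I p) (I q) * (\<Sum>x\<in>{1..n}. theta g n x * v (I(p := tilde n x, q := x)))"
proof -
  have act: "tensor_act n p (unit_matrix_tilde g n i j) (tensor_act n q (unit_matrix j i) v) I =
      (if I q = j then if I p = tilde n j then theta g n j * (theta g n i * v (I(p := tilde n i, q := i))) else 0 else 0)"
    if "i \<in> {1..n}" for i j
  proof -
    have "(\<Sum>k\<in>{1..n}. (if I p = tilde n j \<and> k = tilde n i then theta g n i * theta g n j else 0) * f k)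
        = (if I p = tilde n j then theta g n i * theta g n j * f (tilde n i) else 0)" for f
      using tilde_in[OF that]
      by (auto simp: if_distrib[of "\<lambda>x. x * _"] cong: if_cong)
    moreover have "(\<Sum>l\<in>{1..n}. (if I q = j \<and> l = i then 1 else 0) * f l) = (if I q = j then f i else 0)"
      for f :: "nat \<Rightarrow> complex"
      using that by (auto simp: if_distrib[of "\<lambda>x. x * _"] cong: if_cong)
    ultimately show ?thesis
      unfolding tensor_act_def unit_matrix_def unit_matrix_tilde_def using assms
      by (simp add: if_distrib[of "\<lambda>x. _ * x"] cong: if_cong)
  qed
  have "P_tilde_op g n p q v I = (\<Sum>i\<in>{1..n}. \<Sum>j\<in>{1..n}. if I q = j then if I p = tilde n j then theta g n j * (theta g n i * v (I(p := tilde n i, q := i))) else 0 else 0)"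
    unfolding P_tilde_op_def using act by (intro sum.cong refl) auto
  also have "\<dots> = (\<Sum>i\<in>{1..n}. form g n (I p) (I q) * (theta g n i * v (I(p := tilde n i, q := i))))"
    using tilde_in[of "I q" n] by (intro sum.cong refl) (auto simp: form_def)
  finally show ?thesis by (simp add: sum_distrib_left)
qed

text \<open>Antisymmetry is demanded at every function \<open>I\<close>, not only at multi-indices,
  so that it can be used without range conditions.\<close>

definition alternating :: "nat set \<Rightarrow> tensor \<Rightarrow> bool" where
  "alternating S v \<longleftrightarrow> (\<forall>p\<in>S. \<forall>q\<in>S. p \<noteq> q \<longrightarrow> (\<forall>I. v (I \<circ> transpose p q) = - v I))"

lemma alternatingD:
  "alternating S v \<Longrightarrow> p \<in> S \<Longrightarrow> q \<in> S \<Longrightarrow> p \<noteq> q \<Longrightarrow> v (I \<circ> transpose p q) = - v I"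
  by (simp add: alternating_def)

lemma alternating_subset: "alternating S v \<Longrightarrow> T \<subseteq> S \<Longrightarrow> alternating T v"
  by (auto simp: alternating_def)

lemma alternating_lincomb:
  "alternating S v \<Longrightarrow> alternating S w \<Longrightarrow> alternating S (\<lambda>I. c * v I + d * w I)"
  by (auto simp: alternating_def)

lemma multi_indices_upd:
  "I \<in> multi_indices n N \<Longrightarrow> p \<in> {1..N} \<Longrightarrow> x \<in> {1..n} \<Longrightarrow> I(p := x) \<in> multi_indices n N"
  unfolding multi_indices_def PiE_def Pi_def extensional_def by auto

lemma multi_indices_range: "I \<in> multi_indices n N \<Longrightarrow> p \<in> {1..N} \<Longrightarrow> I p \<in> {1..n}"
  unfolding multi_indices_def by blast

lemma multi_indices_upd2:
  assumes "I(p := x, q := y) \<in> multi_indices n N" "p \<in> {1..N}" "q \<in> {1..N}" "p \<noteq> q" "I p \<in> {1..n}" "I q \<in> {1..n}"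
  shows "I \<in> multi_indices n N"
proof -
  have "(I(p := x, q := y))(p := I p, q := I q) \<in> multi_indices n N"
    by (rule multi_indices_upd[OF multi_indices_upd[OF assms(1,2,5)] assms(3,6)])
  also have "(I(p := x, q := y))(p := I p, q := I q) = I" using assms(4) by auto
  finally show ?thesis .
qed

lemma comp_transpose_eq: "p \<noteq> q \<Longrightarrow> I \<circ> transpose p q = I(p := I q, q := I p)"
  by (auto simp: transpose_def)

text \<open>What the decomposition into blocks and the regularity arguments use of P and P_tilde
  alike. \<open>transport\<close> is equivariance under permutations of the tensor factors;
  \<open>local\<close> gives each output coordinate as a fixed finite combination of input
  coordinates, from which regularity is inherited.\<close>

locale pair_operator =
  fixes Q :: "nat \<Rightarrow> nat \<Rightarrow> tensor \<Rightarrow> tensor" and n :: nat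
  assumes lincomb: "p \<noteq> q \<Longrightarrow> Q p q (\<lambda>I. c * v I + d * w I) = (\<lambda>I. c * Q p q v I + d * Q p q w I)"
    and sym: "p \<noteq> q \<Longrightarrow> Q p q = Q q p"
    and transport: "p \<noteq> q \<Longrightarrow> Q p q v (I \<circ> transpose r s) =
      Q (transpose r s p) (transpose r s q) (\<lambda>I. v (I \<circ> transpose r s)) I"
    and commute: "p \<noteq> q \<Longrightarrow> r \<noteq> s \<Longrightarrow> {p, q} \<inter> {r, s} = {} \<Longrightarrow> Q p q (Q r s v) = Q r s (Q p q v)"
    and in_tensor_space: "p \<noteq> q \<Longrightarrow> p \<in> {1..N} \<Longrightarrow> q \<in> {1..N} \<Longrightarrow> v \<in> tensor_space n N \<Longrightarrow> Q p q v \<in> tensor_space n N"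
    and local: "p \<noteq> q \<Longrightarrow> p \<in> {1..N} \<Longrightarrow> q \<in> {1..N} \<Longrightarrow> I \<in> multi_indices n N \<Longrightarrow>
      \<exists>c K. K ` {1..n} \<subseteq> multi_indices n N \<and> (\<forall>v. Q p q v I = (\<Sum>x\<in>{1..n}. c x * v (K x)))"

lemma swap_upd:
  assumes "{p, q} \<inter> {r, s} = {}"
  shows "(I(p := x, q := y))(r := x', s := y') = (I(r := x', s := y'))(p := x, q := y)"
  using assms by (auto simp: fun_eq_iff)

lemma upd_comp_transpose: "(I \<circ> transpose r s)(p := x) = I(transpose r s p := x) \<circ> transpose r s"
  by (auto simp: fun_eq_iff transpose_def)

lemma pair_operator_P: "pair_operator (P_op n) n"
proof
  fix p q v and I :: "nat \<Rightarrow> nat" and r s assume *: "p \<noteq> (q::nat)"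
  then have **: "transpose r s p \<noteq> transpose r s q" by (metis transpose_involutory)
  have "I \<circ> transpose r s \<circ> transpose p q = I \<circ> transpose (transpose r s p) (transpose r s q) \<circ> transpose r s"
    by (auto simp: fun_eq_iff transpose_def)
  then show "P_op n p q v (I \<circ> transpose r s) =
      P_op n (transpose r s p) (transpose r s q) (\<lambda>I. v (I \<circ> transpose r s)) I"
    unfolding P_op_eq[OF *] P_op_eq[OF **] by (simp only: o_apply)
next
  fix p q r s :: nat and v assume *: "p \<noteq> q" "r \<noteq> s" "{p, q} \<inter> {r, s} = {}"
  show "P_op n p q (P_op n r s v) = P_op n r s (P_op n p q v)"
  proof
    fix I :: "nat \<Rightarrow> nat"
    have "I \<circ> transpose p q \<circ> transpose r s = I \<circ> transpose r s \<circ> transpose p q"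
      using * by (auto simp: fun_eq_iff transpose_def)
    moreover have "(I \<circ> transpose p q) r = I r" "(I \<circ> transpose p q) s = I s"
        "(I \<circ> transpose r s) p = I p" "(I \<circ> transpose r s) q = I q"
      using * by (auto simp: transpose_def)
    ultimately show "P_op n p q (P_op n r s v) I = P_op n r s (P_op n p q v) I"
      by (simp only: P_op_eq[OF *(1)] P_op_eq[OF *(2)] split: if_split) blast
  qed
next
  fix p q N v assume *: "p \<noteq> q" "p \<in> {1..N}" "q \<in> {1..N}" "v \<in> tensor_space n N"
  have "v (I \<circ> transpose p q) = 0" if "I \<notin> multi_indices n N" "I p \<in> {1..n}" "I q \<in> {1..n}" for I
  proof -
    have "I \<circ> transpose p q \<notin> multi_indices n N"
      using multi_indices_upd2[OF _ *(2,3,1) that(2,3)] that(1) *(1) by (metis comp_transpose_eq)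
    then show ?thesis using *(4) by (simp add: tensor_space_def)
  qed
  then show "P_op n p q v \<in> tensor_space n N"
    unfolding tensor_space_def P_op_eq[OF *(1)] by auto
next
  fix p q N and I :: "nat \<Rightarrow> nat" assume *: "p \<noteq> q" "p \<in> {1..N}" "q \<in> {1..N}" "I \<in> multi_indices n N"
  have r: "I p \<in> {1..n}" "I q \<in> {1..n}" using multi_indices_range[OF *(4)] *(2,3) by blast+
  have "I \<circ> transpose p q \<in> multi_indices n N"
    unfolding comp_transpose_eq[OF *(1)]
    by (rule multi_indices_upd[OF multi_indices_upd[OF *(4,2) r(2)] *(3) r(1)])
  moreover have "P_op n p q v I = (\<Sum>x\<in>{1..n}. (if x = I p then 1 else 0) * v (I \<circ> transpose p q))" for v
    unfolding sum_distrib_right[symmetric] using r by (simp add: P_op_eq[OF *(1)])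
  ultimately show "\<exists>c K. K ` {1..n} \<subseteq> multi_indices n N \<and> (\<forall>v. P_op n p q v I = (\<Sum>x\<in>{1..n}. c x * v (K x)))"
    by (intro exI[of _ "\<lambda>x. if x = I p then 1 else 0"] exI[of _ "\<lambda>_. I \<circ> transpose p q"]) auto
qed (auto simp: fun_eq_iff P_op_eq transpose_commute)

lemma pair_operator_P_tilde:
  assumes "g = SP \<longrightarrow> even n"
  shows "pair_operator (P_tilde_op g n) n"
proof
  fix p q c v d w assume "p \<noteq> (q::nat)"
  then show "P_tilde_op g n p q (\<lambda>I. c * v I + d * w I) = (\<lambda>I. c * P_tilde_op g n p q v I + d * P_tilde_op g n p q w I)"
    by (simp add: fun_eq_iff P_tilde_op_eq algebra_simps sum.distrib sum_distrib_left)
next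
  fix p q :: nat assume pq: "p \<noteq> q"
  show "P_tilde_op g n p q = P_tilde_op g n q p"
  proof (intro ext)
    fix v and I :: "nat \<Rightarrow> nat"
    \<comment> \<open>Substituting \<open>tilde n x\<close> for \<open>x\<close> exchanges the two
      factors. In the symplectic case this costs a sign, and so does exchanging the arguments of
      \<open>form\<close>; the two signs cancel.\<close>
    have "(\<Sum>x\<in>{1..n}. theta g n x * v (I(p := tilde n x, q := x))) =
        (\<Sum>x\<in>{1..n}. theta g n (tilde n x) * v (I(q := tilde n x, p := x)))"
      by (rule sum.reindex_bij_witness[of _ "tilde n" "tilde n"])
         (use pq in \<open>auto simp: tilde_tilde tilde_in[unfolded atLeastAtMost_iff One_nat_def] fun_upd_twist tilde_in\<close>)
    also have "\<dots> = (\<Sum>x\<in>{1..n}. (if g = SP then - theta g n x else theta g n x) * v (I(q := tilde n x, p := x)))"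
      using theta_tilde[OF assms] by (intro sum.cong) auto
    also have "\<dots> = (if g = SP then -1 else 1) * (\<Sum>x\<in>{1..n}. theta g n x * v (I(q := tilde n x, p := x)))"
      by (auto simp: sum_distrib_left sum_negf)
    finally show "P_tilde_op g n p q v I = P_tilde_op g n q p v I"
      using pq form_swap[OF assms, of "I p" "I q"] by (simp add: P_tilde_op_eq)
  qed
next
  fix p q v and I :: "nat \<Rightarrow> nat" and r s assume *: "p \<noteq> (q::nat)"
  then have "transpose r s p \<noteq> transpose r s q" by (metis transpose_involutory)
  then show "P_tilde_op g n p q v (I \<circ> transpose r s) =
      P_tilde_op g n (transpose r s p) (transpose r s q) (\<lambda>I. v (I \<circ> transpose r s)) I"
    using * by (simp add: P_tilde_op_eq upd_comp_transpose del: fun_upd_comp)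
next
  fix p q r s :: nat and v assume *: "p \<noteq> q" "r \<noteq> s" "{p, q} \<inter> {r, s} = {}"
  have "(\<Sum>x\<in>{1..n}. theta g n x * (\<Sum>y\<in>{1..n}. theta g n y * v (I(p := tilde n x, q := x, r := tilde n y, s := y)))) =
     (\<Sum>x\<in>{1..n}. theta g n x * (\<Sum>y\<in>{1..n}. theta g n y * v (I(r := tilde n x, s := x, p := tilde n y, q := y))))" for I
    unfolding sum_distrib_left
    by (subst sum.swap, intro sum.cong refl) (simp add: swap_upd[OF *(3)] mult_ac)
  note swap = this
  have pull: "(\<Sum>x\<in>{1..n}. theta g n x * (c * f x)) = c * (\<Sum>x\<in>{1..n}. theta g n x * f x)" for c f
    by (simp add: sum_distrib_left mult.left_commute)
  have upd: "(I(p := x, q := y)) r = I r" "(I(p := x, q := y)) s = I s"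
      "(I(r := x, s := y)) p = I p" "(I(r := x, s := y)) q = I q" for I :: "nat \<Rightarrow> nat" and x y
    using * by auto
  show "P_tilde_op g n p q (P_tilde_op g n r s v) = P_tilde_op g n r s (P_tilde_op g n p q v)"
  proof
    fix I :: "nat \<Rightarrow> nat"
    show "P_tilde_op g n p q (P_tilde_op g n r s v) I = P_tilde_op g n r s (P_tilde_op g n p q v) I"
      by (simp only: P_tilde_op_eq[OF *(1)] P_tilde_op_eq[OF *(2)] upd pull swap mult.left_commute)
  qed
next
  fix p q N v assume *: "p \<noteq> q" "p \<in> {1..N}" "q \<in> {1..N}" "v \<in> tensor_space n N"
  show "P_tilde_op g n p q v \<in> tensor_space n N"
    unfolding tensor_space_def
  proof (intro CollectI allI impI)
    fix I :: "nat \<Rightarrow> nat" assume I: "I \<notin> multi_indices n N"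
    show "P_tilde_op g n p q v I = 0"
    proof (cases "form g n (I p) (I q) = 0")
      case False
      then have "I p \<in> {1..n}" "I q \<in> {1..n}" by (auto simp: form_def split: if_splits)
      then have "I(p := x, q := y) \<notin> multi_indices n N" for x y
        using multi_indices_upd2[OF _ *(2,3,1)] I by blast
      then have "v (I(p := x, q := y)) = 0" for x y
        using *(4) by (simp add: tensor_space_def)
      then show ?thesis by (simp add: P_tilde_op_eq[OF *(1)])
    qed (simp add: P_tilde_op_eq[OF *(1)])
  qed
next
  fix p q N and I :: "nat \<Rightarrow> nat" assume *: "p \<noteq> q" "p \<in> {1..N}" "q \<in> {1..N}" "I \<in> multi_indices n N"
  then have "(\<lambda>x. I(p := tilde n x, q := x)) ` {1..n} \<subseteq> multi_indices n N"
    by (auto intro!: multi_indices_upd tilde_in[unfolded atLeastAtMost_iff One_nat_def])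
  then show "\<exists>c K. K ` {1..n} \<subseteq> multi_indices n N \<and> (\<forall>v. P_tilde_op g n p q v I = (\<Sum>x\<in>{1..n}. c x * v (K x)))"
    by (intro exI[of _ "\<lambda>x. form g n (I p) (I q) * theta g n x"] exI[of _ "\<lambda>x. I(p := tilde n x, q := x)"])
       (simp add: P_tilde_op_eq[OF *(1)] sum_distrib_left mult_ac)
qed

text \<open>The Brauer relation P_tilde_pr P_tilde_pq = P_tilde_pr P_qr, followed by P_qr w = - w.
  The outer operator survives, so a product can be fused if its denominators rise.\<close>

lemma P_tilde_fuse:
  assumes w: "w \<in> tensor_space n N" "\<And>I. w (I \<circ> transpose q r) = - w I"
    and pqr: "p \<noteq> q" "p \<noteq> r" "q \<noteq> r" "p \<in> {1..N}" "q \<in> {1..N}" "r \<in> {1..N}"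
  shows "P_tilde_op g n p r (P_tilde_op g n p q w) = (\<lambda>I. - P_tilde_op g n p r w I)"
proof
  fix I :: "nat \<Rightarrow> nat"
  let ?S = "\<lambda>x. \<Sum>y\<in>{1..n}. theta g n y * w (I(r := x, p := tilde n y, q := y))"
  have "P_tilde_op g n p r (P_tilde_op g n p q w) I =
      form g n (I p) (I r) * (\<Sum>x\<in>{1..n}. theta g n x * form g n (tilde n x) (I q) * ?S x)"
    using pqr by (simp add: P_tilde_op_eq fun_upd_twist[of p] mult_ac)
  also have "\<dots> = - P_tilde_op g n p r w I"
  proof (cases "I q \<in> {1..n}")
    case True
    have "I(r := I q, p := tilde n y, q := y) = I(p := tilde n y, r := y) \<circ> transpose q r" for y
      using pqr by (auto simp: fun_eq_iff transpose_def)
    then show ?thesis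
      using pqr True w(2) by (simp add: sum_theta_form' P_tilde_op_eq sum_negf del: One_nat_def)
  next
    case False
    \<comment> \<open>An out-of-range index in factor \<open>q\<close> is untouched by both updates.
      The right side vanishes because \<open>w\<close> lies in the tensor space, the left side
      because \<open>form\<close> is extended by 0.\<close>
    have "I(p := x, r := y) \<notin> multi_indices n N" for x y
      using multi_indices_range[of "I(p := x, r := y)" n N q] pqr False by auto
    then have "w (I(p := x, r := y)) = 0" for x y using w(1) by (simp add: tensor_space_def)
    moreover have "form g n i (I q) = 0" for i using False unfolding form_def by auto
    ultimately show ?thesis using pqr by (simp add: P_tilde_op_eq)
  qed
  finally show "P_tilde_op g n p r (P_tilde_op g n p q w) I = - P_tilde_op g n p r w I" .
qed

text \<open>Here the relation is P_pr P_pq = P_pq P_qr. The inner operator survives, and fusion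
  needs falling denominators instead.\<close>

lemma P_fuse:
  assumes w: "w \<in> tensor_space n N" "\<And>I. w (I \<circ> transpose q r) = - w I"
    and pqr: "p \<noteq> q" "p \<noteq> r" "q \<noteq> r" "p \<in> {1..N}" "q \<in> {1..N}" "r \<in> {1..N}"
  shows "P_op n p r (P_op n p q w) = (\<lambda>I. - P_op n p q w I)"
proof
  fix I :: "nat \<Rightarrow> nat"
  have "I \<circ> transpose p r \<circ> transpose p q = I \<circ> transpose p q \<circ> transpose q r"
    using pqr by (auto simp: fun_eq_iff transpose_def)
  moreover have "w (I \<circ> transpose p q) = 0" if "I r \<notin> {1..n}"
  proof -
    have "I \<circ> transpose p q \<notin> multi_indices n N"
      using multi_indices_range[of "I \<circ> transpose p q" n N r] that pqr by auto
    then show ?thesis using w(1) by (simp add: tensor_space_def)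
  qed
  ultimately show "P_op n p r (P_op n p q w) I = - P_op n p q w I"
    using pqr w(2) by (auto simp: P_op_eq)
qed

lemma P_tilde_alternating_SO:
  assumes "p \<noteq> q" "\<And>I. w (I \<circ> transpose p q) = - w I"
  shows "P_tilde_op SO n p q w = (\<lambda>I. 0)"
proof
  fix I :: "nat \<Rightarrow> nat"
  let ?S = "\<Sum>x\<in>{1..n}. w (I(p := tilde n x, q := x))"
  have "?S = (\<Sum>x\<in>{1..n}. w (I(p := x, q := tilde n x)))"
    by (rule sum.reindex_bij_witness[of _ "tilde n" "tilde n"])
       (auto simp: tilde_tilde tilde_in[unfolded atLeastAtMost_iff One_nat_def])
  also have "I(p := x, q := tilde n x) = I(p := tilde n x, q := x) \<circ> transpose p q" for x
    using assms(1) by (auto simp: fun_eq_iff transpose_def)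
  then have "(\<Sum>x\<in>{1..n}. w (I(p := x, q := tilde n x))) = - ?S"
    using assms(2) by (simp add: sum_negf)
  finally have "?S = 0" by simp
  then show "P_tilde_op SO n p q w I = 0"
    using assms(1) by (simp add: P_tilde_op_eq theta_def)
qed

section \<open>Antisymmetrisation\<close>

text \<open>A signed sum over coset representatives of the permutations of \<open>S\<close> in those
  of \<open>insert a S\<close>; on functions that already alternate on \<open>S\<close> it is the
  full antisymmetrisation up to a scalar.\<close>

definition antisymmetrise :: "nat \<Rightarrow> nat set \<Rightarrow> tensor \<Rightarrow> tensor" where
  "antisymmetrise a S h = (\<lambda>Z. h Z - (\<Sum>b\<in>S. h (Z \<circ> transpose a b)))"

text \<open>The transposition (a c) exchanges the identity term with the c term, and for the other b
  the relation (a c)(a b) = (a b)(b c) moves a sign into \<open>h\<close>. A transposition inside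
  \<open>S\<close> permutes the terms.\<close>

lemma alternating_antisymmetrise:
  assumes S: "finite S" "a \<notin> S" and h: "alternating S h"
  shows "alternating (insert a S) (antisymmetrise a S h)"
proof -
  have ac: "antisymmetrise a S h (Z \<circ> transpose a c) = - antisymmetrise a S h Z" if "c \<in> S" for c Z
  proof -
    have "(\<Sum>b\<in>S - {c}. h (Z \<circ> transpose a c \<circ> transpose a b)) = (\<Sum>b\<in>S - {c}. - h (Z \<circ> transpose a b))"
    proof (rule sum.cong[OF refl])
      fix b assume b: "b \<in> S - {c}"
      have "Z \<circ> transpose a c \<circ> transpose a b = Z \<circ> transpose a b \<circ> transpose b c"
        using b that S(2) by (auto simp: fun_eq_iff transpose_def)
      then show "h (Z \<circ> transpose a c \<circ> transpose a b) = - h (Z \<circ> transpose a b)"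
        using b that by (simp only:) (rule alternatingD[OF h], auto)
    qed
    moreover have "Z \<circ> transpose a c \<circ> transpose a c = Z"
      by (auto simp: fun_eq_iff transpose_def)
    ultimately show ?thesis
      unfolding antisymmetrise_def using S(1) that by (simp add: sum.remove[of S c] sum_negf)
  qed
  have ac': "antisymmetrise a S h (Z \<circ> transpose c a) = - antisymmetrise a S h Z" if "c \<in> S" for c Z
    using ac[OF that, of Z] by (simp add: transpose_commute)
  have cd: "antisymmetrise a S h (Z \<circ> transpose c d) = - antisymmetrise a S h Z"
    if "c \<in> S" "d \<in> S" "c \<noteq> d" for c d Z
  proof -
    have "(\<Sum>b\<in>S. h (Z \<circ> transpose c d \<circ> transpose a b)) = (\<Sum>b\<in>S. - h (Z \<circ> transpose a b))"
    proof (rule sum.reindex_bij_witness[of _ "transpose c d" "transpose c d"])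
      fix b assume "b \<in> S"
      have "Z \<circ> transpose c d \<circ> transpose a b = Z \<circ> transpose a (transpose c d b) \<circ> transpose c d"
        using that S(2) by (auto simp: fun_eq_iff transpose_def)
      then show "- h (Z \<circ> transpose a (transpose c d b)) = h (Z \<circ> transpose c d \<circ> transpose a b)"
        using that by (simp add: alternatingD[OF h] del: o_apply)
    qed (use that in \<open>auto simp: transpose_def\<close>)
    moreover have "h (Z \<circ> transpose c d) = - h Z" using alternatingD[OF h] that by blast
    ultimately show ?thesis
      unfolding antisymmetrise_def by (simp add: sum_negf)
  qed
  show ?thesis unfolding alternating_def using ac ac' cd by auto
qed

text \<open>Two slots must share a value; exchanging them changes nothing and yet costs a
  sign.\<close>

lemma alternating_pigeonhole:
  assumes "alternating S f" "finite S" "n < card S" "\<And>i. i \<in> S \<Longrightarrow> Z i \<in> {1..n}"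
  shows "f Z = 0"
proof -
  have "\<not> inj_on Z S"
  proof
    assume "inj_on Z S"
    then have "card S \<le> card {1..n}" by (rule card_inj_on_le) (use assms(4) in auto)
    then show False using assms(3) by simp
  qed
  then obtain i j where ij: "i \<in> S" "j \<in> S" "i \<noteq> j" "Z i = Z j" by (auto simp: inj_on_def)
  then have "Z \<circ> transpose i j = Z" by (auto simp: fun_eq_iff transpose_def)
  then have "f Z = - f Z" using alternatingD[OF assms(1) ij(1-3), of Z] by simp
  then show ?thesis by simp
qed

lemma sum_PiE_insert:
  assumes "a \<notin> A"
  shows "(\<Sum>Y\<in>insert a A \<rightarrow>\<^sub>E B. G Y) = (\<Sum>x\<in>B. \<Sum>Y\<in>A \<rightarrow>\<^sub>E B. G (Y(a := x)))"
proof -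
  have "(\<Sum>Y\<in>insert a A \<rightarrow>\<^sub>E B. G Y) = (\<Sum>(x, Y)\<in>B \<times> (A \<rightarrow>\<^sub>E B). G (Y(a := x)))"
    unfolding PiE_insert_eq
    by (subst sum.reindex) (auto intro!: inj_combinator[OF assms, of "\<lambda>_. B", unfolded case_prod_unfold] simp: comp_def case_prod_unfold)
  then show ?thesis by (simp add: sum.cartesian_product)
qed

lemma sum_PiE_transpose:
  fixes B :: "'b set"
  assumes "a \<in> A" "b \<in> A"
  shows "(\<Sum>Y\<in>A \<rightarrow>\<^sub>E B. G Y) = (\<Sum>Y\<in>A \<rightarrow>\<^sub>E B. G (Y \<circ> transpose a b))"
proof -
  have "Y \<circ> transpose a b \<in> A \<rightarrow>\<^sub>E B" if "Y \<in> A \<rightarrow>\<^sub>E B" for Y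
    using that assms by (auto simp: PiE_def Pi_def extensional_def transpose_def)
  moreover have "Y \<circ> transpose a b \<circ> transpose a b = Y" for Y :: "_ \<Rightarrow> 'b"
    by (auto simp: fun_eq_iff transpose_def)
  ultimately show ?thesis
    by (intro sum.reindex_bij_witness[of _ "\<lambda>Y. Y \<circ> transpose a b" "\<lambda>Y. Y \<circ> transpose a b"]) simp_all
qed

lemma prod_transpose:
  assumes "a \<in> A" "b \<in> A"
  shows "(\<Prod>i\<in>A. f ((Y \<circ> transpose a b) i)) = (\<Prod>i\<in>A. f (Y i))"
  by (rule prod.reindex_bij_witness[of _ "transpose a b" "transpose a b"])
     (use assms in \<open>auto simp: transpose_def\<close>)

section \<open>A vanishing determinant\<close>

text \<open>Laplace expansion, one slot at a time. If \<open>f\<close> alternates on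
  \<open>B\<close> and depends on \<open>B\<close> alone, the result is up to a scalar the
  antisymmetrisation over \<open>{s..<s + p}\<close> and \<open>B\<close> of \<open>f\<close> times
  the product of the entries \<open>form g n (I i) (Z i)\<close>.\<close>

fun det_kernel :: "lie_type \<Rightarrow> nat \<Rightarrow> (nat \<Rightarrow> nat) \<Rightarrow> nat \<Rightarrow> nat set \<Rightarrow> tensor \<Rightarrow> nat \<Rightarrow> tensor" where
  "det_kernel g n I s B f 0 = f"
| "det_kernel g n I s B f (Suc p) = antisymmetrise (s + p) ({s..<s + p} \<union> B)
     (\<lambda>Z. form g n (I (s + p)) (Z (s + p)) * det_kernel g n I s B f p Z)"

lemma det_kernel_alternating:
  assumes "finite B" "{s..<s + p} \<inter> B = {}" "alternating B f"
  shows "alternating ({s..<s + p} \<union> B) (det_kernel g n I s B f p)"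
  using assms(2)
proof (induction p)
  case (Suc p)
  then have dis: "{s..<s + p} \<inter> B = {}" "s + p \<notin> B"
    unfolding disjoint_iff by simp_all
  have "alternating ({s..<s + p} \<union> B) (\<lambda>Z. form g n (I (s + p)) (Z (s + p)) * det_kernel g n I s B f p Z)"
    unfolding alternating_def
  proof (intro ballI impI allI)
    fix c d and Z :: "nat \<Rightarrow> nat" assume cd: "c \<in> {s..<s + p} \<union> B" "d \<in> {s..<s + p} \<union> B" "c \<noteq> d"
    then have "(Z \<circ> transpose c d) (s + p) = Z (s + p)" using dis by (auto simp: transpose_def)
    then show "form g n (I (s + p)) ((Z \<circ> transpose c d) (s + p)) * det_kernel g n I s B f p (Z \<circ> transpose c d) =
        - (form g n (I (s + p)) (Z (s + p)) * det_kernel g n I s B f p Z)"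
      unfolding alternatingD[OF Suc.IH[OF dis(1)] cd] by (simp only: mult_minus_right)
  qed
  then have "alternating (insert (s + p) ({s..<s + p} \<union> B)) (det_kernel g n I s B f (Suc p))"
    unfolding det_kernel.simps using assms(1) dis by (intro alternating_antisymmetrise) auto
  moreover have "insert (s + p) ({s..<s + p} \<union> B) = {s..<s + Suc p} \<union> B" by auto
  ultimately show ?case by (simp only:)
qed (use assms in simp)

lemma det_kernel_cong_rows:
  "(\<And>i. i \<in> {s..<s + p} \<Longrightarrow> I i = I' i) \<Longrightarrow> det_kernel g n I s B f p = det_kernel g n I' s B f p"
  by (induction p) auto

lemma det_kernel_cong:
  assumes "\<And>Z Z'. (\<And>i. i \<in> B \<Longrightarrow> Z i = Z' i) \<Longrightarrow> f Z = f Z'" "{s..<s + p} \<inter> B = {}"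
    and "\<And>i. i \<in> {s..<s + p} \<union> B \<Longrightarrow> Z i = Z' i"
  shows "det_kernel g n I s B f p Z = det_kernel g n I s B f p Z'"
  using assms(2,3)
proof (induction p arbitrary: Z Z')
  case 0
  then show ?case by (auto intro: assms(1))
next
  case (Suc p)
  have eq: "Z i = Z' i" if "i \<in> insert (s + p) ({s..<s + p} \<union> B)" for i
    by (rule Suc.prems(2)) (use that in auto)
  have dis: "{s..<s + p} \<inter> B = {}" "s + p \<notin> B"
    using Suc.prems(1) unfolding disjoint_iff by simp_all
  then have "det_kernel g n I s B f p Z = det_kernel g n I s B f p Z'"
    by (intro Suc.IH eq) auto
  moreover have "det_kernel g n I s B f p (Z \<circ> transpose (s + p) b) = det_kernel g n I s B f p (Z' \<circ> transpose (s + p) b)"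
    if "b \<in> {s..<s + p} \<union> B" for b
    using dis that by (intro Suc.IH) (auto simp: transpose_def intro: eq)
  ultimately show ?case
    by (auto simp: antisymmetrise_def eq intro!: arg_cong2[of _ _ _ _ "(-)"] sum.cong)
qed

lemma det_kernel_uminus:
  "det_kernel g n I s B (\<lambda>Z. - f Z) p = (\<lambda>Z. - det_kernel g n I s B f p Z)"
  by (induction p) (auto simp: antisymmetrise_def sum_negf)

text \<open>The first-segment arguments of \<open>w\<close> carry the summation indices
  \<open>Y\<close>, passed through \<open>tilde\<close> because \<open>Y\<close> labels lowered
  indices. The slots in \<open>B\<close> stay free, all others keep the values of
  \<open>I\<close>.\<close>

definition det_base :: "nat \<Rightarrow> nat set \<Rightarrow> tensor \<Rightarrow> (nat \<Rightarrow> nat) \<Rightarrow> nat set \<Rightarrow> (nat \<Rightarrow> nat) \<Rightarrow> tensor" where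
  "det_base n B w I A Y = (\<lambda>Z. w (\<lambda>i. if i \<in> A then tilde n (Y i) else if i \<in> B then Z i else I i))"

text \<open>Multiplied by (p + 1)!, the recursion for \<open>W\<close> asks for p + 1 copies of p! W
  p and one P_tilde term for each q in \<open>B\<close>. Expanding \<open>det_kernel\<close> along
  its new slot supplies exactly these; the count p + 1 accounts for the denominators of the
  recursion.\<close>

lemma det_representation:
  assumes w: "alternating {s..<s + a} w" "alternating B w"
    and B: "finite B" "{s..<s + a} \<inter> B = {}"
    and N: "{s..<s + a} \<subseteq> {1..N}" "B \<subseteq> {1..N}"
    and W: "W 0 = w"
      "\<And>p. p < a \<Longrightarrow> W (Suc p) = (\<lambda>I. W p I - (\<Sum>q\<in>B. P_tilde_op g n (s + p) q (W p) I) / of_nat (Suc p))"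
    and "p \<le> a" "I \<in> multi_indices n N"
  shows "W p I = (\<Sum>Y\<in>{s..<s + p} \<rightarrow>\<^sub>E {1..n}. (\<Prod>i\<in>{s..<s + p}. theta g n (Y i)) *
    det_kernel g n I s B (det_base n B w I {s..<s + p} Y) p (override_on I Y {s..<s + p})) / fact p"
  using assms(9,10)
proof (induction p arbitrary: I)
  case 0
  have "(\<lambda>i. if i \<in> B then I i else I i) = I" by auto
  then show ?case by (simp add: W(1) det_base_def)
next
  case (Suc p)
  let ?A = "{s..<s + p}" and ?a = "s + p"
  let ?A' = "insert ?a ?A"
  have A': "{s..<s + Suc p} = ?A'" by auto
  have aA: "?a \<notin> ?A" and aB: "?a \<notin> B" and AB: "?A \<inter> B = {}" and a_in: "?a \<in> {1..N}"
    using Suc.prems(1) B(2) N(1) unfolding disjoint_iff by (simp_all add: subset_iff)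
  have Ia: "I ?a \<in> {1..n}" using multi_indices_range[OF Suc.prems(2) a_in] .
  let ?th = "\<lambda>A Y. \<Prod>i\<in>A. theta g n (Y i)"
  let ?f = "\<lambda>I A Y. det_base n B w I A Y"
  let ?D = "\<lambda>I A Y Z. det_kernel g n I s B (?f I A Y) p Z"
  have base_cong: "?f I A Y Z = ?f I A Y Z'" if "\<And>i. i \<in> B \<Longrightarrow> Z i = Z' i" for I A Y Z Z'
    unfolding det_base_def by (rule arg_cong[where f = w]) (use that in auto)
  have D_cong: "?D J A Y Z = ?D J A Y Z'" if "\<And>i. i \<in> ?A \<union> B \<Longrightarrow> Z i = Z' i" for J A Y Z Z'
    by (rule det_kernel_cong[OF base_cong AB that])
  have th: "?th ?A' (Y(?a := x)) = theta g n x * ?th ?A Y" for Y x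
  proof -
    have "?th ?A (Y(?a := x)) = ?th ?A Y" by (rule prod.cong) (use aA in auto)
    then show ?thesis using aA by simp
  qed
  let ?G = "\<lambda>b Y. ?th ?A' Y * (form g n (I ?a) (override_on I Y ?A' b) * ?D I ?A' Y (override_on I Y ?A' \<circ> transpose ?a b))"
  have IH: "fact p * W p J = (\<Sum>Y\<in>?A \<rightarrow>\<^sub>E {1..n}. ?th ?A Y * ?D J ?A Y (override_on J Y ?A))"
    if "J \<in> multi_indices n N" for J
    using Suc.IH[OF _ that] Suc.prems(1) by simp
  have upd: "?D I ?A' (Y(?a := x)) Z = ?D (I(?a := tilde n x, q := y)) ?A Y Z" if "q \<in> B" for Y x y q Z
  proof -
    have "?f I ?A' (Y(?a := x)) = ?f (I(?a := tilde n x, q := y)) ?A Y"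
      unfolding det_base_def by (intro ext arg_cong[where f = w]) (use that aA aB in auto)
    moreover have "det_kernel g n I s B f p = det_kernel g n (I(?a := tilde n x, q := y)) s B f p" for f
      by (rule det_kernel_cong_rows) (use that AB in auto)
    ultimately show ?thesis by simp
  qed
  \<comment> \<open>Identity term: \<open>theta\<close> and \<open>form\<close> contract, and the
    argument \<open>?a\<close> of \<open>w\<close> gets back the value \<open>I ?a\<close>.\<close>
  have first: "(\<Sum>Y\<in>?A' \<rightarrow>\<^sub>E {1..n}. ?G ?a Y) = fact p * W p I"
  proof -
    let ?h = "\<lambda>Y y. ?th ?A Y * det_kernel g n I s B (\<lambda>Z. w (\<lambda>i. if i \<in> ?A then tilde n (Y i) else if i \<in> B then Z i else (I(?a := y)) i)) p (override_on I Y ?A)"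
    have "(\<Sum>Y\<in>?A' \<rightarrow>\<^sub>E {1..n}. ?G ?a Y) = (\<Sum>x\<in>{1..n}. \<Sum>Y\<in>?A \<rightarrow>\<^sub>E {1..n}. ?G ?a (Y(?a := x)))"
      by (rule sum_PiE_insert[OF aA])
    also have "\<dots> = (\<Sum>x\<in>{1..n}. \<Sum>Y\<in>?A \<rightarrow>\<^sub>E {1..n}. theta g n x * form g n (I ?a) x * ?h Y (tilde n x))"
    proof (intro sum.cong refl)
      fix x Y
      have e1: "?D I ?A' (Y(?a := x)) (override_on I (Y(?a := x)) ?A' \<circ> transpose ?a ?a) = ?D I ?A' (Y(?a := x)) (override_on I Y ?A)"
        by (rule D_cong) (use aA aB in \<open>auto simp: override_on_def\<close>)
      have e2: "?f I ?A' (Y(?a := x)) = (\<lambda>Z. w (\<lambda>i. if i \<in> ?A then tilde n (Y i) else if i \<in> B then Z i else (I(?a := tilde n x)) i))"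
        unfolding det_base_def by (intro ext arg_cong[where f = w]) (use aA aB in auto)
      note e1[unfolded e2]
      moreover have "override_on I (Y(?a := x)) ?A' ?a = x" by (simp add: override_on_def)
      ultimately show "?G ?a (Y(?a := x)) = theta g n x * form g n (I ?a) x * ?h Y (tilde n x)"
        unfolding th e2 by (simp only: mult_ac)
    qed
    also have "\<dots> = (\<Sum>Y\<in>?A \<rightarrow>\<^sub>E {1..n}. ?h Y (tilde n (tilde n (I ?a))))"
      by (subst sum.swap) (intro sum.cong refl sum_theta_form[OF Ia])
    also have "\<dots> = fact p * W p I"
      unfolding IH[OF Suc.prems(2)] tilde_tilde[OF Ia] fun_upd_triv det_base_def ..
    finally show ?thesis .
  qed
  \<comment> \<open>Terms with b in the first segment: exchanging the summation indices at
    \<open>?a\<close> and \<open>b\<close> costs a sign by the antisymmetry of \<open>w\<close> and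
    leads back to the identity term. There are p such terms.\<close>
  have second: "(\<Sum>Y\<in>?A' \<rightarrow>\<^sub>E {1..n}. ?G b Y) = - (fact p * W p I)" if b: "b \<in> ?A" for b
  proof -
    have "(\<Sum>Y\<in>?A' \<rightarrow>\<^sub>E {1..n}. ?G b Y) = (\<Sum>Y\<in>?A' \<rightarrow>\<^sub>E {1..n}. ?G b (Y \<circ> transpose ?a b))"
      using b by (intro sum_PiE_transpose) auto
    also have "\<dots> = (\<Sum>Y\<in>?A' \<rightarrow>\<^sub>E {1..n}. - ?G ?a Y)"
    proof (intro sum.cong refl)
      fix Y
      have o1: "override_on I (Y \<circ> transpose ?a b) ?A' \<circ> transpose ?a b = override_on I Y ?A'"
        using b by (auto simp: fun_eq_iff override_on_def transpose_def)
      have o2: "override_on I (Y \<circ> transpose ?a b) ?A' b = override_on I Y ?A' ?a"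
        using b by (auto simp: override_on_def)
      have "?f I ?A' (Y \<circ> transpose ?a b) = (\<lambda>Z. - ?f I ?A' Y Z)"
      proof
        fix Z
        have "(\<lambda>i. if i \<in> ?A' then tilde n ((Y \<circ> transpose ?a b) i) else if i \<in> B then Z i else I i) =
            (\<lambda>i. if i \<in> ?A' then tilde n (Y i) else if i \<in> B then Z i else I i) \<circ> transpose ?a b"
          using b by (auto simp: fun_eq_iff transpose_def)
        then show "?f I ?A' (Y \<circ> transpose ?a b) Z = - ?f I ?A' Y Z"
          unfolding det_base_def using alternatingD[OF w(1), of ?a b] b Suc.prems(1) by simp
      qed
      then have "?D I ?A' (Y \<circ> transpose ?a b) Z = - ?D I ?A' Y Z" for Z
        by (simp add: det_kernel_uminus)
      moreover have "?th ?A' (Y \<circ> transpose ?a b) = ?th ?A' Y"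
        using b by (intro prod_transpose) auto
      ultimately show "?G b (Y \<circ> transpose ?a b) = - ?G ?a Y"
        unfolding o1 o2 by simp
    qed
    finally show ?thesis using first by (simp add: sum_negf)
  qed
  \<comment> \<open>Terms with q in \<open>B\<close>: the exchange puts \<open>I q\<close> into the
    form and the new summation index into slot q, while its \<open>tilde\<close> stands in slot
    \<open>?a\<close>. This is the contraction in P_tilde.\<close>
  have third: "(\<Sum>Y\<in>?A' \<rightarrow>\<^sub>E {1..n}. ?G q Y) = fact p * P_tilde_op g n ?a q (W p) I" if q: "q \<in> B" for q
  proof -
    have qa: "?a \<noteq> q" and qA: "q \<notin> ?A" using q aB AB by auto
    have "(\<Sum>Y\<in>?A' \<rightarrow>\<^sub>E {1..n}. ?G q Y) = (\<Sum>x\<in>{1..n}. \<Sum>Y\<in>?A \<rightarrow>\<^sub>E {1..n}. ?G q (Y(?a := x)))"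
      by (rule sum_PiE_insert[OF aA])
    also have "\<dots> = (\<Sum>x\<in>{1..n}. \<Sum>Y\<in>?A \<rightarrow>\<^sub>E {1..n}. form g n (I ?a) (I q) * (theta g n x *
        (?th ?A Y * ?D (I(?a := tilde n x, q := x)) ?A Y (override_on (I(?a := tilde n x, q := x)) Y ?A))))"
    proof (intro sum.cong refl)
      fix x Y
      have "?D I ?A' (Y(?a := x)) (override_on I (Y(?a := x)) ?A' \<circ> transpose ?a q) =
          ?D I ?A' (Y(?a := x)) (override_on (I(?a := tilde n x, q := x)) Y ?A)"
        by (rule D_cong) (use aA aB q qA qa AB in \<open>auto simp: override_on_def transpose_def\<close>)
      also have "\<dots> = ?D (I(?a := tilde n x, q := x)) ?A Y (override_on (I(?a := tilde n x, q := x)) Y ?A)"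
        by (rule upd[OF q])
      finally have "?D I ?A' (Y(?a := x)) (override_on I (Y(?a := x)) ?A' \<circ> transpose ?a q) =
          ?D (I(?a := tilde n x, q := x)) ?A Y (override_on (I(?a := tilde n x, q := x)) Y ?A)" .
      moreover have "override_on I (Y(?a := x)) ?A' q = I q"
        using qA qa by (auto simp: override_on_def)
      ultimately show "?G q (Y(?a := x)) = form g n (I ?a) (I q) * (theta g n x *
        (?th ?A Y * ?D (I(?a := tilde n x, q := x)) ?A Y (override_on (I(?a := tilde n x, q := x)) Y ?A)))"
        unfolding th by (simp only: mult_ac)
    qed
    also have "\<dots> = (\<Sum>x\<in>{1..n}. form g n (I ?a) (I q) * (theta g n x * (fact p * W p (I(?a := tilde n x, q := x)))))"
    proof (intro sum.cong refl)
      fix x assume x: "x \<in> {1..n}"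
      have "I(?a := tilde n x, q := x) \<in> multi_indices n N"
        using Suc.prems(2) a_in q N(2) x by (intro multi_indices_upd tilde_in) auto
      from IH[OF this] show "(\<Sum>Y\<in>?A \<rightarrow>\<^sub>E {1..n}. form g n (I ?a) (I q) * (theta g n x *
          (?th ?A Y * ?D (I(?a := tilde n x, q := x)) ?A Y (override_on (I(?a := tilde n x, q := x)) Y ?A)))) =
          form g n (I ?a) (I q) * (theta g n x * (fact p * W p (I(?a := tilde n x, q := x))))"
        by (simp only: sum_distrib_left)
    qed
    finally show ?thesis
      unfolding P_tilde_op_eq[OF qa] by (simp add: sum_distrib_left mult_ac)
  qed
  have "(\<Sum>Y\<in>{s..<s + Suc p} \<rightarrow>\<^sub>E {1..n}. ?th {s..<s + Suc p} Y *
      det_kernel g n I s B (?f I {s..<s + Suc p} Y) (Suc p) (override_on I Y {s..<s + Suc p})) =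
    (\<Sum>Y\<in>?A' \<rightarrow>\<^sub>E {1..n}. ?G ?a Y - (\<Sum>b\<in>?A \<union> B. ?G b Y))"
    unfolding A'
    by (intro sum.cong refl) (simp add: antisymmetrise_def algebra_simps sum_distrib_left)
  also have "\<dots> = fact p * W p I - ((\<Sum>b\<in>?A. - (fact p * W p I)) + (\<Sum>q\<in>B. fact p * P_tilde_op g n ?a q (W p) I))"
  proof -
    have "(\<Sum>Y\<in>?A' \<rightarrow>\<^sub>E {1..n}. \<Sum>b\<in>?A \<union> B. ?G b Y) = (\<Sum>b\<in>?A \<union> B. \<Sum>Y\<in>?A' \<rightarrow>\<^sub>E {1..n}. ?G b Y)"
      by (rule sum.swap)
    also have "\<dots> = (\<Sum>b\<in>?A. \<Sum>Y\<in>?A' \<rightarrow>\<^sub>E {1..n}. ?G b Y) + (\<Sum>b\<in>B. \<Sum>Y\<in>?A' \<rightarrow>\<^sub>E {1..n}. ?G b Y)"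
      by (rule sum.union_disjoint[OF _ B(1) AB]) simp
    also have "\<dots> = (\<Sum>b\<in>?A. - (fact p * W p I)) + (\<Sum>q\<in>B. fact p * P_tilde_op g n ?a q (W p) I)"
      by (intro arg_cong2[of _ _ _ _ "(+)"] sum.cong refl second third)
    finally show ?thesis unfolding sum_subtractf first by simp
  qed
  also have "\<dots> = fact (Suc p) * W (Suc p) I"
    using Suc.prems(1)
    by (simp add: W(2) sum_distrib_left[symmetric] field_simps del: of_nat_Suc) (simp add: algebra_simps)
  finally show ?case
    by (simp only: nonzero_mult_div_cancel_left[OF fact_nonzero])
qed

lemma det_vanishing:
  assumes "alternating {s..<s + a} w" "alternating B w"
    and "finite B" "{s..<s + a} \<inter> B = {}"
    and "{s..<s + a} \<subseteq> {1..N}" "B \<subseteq> {1..N}"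
    and "W 0 = w"
      "\<And>p. p < a \<Longrightarrow> W (Suc p) = (\<lambda>I. W p I - (\<Sum>q\<in>B. P_tilde_op g n (s + p) q (W p) I) / of_nat (Suc p))"
    and "n < a + card B" "I \<in> multi_indices n N"
  shows "W a I = 0"
proof -
  have "det_kernel g n I s B (det_base n B w I {s..<s + a} Y) a (override_on I Y {s..<s + a}) = 0"
    if Y: "Y \<in> {s..<s + a} \<rightarrow>\<^sub>E {1..n}" for Y
  proof (rule alternating_pigeonhole[where S = "{s..<s + a} \<union> B" and n = n
        and f = "det_kernel g n I s B (det_base n B w I {s..<s + a} Y) a"])
    have "alternating B (det_base n B w I {s..<s + a} Y)"
      unfolding alternating_def
    proof (intro ballI impI allI)
      fix c d and Z :: "nat \<Rightarrow> nat" assume cd: "c \<in> B" "d \<in> B" "c \<noteq> d"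
      have "(\<lambda>i. if i \<in> {s..<s + a} then tilde n (Y i) else if i \<in> B then (Z \<circ> transpose c d) i else I i) =
          (\<lambda>i. if i \<in> {s..<s + a} then tilde n (Y i) else if i \<in> B then Z i else I i) \<circ> transpose c d"
        using cd assms(4) by (auto simp: fun_eq_iff transpose_def)
      then show "det_base n B w I {s..<s + a} Y (Z \<circ> transpose c d) = - det_base n B w I {s..<s + a} Y Z"
        unfolding det_base_def using alternatingD[OF assms(2) cd] by simp
    qed
    then show "alternating ({s..<s + a} \<union> B) (det_kernel g n I s B (det_base n B w I {s..<s + a} Y) a)"
      by (rule det_kernel_alternating[OF assms(3,4)])
    show "n < card ({s..<s + a} \<union> B)"
      using assms(3,4,9) by (simp add: card_Un_disjoint)
    show "override_on I Y {s..<s + a} i \<in> {1..n}" if "i \<in> {s..<s + a} \<union> B" for i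
      using that Y multi_indices_range[OF assms(10), of i] assms(5,6) by (auto simp: override_on_def PiE_def Pi_def)
  qed (use assms(3) in simp)
  then show ?thesis
    using det_representation[OF assms(1-8) order_refl assms(10)] by simp
qed

section \<open>A vanishing Pfaffian\<close>

text \<open>Expansion along the last index: slot 2q + 1 is paired with slot 2q, and the
  antisymmetriser lets every earlier slot take the place of 2q. It covers only the slots up to 2q,
  so antisymmetry in slot 2q + 1 is not built in.\<close>

fun pfaffian :: "lie_type \<Rightarrow> nat \<Rightarrow> nat \<Rightarrow> tensor" where
  "pfaffian g n 0 = (\<lambda>Z. 1)"
| "pfaffian g n (Suc q) = antisymmetrise (2 * q) {..<2 * q}
     (\<lambda>Z. form g n (Z (2 * q + 1)) (Z (2 * q)) * pfaffian g n q Z)"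

lemma pfaffian_cong:
  assumes "\<And>i. i < 2 * q \<Longrightarrow> Z i = Z' i"
  shows "pfaffian g n q Z = pfaffian g n q Z'"
  using assms
proof (induction q arbitrary: Z Z')
  case (Suc q)
  have "pfaffian g n q Z = pfaffian g n q Z'"
    using Suc.prems by (intro Suc.IH) auto
  moreover have "pfaffian g n q (Z \<circ> transpose (2 * q) b) = pfaffian g n q (Z' \<circ> transpose (2 * q) b)"
    if "b < 2 * q" for b
    using Suc.prems that by (intro Suc.IH) (auto simp: transpose_def)
  ultimately show ?case
    using Suc.prems by (auto simp: antisymmetrise_def intro!: arg_cong2[of _ _ _ _ "(-)"] sum.cong)
qed simp

text \<open>Invariance of \<open>f\<close> under the infinitesimal isometries \<open>z \<mapsto> \<langle>y, z\<rangle>x + \<langle>x, z\<rangle>y\<close> of the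
  symplectic form, applied to basis vectors.\<close>

definition isometry_invariant :: "lie_type \<Rightarrow> nat \<Rightarrow> nat \<Rightarrow> tensor \<Rightarrow> bool" where
  "isometry_invariant g n M f \<longleftrightarrow> (\<forall>Z x y.
     (\<Sum>c<M. form g n y (Z c) * f (Z(c := x)) + form g n x (Z c) * f (Z(c := y))) = 0)"

lemma isometry_invariant_transpose:
  assumes f: "isometry_invariant g n M f" and ab: "a < M" "b < M"
  shows "isometry_invariant g n M (\<lambda>Z. f (Z \<circ> transpose a b))"
  unfolding isometry_invariant_def
proof (intro allI)
  fix Z :: "nat \<Rightarrow> nat" and x y
  let ?Z = "Z \<circ> transpose a b"
  have upd: "Z(c := z) \<circ> transpose a b = ?Z(transpose a b c := z)" for c z
    by (auto simp: fun_eq_iff transpose_def)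
  have inv: "?Z (transpose a b c) = Z c" for c by simp
  have "(\<Sum>c<M. form g n y (Z c) * f (Z(c := x) \<circ> transpose a b) + form g n x (Z c) * f (Z(c := y) \<circ> transpose a b))
      = (\<Sum>c<M. form g n y (?Z c) * f (?Z(c := x)) + form g n x (?Z c) * f (?Z(c := y)))"
    unfolding upd
    by (rule sum.reindex_bij_witness[of _ "transpose a b" "transpose a b"])
       (use ab in \<open>auto simp: transpose_def\<close>)
  also have "\<dots> = 0" using f unfolding isometry_invariant_def by blast
  finally show "(\<Sum>c<M. form g n y (Z c) * f (Z(c := x) \<circ> transpose a b) + form g n x (Z c) * f (Z(c := y) \<circ> transpose a b)) = 0" .
qed

lemma isometry_invariant_antisymmetrise:
  assumes f: "isometry_invariant g n M f" and "a < M" "S \<subseteq> {..<M}"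
  shows "isometry_invariant g n M (antisymmetrise a S f)"
  unfolding isometry_invariant_def
proof (intro allI)
  fix Z :: "nat \<Rightarrow> nat" and x y
  let ?d = "\<lambda>f. \<Sum>c<M. form g n y (Z c) * f (Z(c := x)) + form g n x (Z c) * f (Z(c := y))"
  have "?d (antisymmetrise a S f) = ?d f - (\<Sum>b\<in>S. ?d (\<lambda>Z. f (Z \<circ> transpose a b)))"
  proof -
    have "?d (antisymmetrise a S f) = (\<Sum>c<M. (form g n y (Z c) * f (Z(c := x)) + form g n x (Z c) * f (Z(c := y))) -
        (\<Sum>b\<in>S. form g n y (Z c) * f (Z(c := x) \<circ> transpose a b) + form g n x (Z c) * f (Z(c := y) \<circ> transpose a b)))"
      unfolding antisymmetrise_def
      by (intro sum.cong refl) (simp add: sum_distrib_left sum.distrib right_diff_distrib)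
    then show ?thesis
      unfolding sum_subtractf by (subst (asm) sum.swap)
  qed
  moreover have "?d f = 0" using f unfolding isometry_invariant_def by blast
  moreover have "?d (\<lambda>Z. f (Z \<circ> transpose a b)) = 0" if "b \<in> S" for b
    using isometry_invariant_transpose[OF f assms(2), of b] that assms(3)
    unfolding isometry_invariant_def by blast
  ultimately show "?d (antisymmetrise a S f) = 0" by simp
qed

lemma form_antisym:
  assumes "even n"
  shows "form SP n i j = - form SP n j i"
  using form_swap[of SP n i j] assms by simp

text \<open>Leibniz rule: the derivative falls on the old slots, where induction applies, or on the
  two slots of the new factor, which is the invariant form itself.\<close>

lemma isometry_invariant_pfaffian:
  assumes "even n"
  shows "isometry_invariant SP n (2 * q) (pfaffian SP n q)"
proof (induction q)
  case (Suc q)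
  let ?h = "\<lambda>Z. form SP n (Z (2 * q + 1)) (Z (2 * q)) * pfaffian SP n q Z"
  have "isometry_invariant SP n (2 * Suc q) ?h"
    unfolding isometry_invariant_def
  proof (intro allI)
    fix Z :: "nat \<Rightarrow> nat" and x y
    let ?e = "\<lambda>f c. form SP n y (Z c) * f (Z(c := x)) + form SP n x (Z c) * f (Z(c := y))"
    have pf: "pfaffian SP n q (Z(c := z)) = pfaffian SP n q Z" if "c \<ge> 2 * q" for c z
      by (rule pfaffian_cong) (use that in auto)
    have "(\<Sum>c<2 * q. ?e ?h c) = form SP n (Z (2 * q + 1)) (Z (2 * q)) * (\<Sum>c<2 * q. ?e (pfaffian SP n q) c)"
      by (auto simp: sum_distrib_left algebra_simps intro!: sum.cong)
    also have "\<dots> = 0" using Suc unfolding isometry_invariant_def by simp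
    finally have "(\<Sum>c<2 * Suc q. ?e ?h c) = ?e ?h (2 * q) + ?e ?h (2 * q + 1)" by simp
    \<comment> \<open>The smaller Pfaffian does not see slots 2q and 2q + 1. Each bracket vanishes
      because the form is skew.\<close>
    also have "\<dots> = (form SP n y (Z (2 * q)) * (form SP n (Z (2 * q + 1)) x + form SP n x (Z (2 * q + 1))) +
        form SP n x (Z (2 * q)) * (form SP n (Z (2 * q + 1)) y + form SP n y (Z (2 * q + 1)))) * pfaffian SP n q Z"
      by (simp add: pf algebra_simps)
    also have "\<dots> = 0"
      using form_antisym[OF assms, of "Z (2 * q + 1)" x] form_antisym[OF assms, of "Z (2 * q + 1)" y] by simp
    finally show "(\<Sum>c<2 * Suc q. ?e ?h c) = 0" .
  qed
  then show ?case
    unfolding pfaffian.simps by (rule isometry_invariant_antisymmetrise) auto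
qed (simp add: isometry_invariant_def)

text \<open>A transposition of M + 1 with d < M is conjugate to (M d) by the adjacent transposition
  of M and M + 1, so one further sign suffices.\<close>

lemma alternating_lessThan_SucI:
  assumes f: "alternating {..<Suc M} f" and swap: "\<And>Z. f (Z \<circ> transpose M (Suc M)) = - f Z"
  shows "alternating {..<Suc (Suc M)} f"
proof -
  have *: "f (Z \<circ> transpose (Suc M) d) = - f Z" if "d < Suc M" for d Z
  proof (cases "d = M")
    case True
    then show ?thesis using swap[of Z] by (simp add: transpose_commute)
  next
    case False
    then have d: "M \<in> {..<Suc M}" "d \<in> {..<Suc M}" "M \<noteq> d" using that by auto
    have "Z \<circ> transpose (Suc M) d = Z \<circ> transpose M (Suc M) \<circ> transpose M d \<circ> transpose M (Suc M)"
      using d by (auto simp: fun_eq_iff transpose_def)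
    then show ?thesis by (simp only: swap alternatingD[OF f d] minus_minus)
  qed
  then have **: "f (Z \<circ> transpose d (Suc M)) = - f Z" if "d < Suc M" for d Z
    using that by (simp add: transpose_commute[of d])
  show ?thesis
    unfolding alternating_def
  proof (intro ballI impI allI)
    fix c d and Z :: "nat \<Rightarrow> nat" assume cd: "c \<in> {..<Suc (Suc M)}" "d \<in> {..<Suc (Suc M)}" "c \<noteq> d"
    consider "c < Suc M" "d < Suc M" | "c = Suc M" "d < Suc M" | "c < Suc M" "d = Suc M"
      using cd by force
    then show "f (Z \<circ> transpose c d) = - f Z"
      using * ** alternatingD[OF f, of c d Z] cd(3) by cases auto
  qed
qed

text \<open>The antisymmetriser leaves one sign open, that of exchanging the last two slots. Adding
  the expansions of both values, what remains is the isometry invariance of the smaller Pfaffian for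
  x, y the values in these slots.\<close>

lemma alternating_pfaffian:
  assumes "even n"
  shows "alternating {..<2 * q} (pfaffian SP n q)"
proof (induction q)
  case (Suc q)
  let ?h = "\<lambda>Z. form SP n (Z (2 * q + 1)) (Z (2 * q)) * pfaffian SP n q Z"
  have "alternating {..<2 * q} ?h"
    unfolding alternating_def
  proof (intro ballI impI allI)
    fix c d and Z :: "nat \<Rightarrow> nat" assume cd: "c \<in> {..<2 * q}" "d \<in> {..<2 * q}" "c \<noteq> d"
    then have "(Z \<circ> transpose c d) (2 * q) = Z (2 * q)" "(Z \<circ> transpose c d) (2 * q + 1) = Z (2 * q + 1)"
      by (auto simp: transpose_def)
    then show "?h (Z \<circ> transpose c d) = - ?h Z"
      unfolding alternatingD[OF Suc.IH cd] by (simp only: mult_minus_right)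
  qed
  then have "alternating (insert (2 * q) {..<2 * q}) (pfaffian SP n (Suc q))"
    unfolding pfaffian.simps by (intro alternating_antisymmetrise) auto
  moreover have "insert (2 * q) {..<2 * q} = {..<Suc (2 * q)}" by auto
  ultimately have alt: "alternating {..<Suc (2 * q)} (pfaffian SP n (Suc q))" by simp
  have "pfaffian SP n (Suc q) (Z \<circ> transpose (2 * q) (Suc (2 * q))) = - pfaffian SP n (Suc q) Z" for Z
  proof -
    let ?x = "Z (2 * q)" and ?y = "Z (2 * q + 1)"
    let ?\<tau> = "transpose (2 * q) (Suc (2 * q))"
    have t: "(W \<circ> transpose (2 * q) b) (2 * q + 1) = W (2 * q + 1)" "(W \<circ> transpose (2 * q) b) (2 * q) = W b"
      "(Z \<circ> ?\<tau>) (2 * q + 1) = ?x" "(Z \<circ> ?\<tau>) (2 * q) = ?y" "(Z \<circ> ?\<tau>) b = Z b"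
      if "b < 2 * q" for b and W :: "nat \<Rightarrow> nat"
      using that by (auto simp: transpose_def)
    have t0: "(Z \<circ> ?\<tau>) (2 * q + 1) = ?x" "(Z \<circ> ?\<tau>) (2 * q) = ?y"
      by (auto simp: transpose_def)
    have e1: "pfaffian SP n q (Z \<circ> transpose (2 * q) b) = pfaffian SP n q (Z(b := ?x))" if "b < 2 * q" for b
      by (rule pfaffian_cong) (use that in \<open>auto simp: transpose_def\<close>)
    have e2: "pfaffian SP n q (Z \<circ> ?\<tau> \<circ> transpose (2 * q) b) = pfaffian SP n q (Z(b := ?y))" if "b < 2 * q" for b
      by (rule pfaffian_cong) (use that in \<open>auto simp: transpose_def\<close>)
    have e3: "pfaffian SP n q (Z \<circ> ?\<tau>) = pfaffian SP n q Z"
      by (rule pfaffian_cong) (auto simp: transpose_def)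
    have "pfaffian SP n (Suc q) Z = form SP n ?y ?x * pfaffian SP n q Z -
        (\<Sum>b<2 * q. form SP n ?y (Z b) * pfaffian SP n q (Z(b := ?x)))"
      unfolding pfaffian.simps antisymmetrise_def
      by (intro arg_cong2[of _ _ _ _ "(-)"] sum.cong refl) (simp only: lessThan_iff e1 t)
    moreover have "pfaffian SP n (Suc q) (Z \<circ> ?\<tau>) = form SP n ?x ?y * pfaffian SP n q Z -
        (\<Sum>b<2 * q. form SP n ?x (Z b) * pfaffian SP n q (Z(b := ?y)))"
      unfolding pfaffian.simps antisymmetrise_def e3
      by (intro arg_cong2[of _ _ _ _ "(-)"] sum.cong refl) (simp_all only: lessThan_iff e2 t t0)
    moreover have "(\<Sum>b<2 * q. form SP n ?y (Z b) * pfaffian SP n q (Z(b := ?x))) +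
        (\<Sum>b<2 * q. form SP n ?x (Z b) * pfaffian SP n q (Z(b := ?y))) = 0"
      using isometry_invariant_pfaffian[OF assms, of q]
      unfolding isometry_invariant_def sum.distrib by blast
    moreover have "form SP n ?x ?y = - form SP n ?y ?x" by (rule form_antisym[OF assms])
    ultimately show ?thesis by (simp add: algebra_simps add_eq_0_iff)
  qed
  from alternating_lessThan_SucI[OF alt this] show ?case by simp
qed (simp add: alternating_def)

text \<open>The arguments of the Pfaffian: slot \<open>2i\<close> holds the \<open>i\<close>th summation index, slot \<open>2i + 1\<close>
  the \<open>i\<close>th tensor index.\<close>

definition interleave :: "nat \<Rightarrow> (nat \<Rightarrow> nat) \<Rightarrow> (nat \<Rightarrow> nat) \<Rightarrow> nat \<Rightarrow> nat" where
  "interleave s Y I = (\<lambda>k. if even k then Y (s + k div 2) else I (s + k div 2))"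

lemma sum_lessThan_double: "(\<Sum>b<2 * (q :: nat). f b) = (\<Sum>j<q. f (2 * j) + (f (2 * j + 1) :: complex))"
  by (induction q) (simp_all add: add.assoc)

text \<open>As for the determinant, except that input and output indices are now arguments of one
  skew function. In the expansion along the new pair the even slots return copies of
  \<open>W q\<close> and the odd ones the P_tilde terms, which again gives the count q + 1.\<close>

lemma pfaffian_representation:
  assumes w: "alternating {s..<s + k} w" and N: "{s..<s + k} \<subseteq> {1..N}" and n: "even n"
    and W: "W 0 = w"
      "\<And>q. q < k \<Longrightarrow> W (Suc q) = (\<lambda>I. W q I - (\<Sum>j<q. P_tilde_op SP n (s + j) (s + q) (W q) I) / of_nat (Suc q))"
    and "q \<le> k" "I \<in> multi_indices n N"
  shows "W q I = (\<Sum>Y\<in>{s..<s + q} \<rightarrow>\<^sub>E {1..n}. (\<Prod>i\<in>{s..<s + q}. theta SP n (Y i)) *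
    (pfaffian SP n q (interleave s Y I) * w (override_on I (tilde n \<circ> Y) {s..<s + q}))) / fact q"
  using assms(6,7)
proof (induction q arbitrary: I)
  case 0
  then show ?case by (simp add: W(1) override_on_def)
next
  case (Suc q)
  let ?A = "{s..<s + q}" and ?a = "s + q"
  let ?A' = "insert ?a ?A"
  have A': "{s..<s + Suc q} = ?A'" by auto
  have aA: "?a \<notin> ?A" and a_in: "?a \<in> {1..N}"
    using Suc.prems(1) N by (simp_all add: subset_iff)
  have Ia: "I ?a \<in> {1..n}" using multi_indices_range[OF Suc.prems(2) a_in] .
  let ?th = "\<lambda>A Y. \<Prod>i\<in>A. theta SP n (Y i)"
  let ?ov = "\<lambda>I Y A. override_on I (tilde n \<circ> Y) A"
  let ?pf = "pfaffian SP n q"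
  have th: "?th ?A' (Y(?a := x)) = theta SP n x * ?th ?A Y" for Y x
  proof -
    have "?th ?A (Y(?a := x)) = ?th ?A Y" by (rule prod.cong) (use aA in auto)
    then show ?thesis using aA by simp
  qed
  have ov_upd: "?ov I (Y(?a := x)) ?A' = (?ov I Y ?A)(?a := tilde n x)" for Y x
    using aA by (auto simp: fun_eq_iff override_on_def)
  let ?G = "\<lambda>i b Y. ?th ?A' Y * (form SP n (I ?a) i * ?pf (interleave s Y I \<circ> transpose (2 * q) b) * w (?ov I Y ?A'))"
  have IH: "fact q * W q J = (\<Sum>Y\<in>?A \<rightarrow>\<^sub>E {1..n}. ?th ?A Y * (?pf (interleave s Y J) * w (?ov J Y ?A)))"
    if "J \<in> multi_indices n N" for J
  proof -
    have "q \<le> k" using Suc.prems(1) by simp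
    show ?thesis
      unfolding Suc.IH[OF \<open>q \<le> k\<close> that]
      by (simp only: times_divide_eq_right nonzero_mult_div_cancel_left[OF fact_nonzero])
  qed
  have first: "(\<Sum>Y\<in>?A' \<rightarrow>\<^sub>E {1..n}. ?G (Y ?a) (2 * q) Y) = fact q * W q I"
  proof -
    let ?h = "\<lambda>Y y. ?th ?A Y * (?pf (interleave s Y I) * w ((?ov I Y ?A)(?a := y)))"
    have "(\<Sum>Y\<in>?A' \<rightarrow>\<^sub>E {1..n}. ?G (Y ?a) (2 * q) Y) = (\<Sum>x\<in>{1..n}. \<Sum>Y\<in>?A \<rightarrow>\<^sub>E {1..n}. ?G ((Y(?a := x)) ?a) (2 * q) (Y(?a := x)))"
      by (rule sum_PiE_insert[OF aA])
    also have "\<dots> = (\<Sum>x\<in>{1..n}. \<Sum>Y\<in>?A \<rightarrow>\<^sub>E {1..n}. theta SP n x * form SP n (I ?a) x * ?h Y (tilde n x))"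
    proof (intro sum.cong refl)
      fix x Y
      have "?pf (interleave s (Y(?a := x)) I \<circ> transpose (2 * q) (2 * q)) = ?pf (interleave s Y I)"
        by (rule pfaffian_cong) (auto simp: interleave_def)
      then show "?G ((Y(?a := x)) ?a) (2 * q) (Y(?a := x)) = theta SP n x * form SP n (I ?a) x * ?h Y (tilde n x)"
        unfolding th ov_upd fun_upd_same by (simp only: mult_ac)
    qed
    also have "\<dots> = (\<Sum>Y\<in>?A \<rightarrow>\<^sub>E {1..n}. ?h Y (tilde n (tilde n (I ?a))))"
      by (subst sum.swap) (intro sum.cong refl sum_theta_form[OF Ia])
    also have "\<dots> = fact q * W q I"
    proof -
      have "(?ov I Y ?A)(?a := I ?a) = ?ov I Y ?A" for Y
        using aA by (auto simp: fun_eq_iff override_on_def)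
      then show ?thesis unfolding IH[OF Suc.prems(2)] tilde_tilde[OF Ia] by simp
    qed
    finally show ?thesis .
  qed
  \<comment> \<open>The even slot 2j holds the summation index \<open>Y (s + j)\<close>. Renaming it
    against \<open>Y ?a\<close> restores the arguments of the Pfaffian, and the sign comes from
    \<open>w\<close>.\<close>
  have second: "(\<Sum>Y\<in>?A' \<rightarrow>\<^sub>E {1..n}. ?G (Y (s + j)) (2 * j) Y) = - (fact q * W q I)" if j: "j < q" for j
  proof -
    have jA: "s + j \<in> ?A" using j by auto
    have "(\<Sum>Y\<in>?A' \<rightarrow>\<^sub>E {1..n}. ?G (Y (s + j)) (2 * j) Y) =
        (\<Sum>Y\<in>?A' \<rightarrow>\<^sub>E {1..n}. ?G ((Y \<circ> transpose ?a (s + j)) (s + j)) (2 * j) (Y \<circ> transpose ?a (s + j)))"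
      using jA by (intro sum_PiE_transpose) auto
    also have "\<dots> = (\<Sum>Y\<in>?A' \<rightarrow>\<^sub>E {1..n}. - ?G (Y ?a) (2 * q) Y)"
    proof (intro sum.cong refl)
      fix Y
      have "interleave s (Y \<circ> transpose ?a (s + j)) I \<circ> transpose (2 * q) (2 * j) = interleave s Y I"
        using j by (auto simp: fun_eq_iff interleave_def transpose_def)
      moreover have "interleave s Y I \<circ> transpose (2 * q) (2 * q) = interleave s Y I" by auto
      moreover have "?ov I (Y \<circ> transpose ?a (s + j)) ?A' = ?ov I Y ?A' \<circ> transpose ?a (s + j)"
        using jA by (auto simp: fun_eq_iff override_on_def transpose_def)
      moreover have "w (?ov I Y ?A' \<circ> transpose ?a (s + j)) = - w (?ov I Y ?A')"
        using jA Suc.prems(1) by (intro alternatingD[OF w]) auto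
      moreover have "?th ?A' (Y \<circ> transpose ?a (s + j)) = ?th ?A' Y"
        using jA by (intro prod_transpose) auto
      moreover have "(Y \<circ> transpose ?a (s + j)) (s + j) = Y ?a" by simp
      ultimately show "?G ((Y \<circ> transpose ?a (s + j)) (s + j)) (2 * j) (Y \<circ> transpose ?a (s + j)) = - ?G (Y ?a) (2 * q) Y"
        by (simp only: mult_minus_right)
    qed
    finally show ?thesis using first by (simp only: sum_negf)
  qed
  \<comment> \<open>The odd slot 2j + 1 holds the tensor index \<open>I (s + j)\<close>, which moves
    into the form while the new summation index takes its place.\<close>
  have third: "(\<Sum>Y\<in>?A' \<rightarrow>\<^sub>E {1..n}. ?G (I (s + j)) (2 * j + 1) Y) = fact q * P_tilde_op SP n (s + j) ?a (W q) I"
    if j: "j < q" for j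
  proof -
    let ?b = "s + j"
    let ?I = "\<lambda>x. I(?a := tilde n x, ?b := x)"
    have jA: "?b \<in> ?A" and ba: "?b \<noteq> ?a" "?a \<noteq> ?b" using j by auto
    have "(\<Sum>Y\<in>?A' \<rightarrow>\<^sub>E {1..n}. ?G (I ?b) (2 * j + 1) Y) = (\<Sum>x\<in>{1..n}. \<Sum>Y\<in>?A \<rightarrow>\<^sub>E {1..n}. ?G (I ?b) (2 * j + 1) (Y(?a := x)))"
      by (rule sum_PiE_insert[OF aA])
    also have "\<dots> = (\<Sum>x\<in>{1..n}. \<Sum>Y\<in>?A \<rightarrow>\<^sub>E {1..n}. form SP n (I ?a) (I ?b) * (theta SP n x *
        (?th ?A Y * (?pf (interleave s Y (?I x)) * w (?ov (?I x) Y ?A)))))"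
    proof (intro sum.cong refl)
      fix x Y
      have "?pf (interleave s (Y(?a := x)) I \<circ> transpose (2 * q) (2 * j + 1)) = ?pf (interleave s Y (?I x))"
        by (rule pfaffian_cong) (use j in \<open>auto simp: interleave_def transpose_def elim!: oddE\<close>)
      moreover have "?ov I (Y(?a := x)) ?A' = ?ov (?I x) Y ?A"
        unfolding ov_upd using aA jA by (auto simp: fun_eq_iff override_on_def)
      ultimately show "?G (I ?b) (2 * j + 1) (Y(?a := x)) = form SP n (I ?a) (I ?b) * (theta SP n x *
        (?th ?A Y * (?pf (interleave s Y (?I x)) * w (?ov (?I x) Y ?A))))"
        unfolding th by (simp only: mult_ac)
    qed
    also have "\<dots> = (\<Sum>x\<in>{1..n}. form SP n (I ?a) (I ?b) * (theta SP n x * (fact q * W q (?I x))))"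
    proof (intro sum.cong refl)
      fix x assume x: "x \<in> {1..n}"
      have "?b \<in> {1..N}" using N Suc.prems(1) j by (simp add: subset_iff)
      then have "?I x \<in> multi_indices n N"
        using Suc.prems(2) a_in x by (intro multi_indices_upd tilde_in)
      from IH[OF this] show "(\<Sum>Y\<in>?A \<rightarrow>\<^sub>E {1..n}. form SP n (I ?a) (I ?b) * (theta SP n x *
          (?th ?A Y * (?pf (interleave s Y (?I x)) * w (?ov (?I x) Y ?A))))) =
          form SP n (I ?a) (I ?b) * (theta SP n x * (fact q * W q (?I x)))"
        by (simp only: sum_distrib_left)
    qed
    also have "\<dots> = fact q * P_tilde_op SP n ?a ?b (W q) I"
      unfolding P_tilde_op_eq[OF ba(2)] by (simp add: sum_distrib_left mult_ac)
    also have "P_tilde_op SP n ?a ?b = P_tilde_op SP n ?b ?a"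
      using n ba by (intro pair_operator.sym[OF pair_operator_P_tilde]) auto
    finally show ?thesis .
  qed
  have slot: "interleave s Y I (2 * q + 1) = I ?a" "interleave s Y I (2 * j) = Y (s + j)"
    "interleave s Y I (2 * j + 1) = I (s + j)" for Y j
    by (simp_all add: interleave_def)
  have tr: "(interleave s Y I \<circ> transpose (2 * q) b) (2 * q + 1) = I ?a"
    "(interleave s Y I \<circ> transpose (2 * q) b) (2 * q) = interleave s Y I b" if "b < 2 * q" for Y b
    using that slot by (auto simp: transpose_def)
  have "(\<Sum>Y\<in>{s..<s + Suc q} \<rightarrow>\<^sub>E {1..n}. ?th {s..<s + Suc q} Y *
      (pfaffian SP n (Suc q) (interleave s Y I) * w (?ov I Y {s..<s + Suc q}))) =
    (\<Sum>Y\<in>?A' \<rightarrow>\<^sub>E {1..n}. ?G (Y ?a) (2 * q) Y - (\<Sum>j<q. ?G (Y (s + j)) (2 * j) Y + ?G (I (s + j)) (2 * j + 1) Y))"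
    unfolding A'
  proof (intro sum.cong refl)
    fix Y
    have "pfaffian SP n (Suc q) (interleave s Y I) = form SP n (I ?a) (Y ?a) * ?pf (interleave s Y I \<circ> transpose (2 * q) (2 * q)) -
      (\<Sum>b<2 * q. form SP n (I ?a) (interleave s Y I b) * ?pf (interleave s Y I \<circ> transpose (2 * q) b))"
    proof -
      have "interleave s Y I \<circ> transpose (2 * q) (2 * q) = interleave s Y I" by simp
      then show ?thesis
        unfolding pfaffian.simps antisymmetrise_def
        by (intro arg_cong2[of _ _ _ _ "(-)"] sum.cong refl) (simp_all only: lessThan_iff tr slot)
    qed
    then show "?th ?A' Y * (pfaffian SP n (Suc q) (interleave s Y I) * w (?ov I Y ?A')) =
      ?G (Y ?a) (2 * q) Y - (\<Sum>j<q. ?G (Y (s + j)) (2 * j) Y + ?G (I (s + j)) (2 * j + 1) Y)"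
      unfolding sum_lessThan_double slot
      by (simp only: left_diff_distrib right_diff_distrib sum_distrib_left sum_distrib_right distrib_left distrib_right)
  qed
  also have "\<dots> = fact q * W q I - (\<Sum>j<q. - (fact q * W q I) + fact q * P_tilde_op SP n (s + j) ?a (W q) I)"
  proof -
    have "(\<Sum>Y\<in>?A' \<rightarrow>\<^sub>E {1..n}. \<Sum>j<q. ?G (Y (s + j)) (2 * j) Y + ?G (I (s + j)) (2 * j + 1) Y) =
      (\<Sum>j<q. (\<Sum>Y\<in>?A' \<rightarrow>\<^sub>E {1..n}. ?G (Y (s + j)) (2 * j) Y) + (\<Sum>Y\<in>?A' \<rightarrow>\<^sub>E {1..n}. ?G (I (s + j)) (2 * j + 1) Y))"
      by (subst sum.swap) (simp only: sum.distrib)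
    also have "\<dots> = (\<Sum>j<q. - (fact q * W q I) + fact q * P_tilde_op SP n (s + j) ?a (W q) I)"
      by (intro arg_cong2[of _ _ _ _ "(+)"] sum.cong refl second third) auto
    finally show ?thesis unfolding sum_subtractf first by (simp only:)
  qed
  also have "\<dots> = fact (Suc q) * W (Suc q) I"
  proof -
    let ?S = "\<Sum>j<q. P_tilde_op SP n (s + j) ?a (W q) I"
    have "(\<Sum>j<q. - (fact q * W q I) + fact q * P_tilde_op SP n (s + j) ?a (W q) I) =
        - (of_nat q * (fact q * W q I)) + fact q * ?S"
      unfolding sum.distrib by (simp add: sum_distrib_left)
    moreover have "W (Suc q) I = W q I - ?S / of_nat (Suc q)"
      using W(2)[of q] Suc.prems(1) by simp
    moreover have "f * w - (- (of_nat q * (f * w)) + f * S) = of_nat (Suc q) * f * (w - S / of_nat (Suc q))"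
      for f w S :: complex
      by (simp add: field_simps del: of_nat_Suc) (simp add: algebra_simps)
    ultimately show ?thesis by (simp only: fact_Suc of_nat_mult)
  qed
  finally show ?case
    by (simp only: nonzero_mult_div_cancel_left[OF fact_nonzero])
qed

lemma pfaffian_vanishing:
  assumes "alternating {s..<s + k} w" and N: "{s..<s + k} \<subseteq> {1..N}" and "even n"
    and "W 0 = w"
      "\<And>q. q < k \<Longrightarrow> W (Suc q) = (\<lambda>I. W q I - (\<Sum>j<q. P_tilde_op SP n (s + j) (s + q) (W q) I) / of_nat (Suc q))"
    and "n < 2 * k" "I \<in> multi_indices n N"
  shows "W k I = 0"
proof -
  have "pfaffian SP n k (interleave s Y I) = 0" if Y: "Y \<in> {s..<s + k} \<rightarrow>\<^sub>E {1..n}" for Y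
  proof (rule alternating_pigeonhole[where f = "pfaffian SP n k" and S = "{..<2 * k}" and n = n])
    show "alternating {..<2 * k} (pfaffian SP n k)" by (rule alternating_pfaffian[OF assms(3)])
    fix i assume "i \<in> {..<2 * k}"
    then have i: "s + i div 2 \<in> {s..<s + k}" by auto
    then have "I (s + i div 2) \<in> {1..n}" using multi_indices_range[OF assms(7)] N by blast
    moreover have "Y (s + i div 2) \<in> {1..n}" using PiE_mem[OF Y i] .
    ultimately show "interleave s Y I i \<in> {1..n}" by (simp add: interleave_def)
  qed (use assms(6) in auto)
  then show ?thesis
    using pfaffian_representation[OF assms(1-5) order_refl assms(7)] by simp
qed

section \<open>Fusion\<close>

definition pair_R :: "(nat \<Rightarrow> nat \<Rightarrow> tensor \<Rightarrow> tensor) \<Rightarrow> nat \<Rightarrow> nat \<Rightarrow> complex \<Rightarrow> tensor \<Rightarrow> tensor" where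
  "pair_R Q p q x v = (\<lambda>I. v I - Q p q v I / x)"

abbreviation R_product :: "(nat \<Rightarrow> nat \<Rightarrow> tensor \<Rightarrow> tensor) \<Rightarrow> (nat \<Rightarrow> nat \<Rightarrow> complex) \<Rightarrow>
    (nat \<times> nat) list \<Rightarrow> tensor \<Rightarrow> tensor" where
  "R_product Q x ps \<equiv> fold (\<lambda>(p, q). pair_R Q p q (x p q)) ps"

lemma R_op_eq: "R_op n = pair_R (P_op n)"
  by (simp add: fun_eq_iff R_op_def pair_R_def)

lemma R_tilde_op_eq: "R_tilde_op g n = pair_R (P_tilde_op g n)"
  by (simp add: fun_eq_iff R_tilde_op_def pair_R_def)

section \<open>Linear operators on tensors\<close>

definition linear_op :: "(tensor \<Rightarrow> tensor) \<Rightarrow> bool" where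
  "linear_op A \<longleftrightarrow> (\<forall>c d v w. A (\<lambda>I. c * v I + d * w I) = (\<lambda>I. c * A v I + d * A w I))"

lemma linear_opD: "linear_op A \<Longrightarrow> A (\<lambda>I. c * v I + d * w I) = (\<lambda>I. c * A v I + d * A w I)"
  by (simp add: linear_op_def)

lemma linear_op_scale: "linear_op A \<Longrightarrow> A (\<lambda>I. c * v I) = (\<lambda>I. c * A v I)"
  using linear_opD[of A c v 0 v] by simp

lemma linear_op_diff_scale: "linear_op A \<Longrightarrow> A (\<lambda>I. v I - c * w I) = (\<lambda>I. A v I - c * A w I)"
  using linear_opD[of A 1 v "-c" w] by simp

lemma linear_op_divide_diff: "linear_op A \<Longrightarrow> A (\<lambda>I. v I - w I / c) = (\<lambda>I. A v I - A w I / c)"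
  using linear_op_diff_scale[of A v "1 / c" w] by simp

lemma linear_op_add: "linear_op A \<Longrightarrow> A (\<lambda>I. v I + w I) = (\<lambda>I. A v I + A w I)"
  using linear_opD[of A 1 v 1 w] by simp

lemma linear_op_uminus: "linear_op A \<Longrightarrow> A (\<lambda>I. - v I) = (\<lambda>I. - A v I)"
  using linear_op_scale[of A "-1" v] by simp

lemma linear_op_sum: "linear_op A \<Longrightarrow> A (\<lambda>I. \<Sum>x\<in>X. v x I) = (\<lambda>I. \<Sum>x\<in>X. A (v x) I)"
proof (induction X rule: infinite_finite_induct)
  case (insert x X)
  then show ?case using linear_op_add[OF insert.prems, of "v x" "\<lambda>I. \<Sum>x\<in>X. v x I"] by simp
qed (use linear_op_scale[of A 0] in simp_all)

lemma linear_op_sum_op: "(\<And>x. x \<in> X \<Longrightarrow> linear_op (A x)) \<Longrightarrow> linear_op (\<lambda>v I. \<Sum>x\<in>X. A x v I)"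
  by (auto simp: linear_op_def fun_eq_iff sum.distrib sum_distrib_left)

lemma linear_op_divide: "linear_op A \<Longrightarrow> linear_op (\<lambda>v I. A v I / c)"
  by (auto simp: linear_op_def fun_eq_iff field_simps add_divide_distrib)

lemma linear_op_minus_divide: "linear_op A \<Longrightarrow> linear_op (\<lambda>v I. v I - A v I / c)"
  by (auto simp: linear_op_def fun_eq_iff algebra_simps add_divide_distrib)

lemma linear_op_fold: "(\<And>x. x \<in> set xs \<Longrightarrow> linear_op (f x)) \<Longrightarrow> linear_op (fold f xs)"
  by (induction xs) (auto simp: linear_op_def)

text \<open>The scalar step when one more factor joins: in the first identity its operator absorbs
  the c earlier ones, in the second each earlier operator absorbs it.\<close>

lemma fuse_arith:
  fixes e f :: complex
  assumes "e \<noteq> 0" "f \<noteq> 0"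
  shows "f = e + c \<Longrightarrow> x - S / e - (u + c * u / e) / f = x - (S + u) / e"
    and "f = e + 1 \<Longrightarrow> x - S / f - (u + S / f) / e = x - (S + u) / e"
proof -
  assume f: "f = e + c"
  have "u + c * u / e = u * (e + c) / e"
    using assms(1) by (simp add: field_simps)
  then have "(u + c * u / e) / f = u / e"
    unfolding f[symmetric] using assms(2) by simp
  then show "x - S / e - (u + c * u / e) / f = x - (S + u) / e"
    by (simp add: add_divide_distrib)
next
  assume f: "f = e + 1"
  have "S / f + (u + S / f) / e = (u + S / f * (e + 1)) / e"
    using assms(1) by (simp add: add_divide_distrib algebra_simps)
  then have "S / f + (u + S / f) / e = (S + u) / e"
    unfolding f[symmetric] using assms(2) by (simp add: add.commute)
  then show "x - S / f - (u + S / f) / e = x - (S + u) / e"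
    by (simp add: algebra_simps)
qed

text \<open>Each earlier operator is absorbed into the new one, and the resulting
  \<open>length xs\<close> equal copies are compensated by the larger denominator of the new factor.
  The first denominator remains.\<close>

lemma fuse_up:
  assumes lin: "\<And>x. x \<in> set xs \<Longrightarrow> linear_op (A x)" and "distinct xs"
    and anti: "\<And>x y. x \<in> set xs \<Longrightarrow> y \<in> set xs \<Longrightarrow> x \<noteq> y \<Longrightarrow> A y (A x w) = (\<lambda>I. - A y w I)"
    and "\<And>i. i < length xs \<Longrightarrow> d (xs ! i) = e + of_nat i"
    and "\<And>i. i < length xs \<Longrightarrow> e + of_nat i \<noteq> (0 :: complex)"
  shows "fold (\<lambda>x v I. v I - A x v I / d x) xs w = (\<lambda>I. w I - (\<Sum>x\<in>set xs. A x w I) / e)"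
  using assms
proof (induction xs rule: rev_induct)
  case (snoc y xs)
  have d: "d (xs ! i) = e + of_nat i" if "i < length xs" for i
    using snoc.prems(4)[of i] that by (simp add: nth_append)
  have nz: "e + of_nat i \<noteq> 0" if "i \<le> length xs" for i
    using snoc.prems(5)[of i] that by simp
  have IH: "fold (\<lambda>x v I. v I - A x v I / d x) xs w = (\<lambda>I. w I - (\<Sum>x\<in>set xs. A x w I) / e)"
    using snoc.prems d nz by (intro snoc.IH) auto
  have "A y (A x w) = (\<lambda>I. - A y w I)" if "x \<in> set xs" for x
    using snoc.prems(2) that by (intro snoc.prems(3)) auto
  moreover have lin_y: "linear_op (A y)" using snoc.prems(1) by simp
  ultimately have "A y (\<lambda>I. w I - (\<Sum>x\<in>set xs. A x w I) / e) = (\<lambda>I. A y w I + of_nat (length xs) * A y w I / e)"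
    unfolding linear_op_divide_diff[OF lin_y] linear_op_sum[OF lin_y]
    using snoc.prems(2) by (simp add: distinct_card)
  moreover have "d y = e + of_nat (length xs)" using snoc.prems(4)[of "length xs"] by simp
  ultimately have "fold (\<lambda>x v I. v I - A x v I / d x) (xs @ [y]) w = (\<lambda>I. w I - (\<Sum>x\<in>set xs. A x w I) / e -
      (A y w I + of_nat (length xs) * A y w I / e) / (e + of_nat (length xs)))"
    by (simp add: IH)
  also have "\<dots> = (\<lambda>I. w I - ((\<Sum>x\<in>set xs. A x w I) + A y w I) / e)"
    using nz[of 0] nz[of "length xs"] by (intro ext fuse_arith(1)) auto
  finally show ?case using snoc.prems(2) by (simp add: add.commute)
qed simp

text \<open>Now the new operator is absorbed into the earlier ones, so the denominators have to
  fall, and the last one remains.\<close>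

lemma fuse_down:
  assumes lin: "\<And>x. x \<in> set xs \<Longrightarrow> linear_op (A x)" and "distinct xs"
    and anti: "\<And>x y. x \<in> set xs \<Longrightarrow> y \<in> set xs \<Longrightarrow> x \<noteq> y \<Longrightarrow> A y (A x w) = (\<lambda>I. - A x w I)"
    and "\<And>i. i < length xs \<Longrightarrow> d (xs ! i) = e + of_nat (length xs - Suc i)"
    and "\<And>i. i < length xs \<Longrightarrow> e + of_nat i \<noteq> (0 :: complex)"
  shows "fold (\<lambda>x v I. v I - A x v I / d x) xs w = (\<lambda>I. w I - (\<Sum>x\<in>set xs. A x w I) / e)"
  using assms
proof (induction xs arbitrary: e rule: rev_induct)
  case (snoc y xs)
  show ?case
  proof (cases "xs = []")
    case True
    then show ?thesis using snoc.prems(4)[of 0] by simp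
  next
    case False
    \<comment> \<open>The shorter list ends with denominator e + 1, which is why the induction
      generalises over \<open>e\<close>.\<close>
    have d: "d (xs ! i) = (e + 1) + of_nat (length xs - Suc i)" if "i < length xs" for i
    proof -
      have "length xs - i = Suc (length xs - Suc i)" using that by simp
      then show ?thesis using snoc.prems(4)[of i] that by (simp add: nth_append)
    qed
    have nz: "(e + 1) + of_nat i \<noteq> 0" if "i < length xs" for i
      using snoc.prems(5)[of "Suc i"] that by (simp add: add_ac)
    have e: "e \<noteq> 0" "e + 1 \<noteq> 0" using snoc.prems(5)[of 0] nz[of 0] False by auto
    have IH: "fold (\<lambda>x v I. v I - A x v I / d x) xs w = (\<lambda>I. w I - (\<Sum>x\<in>set xs. A x w I) / (e + 1))"
      using snoc.prems d nz by (intro snoc.IH) auto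
    have "A y (A x w) = (\<lambda>I. - A x w I)" if "x \<in> set xs" for x
      using snoc.prems(2) that by (intro snoc.prems(3)) auto
    moreover have lin_y: "linear_op (A y)" using snoc.prems(1) by simp
    ultimately have "A y (\<lambda>I. w I - (\<Sum>x\<in>set xs. A x w I) / (e + 1)) = (\<lambda>I. A y w I + (\<Sum>x\<in>set xs. A x w I) / (e + 1))"
      unfolding linear_op_divide_diff[OF lin_y] linear_op_sum[OF lin_y] by (simp add: sum_negf)
    moreover have "d y = e" using snoc.prems(4)[of "length xs"] by simp
    ultimately have "fold (\<lambda>x v I. v I - A x v I / d x) (xs @ [y]) w = (\<lambda>I. w I - (\<Sum>x\<in>set xs. A x w I) / (e + 1) -
        (A y w I + (\<Sum>x\<in>set xs. A x w I) / (e + 1)) / e)"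
      by (simp add: IH)
    also have "\<dots> = (\<lambda>I. w I - ((\<Sum>x\<in>set xs. A x w I) + A y w I) / e)"
      using e by (intro ext fuse_arith(2)) auto
    finally show ?thesis using snoc.prems(2) by (simp add: add.commute)
  qed
qed simp

text \<open>The normal form of a block after fusion: one sum over \<open>T\<close> and one
  denominator per row. Columns take the same form with the segments exchanged, since the operators
  are symmetric in their two factors.\<close>

definition rows :: "(nat \<Rightarrow> nat \<Rightarrow> tensor \<Rightarrow> tensor) \<Rightarrow> nat list \<Rightarrow> nat set \<Rightarrow> (nat \<Rightarrow> complex) \<Rightarrow> tensor \<Rightarrow> tensor" where
  "rows Q ps T d w = fold (\<lambda>p v I. v I - (\<Sum>q\<in>T. Q p q v I) / d p) ps w"

context pair_operator
begin

lemma linear: "p \<noteq> q \<Longrightarrow> linear_op (Q p q)"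
  by (simp add: linear_op_def lincomb)

lemma pair_R_linear: "p \<noteq> q \<Longrightarrow> linear_op (pair_R Q p q x)"
  unfolding pair_R_def by (intro linear_op_minus_divide linear)

lemma pair_R_commute:
  assumes "p \<noteq> q" "r \<noteq> s" "{p, q} \<inter> {r, s} = {}"
  shows "pair_R Q p q x (pair_R Q r s y v) = pair_R Q r s y (pair_R Q p q x v)"
  unfolding pair_R_def linear_op_divide_diff[OF linear[OF assms(1)]] linear_op_divide_diff[OF linear[OF assms(2)]]
    commute[OF assms] by (simp add: fun_eq_iff diff_divide_distrib mult.commute)

lemma pair_R_tensor_space:
  assumes "p \<noteq> q" "p \<in> {1..N}" "q \<in> {1..N}" "v \<in> tensor_space n N"
  shows "pair_R Q p q x v \<in> tensor_space n N"
  using assms(4) in_tensor_space[OF assms] by (simp add: pair_R_def tensor_space_def)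

lemma pair_R_fold_tensor_space:
  assumes "\<And>p q. (p, q) \<in> set ps \<Longrightarrow> p \<noteq> q \<and> p \<in> {1..N} \<and> q \<in> {1..N}" "v \<in> tensor_space n N"
  shows "R_product Q x ps v \<in> tensor_space n N"
  using assms
proof (induction ps arbitrary: v)
  case (Cons a ps)
  obtain p q where a: "a = (p, q)" by force
  have "p \<noteq> q \<and> p \<in> {1..N} \<and> q \<in> {1..N}" by (rule Cons.prems(1)) (simp add: a)
  then have "pair_R Q p q (x p q) v \<in> tensor_space n N"
    using Cons.prems(2) pair_R_tensor_space by blast
  then have "R_product Q x ps (pair_R Q p q (x p q) v) \<in> tensor_space n N"
    by (intro Cons.IH) (rule Cons.prems(1), simp)
  then show ?case by (simp add: a)
qed simp

lemma transport_alternating: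
  assumes "alternating S w" "r \<in> S" "s \<in> S" "r \<noteq> s" "p \<noteq> q"
  shows "Q p q w (I \<circ> transpose r s) = - Q (transpose r s p) (transpose r s q) w I"
proof -
  have "transpose r s p \<noteq> transpose r s q" using assms(5) by (metis transpose_involutory)
  then have "Q (transpose r s p) (transpose r s q) (\<lambda>I. - w I) = (\<lambda>I. - Q (transpose r s p) (transpose r s q) w I)"
    by (intro linear_op_uminus linear)
  then show ?thesis
    unfolding transport[OF assms(5)] alternatingD[OF assms(1-4)] by simp
qed

lemma alternating_sum_fixed:
  assumes "alternating S w" "p \<notin> S"
  shows "alternating S (\<lambda>I. \<Sum>q\<in>S. Q p q w I)"
  unfolding alternating_def
proof (intro ballI impI allI)
  fix r s I assume rs: "r \<in> S" "s \<in> S" "r \<noteq> s"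
  then have p: "transpose r s p = p" using assms(2) by (auto simp: transpose_def)
  have "(\<Sum>q\<in>S. Q p q w (I \<circ> transpose r s)) = (\<Sum>q\<in>S. - Q p (transpose r s q) w I)"
  proof (intro sum.cong refl)
    fix q assume "q \<in> S"
    then have "p \<noteq> q" using assms(2) by auto
    from transport_alternating[OF assms(1) rs this]
    show "Q p q w (I \<circ> transpose r s) = - Q p (transpose r s q) w I" unfolding p .
  qed
  also have "\<dots> = (\<Sum>q\<in>S. - Q p q w I)"
    by (rule sum.reindex_bij_witness[of _ "transpose r s" "transpose r s"])
       (use rs in \<open>auto simp: transpose_def\<close>)
  finally show "(\<Sum>q\<in>S. Q p q w (I \<circ> transpose r s)) = - (\<Sum>q\<in>S. Q p q w I)"
    by (simp add: sum_negf)
qed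

lemma alternating_disjoint:
  assumes "alternating S w" "p \<notin> S" "q \<notin> S" "p \<noteq> q"
  shows "alternating S (Q p q w)"
  unfolding alternating_def
proof (intro ballI impI allI)
  fix r s I assume rs: "r \<in> S" "s \<in> S" "r \<noteq> s"
  then have "transpose r s p = p" "transpose r s q = q" using assms by (auto simp: transpose_def)
  then show "Q p q w (I \<circ> transpose r s) = - Q p q w I"
    using transport_alternating[OF assms(1) rs assms(4), of I] by simp
qed

lemma alternating_pair_R_disjoint:
  assumes "alternating S w" "p \<notin> S" "q \<notin> S" "p \<noteq> q"
  shows "alternating S (pair_R Q p q x w)"
  using assms(1) alternating_disjoint[OF assms] by (auto simp: alternating_def pair_R_def)

lemma alternating_pair_R_same:
  assumes "alternating {p, q} w" "p \<noteq> q"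
  shows "alternating {p, q} (pair_R Q p q x w)"
proof -
  have "pair_R Q p q x w (I \<circ> transpose p q) = - pair_R Q p q x w I" for I
    using transport_alternating[OF assms(1) _ _ assms(2,2), of I] sym[OF assms(2)]
      alternatingD[OF assms(1) _ _ assms(2), of I]
    by (simp add: pair_R_def del: o_apply)
  then show ?thesis unfolding alternating_def by (auto simp: transpose_commute[of q p])
qed

lemma alternating_pair_R_fold_disjoint:
  assumes "\<And>p q. (p, q) \<in> set ps \<Longrightarrow> p \<noteq> q \<and> p \<notin> S \<and> q \<notin> S" "alternating S v"
  shows "alternating S (R_product Q x ps v)"
  using assms
proof (induction ps arbitrary: v)
  case (Cons a ps)
  obtain p q where a: "a = (p, q)" by force
  have "p \<noteq> q \<and> p \<notin> S \<and> q \<notin> S" by (rule Cons.prems(1)) (simp add: a)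
  then have "alternating S (pair_R Q p q (x p q) v)"
    using Cons.prems(2) alternating_pair_R_disjoint by blast
  then have "alternating S (R_product Q x ps (pair_R Q p q (x p q) v))"
    by (intro Cons.IH) (rule Cons.prems(1), simp)
  then show ?case by (simp add: a)
qed simp

text \<open>A single factor may destroy antisymmetry in \<open>T\<close>, but permutations of
  \<open>T\<close> only permute the summands of a whole row.\<close>

lemma row_alternating:
  assumes "alternating T w" "p \<notin> T"
  shows "alternating T (\<lambda>I. w I - (\<Sum>q\<in>T. Q p q w I) / d)"
  using alternating_lincomb[OF assms(1) alternating_sum_fixed[OF assms], of 1 "- (1 / d)"] by simp

lemma row_tensor_space:
  assumes "w \<in> tensor_space n N" "p \<notin> T" "p \<in> {1..N}" "T \<subseteq> {1..N}"
  shows "(\<lambda>I. w I - (\<Sum>q\<in>T. Q p q w I) / d) \<in> tensor_space n N"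
proof -
  have "Q p q w \<in> tensor_space n N" if "q \<in> T" for q
    using assms that by (intro in_tensor_space) auto
  then show ?thesis using assms(1) by (simp add: tensor_space_def)
qed

text \<open>Fusing a row needs antisymmetry in \<open>T\<close>, and a fused row returns it to the
  next one; hence both conclusions are proved together.\<close>

lemma rows_eq:
  assumes "\<And>p v. \<lbrakk>p \<in> set ps; alternating T v; v \<in> tensor_space n N\<rbrakk> \<Longrightarrow>
      F p v = (\<lambda>I. v I - (\<Sum>q\<in>T. Q p q v I) / d p)"
    and "alternating T w" "w \<in> tensor_space n N" "set ps \<inter> T = {}" "set ps \<subseteq> {1..N}" "T \<subseteq> {1..N}"
  shows "fold F ps w = rows Q ps T d w \<and> alternating T (rows Q ps T d w)"
  using assms
proof (induction ps arbitrary: w)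
  case (Cons p ps)
  have F: "F p w = (\<lambda>I. w I - (\<Sum>q\<in>T. Q p q w I) / d p)"
    using Cons.prems by (intro Cons.prems(1)) auto
  have "alternating T (F p w)" "F p w \<in> tensor_space n N"
    unfolding F using Cons.prems by (auto intro!: row_alternating row_tensor_space)
  then have "fold F ps (F p w) = rows Q ps T d (F p w) \<and> alternating T (rows Q ps T d (F p w))"
    using Cons.prems by (intro Cons.IH) auto
  then show ?case by (simp add: rows_def F)
qed (simp add: rows_def)

end

section \<open>Rectangles of pairs, read by rows and by columns\<close>

lemma filter_snd_product:
  assumes "distinct qs" "q \<in> set qs"
  shows "filter (\<lambda>x. snd x = q) (List.product ps qs) = map (\<lambda>p. (p, q)) ps"
proof -
  have *: "filter (\<lambda>y. y = q) qs = [q]"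
    using assms by (induction qs) (auto simp: filter_empty_conv)
  have "filter (\<lambda>x. snd x = q) (map (Pair p) qs) = [(p, q)]" for p
    using * by (simp add: filter_map comp_def)
  note ** = this
  show ?thesis by (induction ps) (simp_all add: ** del: filter_map)
qed

lemma product_fold:
  "fold f (List.product ps qs) v = fold (\<lambda>p. fold (\<lambda>q. f (p, q)) qs) ps v"
  by (induction ps arbitrary: v) (simp_all add: fold_map comp_def)

lemma sorted_wrt_product:
  assumes "sorted_wrt R ps" "sorted_wrt R' qs"
  shows "sorted_wrt (\<lambda>x y. R (fst x) (fst y) \<or> fst x = fst y \<and> R' (snd x) (snd y)) (List.product ps qs)"
  using assms(1)
  by (induction ps)
     (auto simp: sorted_wrt_append sorted_wrt_map intro: sorted_wrt_mono_rel[OF _ assms(2)])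

context pair_operator
begin

text \<open>Factors in different rows and different columns of the rectangle act on disjoint pairs
  of tensor factors and commute. Passing from row order to column order requires nothing
  more.\<close>

lemma product_fold_columns:
  assumes "set ps \<inter> set qs = {}" "distinct ps" "distinct qs" "sorted_wrt R ps" "sorted_wrt R' qs"
    and R': "\<And>x y. x \<in> set qs \<Longrightarrow> y \<in> set qs \<Longrightarrow> R' x y \<Longrightarrow> \<not> R' y x \<and> x \<noteq> y"
    and R: "\<And>x y. x \<in> set ps \<Longrightarrow> y \<in> set ps \<Longrightarrow> R x y \<Longrightarrow> x \<noteq> y"
  shows "R_product Q x (List.product ps qs) v =
    fold (\<lambda>q. fold (\<lambda>p. pair_R Q p q (x p q)) ps) qs v"
proof -
  have "R_product Q x (List.product ps qs) v =
    fold (\<lambda>q. R_product Q x (filter (\<lambda>x. snd x = q) (List.product ps qs))) qs v"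
  proof (rule fold_by_key[OF sorted_wrt_product[OF assms(4,5)] assms(5,3)])
    fix a b v
    assume ab: "a \<in> set (List.product ps qs)" "b \<in> set (List.product ps qs)"
      "R (fst a) (fst b) \<or> fst a = fst b \<and> R' (snd a) (snd b)" "R' (snd b) (snd a)"
    obtain p q r s where [simp]: "a = (p, q)" "b = (r, s)" by force
    have "q \<noteq> s" "p \<noteq> r" "p \<noteq> q" "r \<noteq> s" "p \<noteq> s" "q \<noteq> r"
      using ab assms(1) R' R by auto
    then show "(case a of (p, q) \<Rightarrow> pair_R Q p q (x p q)) ((case b of (p, q) \<Rightarrow> pair_R Q p q (x p q)) v) =
        (case b of (p, q) \<Rightarrow> pair_R Q p q (x p q)) ((case a of (p, q) \<Rightarrow> pair_R Q p q (x p q)) v)"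
      by (auto intro!: pair_R_commute)
  qed auto
  also have "\<dots> = fold (\<lambda>q. fold (\<lambda>p. pair_R Q p q (x p q)) ps) qs v"
    by (rule fold_cong) (simp_all add: filter_snd_product[OF assms(3)] fold_map comp_def)
  finally show ?thesis .
qed

end

text \<open>The denominators rise with q, as fusion of P_tilde requires, and the one at q = t
  survives.\<close>

lemma P_tilde_row:
  assumes "g = SP \<longrightarrow> even n" "alternating {t..<t + b} w" "w \<in> tensor_space n N"
    and "p \<notin> {t..<t + b}" "p \<in> {1..N}" "{t..<t + b} \<subseteq> {1..N}"
    and "\<And>q. q \<in> {t..<t + b} \<Longrightarrow> d q = e + of_nat q" "\<And>q. q \<in> {t..<t + b} \<Longrightarrow> e + of_nat q \<noteq> 0"
  shows "fold (\<lambda>q. pair_R (P_tilde_op g n) p q (d q)) [t..<t + b] w =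
    (\<lambda>I. w I - (\<Sum>q\<in>{t..<t + b}. P_tilde_op g n p q w I) / (e + of_nat t))"
proof -
  interpret pair_operator "P_tilde_op g n" n by (rule pair_operator_P_tilde[OF assms(1)])
  have "fold (\<lambda>q v I. v I - P_tilde_op g n p q v I / d q) [t..<t + b] w =
      (\<lambda>I. w I - (\<Sum>q\<in>set [t..<t + b]. P_tilde_op g n p q w I) / (e + of_nat t))"
  proof (rule fuse_up)
    fix x y assume "x \<in> set [t..<t + b]" "y \<in> set [t..<t + b]" "x \<noteq> y"
    then show "P_tilde_op g n p y (P_tilde_op g n p x w) = (\<lambda>I. - P_tilde_op g n p y w I)"
      using assms(4-6) alternatingD[OF assms(2)] by (intro P_tilde_fuse[OF assms(3)]) auto
  next
    fix i assume "i < length [t..<t + b]"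
    then show "d ([t..<t + b] ! i) = e + of_nat t + of_nat i" "e + of_nat t + of_nat i \<noteq> 0"
      using assms(7,8)[of "t + i"] by (simp_all add: add.assoc)
  qed (use assms(4) in \<open>auto intro: linear\<close>)
  then show ?thesis by (simp add: pair_R_def[abs_def])
qed

text \<open>The denominators fall as q grows, as \<open>P_fuse\<close> requires; this is the purpose
  of reversing the segments in \<open>B_pairs\<close>. The surviving denominator belongs to the last
  index t + b - 1.\<close>

lemma P_row:
  assumes "alternating {t..<t + b} w" "w \<in> tensor_space n N"
    and "p \<notin> {t..<t + b}" "p \<in> {1..N}" "{t..<t + b} \<subseteq> {1..N}"
    and "\<And>q. q \<in> {t..<t + b} \<Longrightarrow> d q = e - of_nat q" "\<And>q. q \<in> {t..<t + b} \<Longrightarrow> e - of_nat q \<noteq> 0"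
  shows "fold (\<lambda>q. pair_R (P_op n) p q (d q)) [t..<t + b] w =
    (\<lambda>I. w I - (\<Sum>q\<in>{t..<t + b}. P_op n p q w I) / (e + 1 - of_nat (t + b)))"
proof -
  interpret pair_operator "P_op n" n by (rule pair_operator_P)
  have "fold (\<lambda>q v I. v I - P_op n p q v I / d q) [t..<t + b] w =
      (\<lambda>I. w I - (\<Sum>q\<in>set [t..<t + b]. P_op n p q w I) / (e + 1 - of_nat (t + b)))"
  proof (rule fuse_down)
    fix x y assume "x \<in> set [t..<t + b]" "y \<in> set [t..<t + b]" "x \<noteq> y"
    then show "P_op n p y (P_op n p x w) = (\<lambda>I. - P_op n p x w I)"
      using assms(3-5) alternatingD[OF assms(1)] by (intro P_fuse[OF assms(2)]) auto
  next
    fix i assume i: "i < length [t..<t + b]"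
    then show "d ([t..<t + b] ! i) = e + 1 - of_nat (t + b) + of_nat (length [t..<t + b] - Suc i)"
      using assms(6)[of "t + i"] by (simp add: of_nat_diff)
    \<comment> \<open>Counted upwards from the surviving one, the i-th denominator belongs to this
      index.\<close>
    have "t + b - Suc i \<in> {t..<t + b}" using i by auto
    then show "e + 1 - of_nat (t + b) + of_nat i \<noteq> 0"
      using assms(7)[of "t + b - Suc i"] i by (simp add: of_nat_diff algebra_simps)
  qed (use assms(3) in \<open>auto intro: linear\<close>)
  then show ?thesis by (simp add: pair_R_def[abs_def])
qed

text \<open>The denominators grow with p, so the column is run through downwards, and the one at
  \<open>s\<close> survives.\<close>

lemma P_column:
  assumes "alternating {s..<s + a} w" "w \<in> tensor_space n N"
    and "q \<notin> {s..<s + a}" "q \<in> {1..N}" "{s..<s + a} \<subseteq> {1..N}"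
    and "\<And>p. p \<in> {s..<s + a} \<Longrightarrow> d p = e + of_nat p" "\<And>p. p \<in> {s..<s + a} \<Longrightarrow> e + of_nat p \<noteq> 0"
  shows "fold (\<lambda>p. pair_R (P_op n) p q (d p)) (rev [s..<s + a]) w =
    (\<lambda>I. w I - (\<Sum>p\<in>{s..<s + a}. P_op n q p w I) / (e + of_nat s))"
proof -
  interpret pair_operator "P_op n" n by (rule pair_operator_P)
  have sym': "P_op n p q = P_op n q p" if "p \<in> {s..<s + a}" for p
    using assms(3) that by (intro sym) auto
  have "fold (\<lambda>p v I. v I - P_op n q p v I / d p) (rev [s..<s + a]) w =
      (\<lambda>I. w I - (\<Sum>p\<in>set (rev [s..<s + a]). P_op n q p w I) / (e + of_nat s))"
  proof (rule fuse_down)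
    fix x y assume "x \<in> set (rev [s..<s + a])" "y \<in> set (rev [s..<s + a])" "x \<noteq> y"
    then show "P_op n q y (P_op n q x w) = (\<lambda>I. - P_op n q x w I)"
      using assms(3-5) alternatingD[OF assms(1)] by (intro P_fuse[OF assms(2)]) auto
  next
    fix i assume i: "i < length (rev [s..<s + a])"
    then have "rev [s..<s + a] ! i = s + (a - Suc i)" by (simp add: rev_nth)
    then show "d (rev [s..<s + a] ! i) = e + of_nat s + of_nat (length (rev [s..<s + a]) - Suc i)"
      using assms(6)[of "s + (a - Suc i)"] i by simp
    show "e + of_nat s + of_nat i \<noteq> 0"
      using assms(7)[of "s + i"] i by (simp add: add.assoc)
  qed (use assms(3) in \<open>auto intro: linear\<close>)
  moreover have "fold (\<lambda>p. pair_R (P_op n) p q (d p)) (rev [s..<s + a]) w =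
      fold (\<lambda>p v I. v I - P_op n q p v I / d p) (rev [s..<s + a]) w"
    by (rule fold_cong) (use sym' in \<open>auto simp: pair_R_def\<close>)
  ultimately show ?thesis by simp
qed

lemma P_tilde_column:
  assumes "g = SP \<longrightarrow> even n" "alternating {s..<s + a} w" "w \<in> tensor_space n N"
    and "q \<notin> {s..<s + a}" "q \<in> {1..N}" "{s..<s + a} \<subseteq> {1..N}"
    and "\<And>p. p \<in> {s..<s + a} \<Longrightarrow> d p = e + of_nat p" "\<And>p. p \<in> {s..<s + a} \<Longrightarrow> e + of_nat p \<noteq> 0"
  shows "fold (\<lambda>p. pair_R (P_tilde_op g n) p q (d p)) [s..<s + a] w =
    (\<lambda>I. w I - (\<Sum>p\<in>{s..<s + a}. P_tilde_op g n q p w I) / (e + of_nat s))"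
proof -
  interpret pair_operator "P_tilde_op g n" n by (rule pair_operator_P_tilde[OF assms(1)])
  have "fold (\<lambda>p. pair_R (P_tilde_op g n) p q (d p)) [s..<s + a] w =
      fold (\<lambda>p. pair_R (P_tilde_op g n) q p (d p)) [s..<s + a] w"
  proof (rule fold_cong)
    fix p assume "p \<in> set [s..<s + a]"
    then have "p \<noteq> q" using assms(4) by auto
    then show "pair_R (P_tilde_op g n) p q (d p) = pair_R (P_tilde_op g n) q p (d p)"
      by (auto simp: pair_R_def sym)
  qed simp_all
  then show ?thesis using P_tilde_row[OF assms] by simp
qed

section \<open>Blocks\<close>

text \<open>Read by rows the block is seen to alternate on the second segment, read by columns on
  the first.\<close>

lemma C_block:
  assumes g: "g = SP \<longrightarrow> even n" and w: "alternating {s..<s + a} w" "alternating {t..<t + b} w" "w \<in> tensor_space n N"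
    and N: "{s..<s + a} \<inter> {t..<t + b} = {}" "{s..<s + a} \<subseteq> {1..N}" "{t..<t + b} \<subseteq> {1..N}"
    and nz: "\<And>p q. p \<in> {s..<s + a} \<Longrightarrow> q \<in> {t..<t + b} \<Longrightarrow> e + of_nat p + of_nat q \<noteq> 0"
  defines "B \<equiv> R_product (P_tilde_op g n) (\<lambda>p q. e + of_nat p + of_nat q) (List.product [s..<s + a] [t..<t + b]) w"
  shows "B = rows (P_tilde_op g n) [s..<s + a] {t..<t + b} (\<lambda>p. e + of_nat p + of_nat t) w"
    and "alternating {s..<s + a} B" "alternating {t..<t + b} B"
proof -
  interpret pair_operator "P_tilde_op g n" n by (rule pair_operator_P_tilde[OF g])
  have "B = fold (\<lambda>p. fold (\<lambda>q. pair_R (P_tilde_op g n) p q (e + of_nat p + of_nat q)) [t..<t + b]) [s..<s + a] w"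
    unfolding B_def by (simp add: product_fold)
  moreover have "fold (\<lambda>p. fold (\<lambda>q. pair_R (P_tilde_op g n) p q (e + of_nat p + of_nat q)) [t..<t + b]) [s..<s + a] w =
      rows (P_tilde_op g n) [s..<s + a] {t..<t + b} (\<lambda>p. e + of_nat p + of_nat t) w \<and>
      alternating {t..<t + b} (rows (P_tilde_op g n) [s..<s + a] {t..<t + b} (\<lambda>p. e + of_nat p + of_nat t) w)"
  proof (rule rows_eq)
    fix p v assume p: "p \<in> set [s..<s + a]" and v: "alternating {t..<t + b} v" "v \<in> tensor_space n N"
    then have "p \<in> {s..<s + a}" by simp
    then show "fold (\<lambda>q. pair_R (P_tilde_op g n) p q (e + of_nat p + of_nat q)) [t..<t + b] v =
        (\<lambda>I. v I - (\<Sum>q\<in>{t..<t + b}. P_tilde_op g n p q v I) / (e + of_nat p + of_nat t))"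
      using N nz by (intro P_tilde_row[OF g v]) blast+
  qed (use w N in auto)
  ultimately show "B = rows (P_tilde_op g n) [s..<s + a] {t..<t + b} (\<lambda>p. e + of_nat p + of_nat t) w" "alternating {t..<t + b} B"
    by simp_all
  have "B = fold (\<lambda>q. fold (\<lambda>p. pair_R (P_tilde_op g n) p q (e + of_nat p + of_nat q)) [s..<s + a]) [t..<t + b] w"
    unfolding B_def using N(1) by (intro product_fold_columns[where R = "(<)" and R' = "(<)"]) auto
  moreover have "fold (\<lambda>q. fold (\<lambda>p. pair_R (P_tilde_op g n) p q (e + of_nat p + of_nat q)) [s..<s + a]) [t..<t + b] w =
      rows (P_tilde_op g n) [t..<t + b] {s..<s + a} (\<lambda>q. e + of_nat q + of_nat s) w \<and>
      alternating {s..<s + a} (rows (P_tilde_op g n) [t..<t + b] {s..<s + a} (\<lambda>q. e + of_nat q + of_nat s) w)"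
  proof (rule rows_eq)
    fix q v assume q: "q \<in> set [t..<t + b]" and v: "alternating {s..<s + a} v" "v \<in> tensor_space n N"
    then have q': "q \<in> {t..<t + b}" by simp
    show "fold (\<lambda>p. pair_R (P_tilde_op g n) p q (e + of_nat p + of_nat q)) [s..<s + a] v =
        (\<lambda>I. v I - (\<Sum>p\<in>{s..<s + a}. P_tilde_op g n q p v I) / (e + of_nat q + of_nat s))"
    proof (rule P_tilde_column[OF g v])
      fix p assume "p \<in> {s..<s + a}"
      then show "e + of_nat q + of_nat p \<noteq> 0" using nz[OF _ q', of p] by (simp add: add_ac)
    qed (use q' N in \<open>auto simp: add_ac\<close>)
  qed (use w N in auto)
  ultimately show "alternating {s..<s + a} B" by simp
qed

text \<open>Both normal forms are kept: which of them is suitable for regularity depends on the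
  lengths of the segments.\<close>

lemma B_block:
  assumes w: "alternating {s..<s + a} w" "alternating {t..<t + b} w" "w \<in> tensor_space n N"
    and N: "{s..<s + a} \<inter> {t..<t + b} = {}" "{s..<s + a} \<subseteq> {1..N}" "{t..<t + b} \<subseteq> {1..N}"
    and nz: "\<And>p q. p \<in> {s..<s + a} \<Longrightarrow> q \<in> {t..<t + b} \<Longrightarrow> e + of_nat p - of_nat q \<noteq> 0"
  defines "B \<equiv> R_product (P_op n) (\<lambda>p q. e + of_nat p - of_nat q) (List.product (rev [s..<s + a]) [t..<t + b]) w"
  shows "B = rows (P_op n) (rev [s..<s + a]) {t..<t + b} (\<lambda>p. e + of_nat p + 1 - of_nat (t + b)) w"
    and "B = rows (P_op n) [t..<t + b] {s..<s + a} (\<lambda>q. e - of_nat q + of_nat s) w"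
    and "alternating {s..<s + a} B" "alternating {t..<t + b} B"
proof -
  interpret pair_operator "P_op n" n by (rule pair_operator_P)
  have "B = fold (\<lambda>p. fold (\<lambda>q. pair_R (P_op n) p q (e + of_nat p - of_nat q)) [t..<t + b]) (rev [s..<s + a]) w"
    unfolding B_def by (simp add: product_fold)
  moreover have "fold (\<lambda>p. fold (\<lambda>q. pair_R (P_op n) p q (e + of_nat p - of_nat q)) [t..<t + b]) (rev [s..<s + a]) w =
      rows (P_op n) (rev [s..<s + a]) {t..<t + b} (\<lambda>p. e + of_nat p + 1 - of_nat (t + b)) w \<and>
      alternating {t..<t + b} (rows (P_op n) (rev [s..<s + a]) {t..<t + b} (\<lambda>p. e + of_nat p + 1 - of_nat (t + b)) w)"
  proof (rule rows_eq)
    fix p v assume p: "p \<in> set (rev [s..<s + a])" and v: "alternating {t..<t + b} v" "v \<in> tensor_space n N"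
    then have "p \<in> {s..<s + a}" by simp
    then show "fold (\<lambda>q. pair_R (P_op n) p q (e + of_nat p - of_nat q)) [t..<t + b] v =
        (\<lambda>I. v I - (\<Sum>q\<in>{t..<t + b}. P_op n p q v I) / (e + of_nat p + 1 - of_nat (t + b)))"
      using N nz by (intro P_row[OF v]) blast+
  qed (use w N in auto)
  ultimately show "B = rows (P_op n) (rev [s..<s + a]) {t..<t + b} (\<lambda>p. e + of_nat p + 1 - of_nat (t + b)) w" "alternating {t..<t + b} B"
    by simp_all
  have "B = fold (\<lambda>q. fold (\<lambda>p. pair_R (P_op n) p q (e + of_nat p - of_nat q)) (rev [s..<s + a])) [t..<t + b] w"
    unfolding B_def using N(1)
    by (intro product_fold_columns[where R = "(>)" and R' = "(<)"]) (auto simp: sorted_wrt_rev)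
  moreover have "fold (\<lambda>q. fold (\<lambda>p. pair_R (P_op n) p q (e + of_nat p - of_nat q)) (rev [s..<s + a])) [t..<t + b] w =
      rows (P_op n) [t..<t + b] {s..<s + a} (\<lambda>q. e - of_nat q + of_nat s) w \<and>
      alternating {s..<s + a} (rows (P_op n) [t..<t + b] {s..<s + a} (\<lambda>q. e - of_nat q + of_nat s) w)"
  proof (rule rows_eq)
    fix q v assume q: "q \<in> set [t..<t + b]" and v: "alternating {s..<s + a} v" "v \<in> tensor_space n N"
    then have q': "q \<in> {t..<t + b}" by simp
    show "fold (\<lambda>p. pair_R (P_op n) p q (e + of_nat p - of_nat q)) (rev [s..<s + a]) v =
        (\<lambda>I. v I - (\<Sum>p\<in>{s..<s + a}. P_op n q p v I) / (e - of_nat q + of_nat s))"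
    proof (rule P_column[OF v])
      fix p assume "p \<in> {s..<s + a}"
      then show "e - of_nat q + of_nat p \<noteq> 0" using nz[OF _ q', of p] by (simp add: algebra_simps)
    qed (use q' N in \<open>auto simp: algebra_simps\<close>)
  qed (use w N in auto)
  ultimately show "alternating {s..<s + a} B"
    "B = rows (P_op n) [t..<t + b] {s..<s + a} (\<lambda>q. e - of_nat q + of_nat s) w" by simp_all
qed

section \<open>Pairs of indices within a single segment\<close>

definition triangle :: "nat \<Rightarrow> nat \<Rightarrow> (nat \<times> nat) list" where
  "triangle s k = concat (map (\<lambda>p. map (Pair p) [Suc p..<s + k]) [s..<s + k])"

lemma triangle_0 [simp]: "triangle s 0 = []"
  by (simp add: triangle_def)

lemma triangle_Suc: "triangle s (Suc k) = map (Pair s) [Suc s..<Suc s + k] @ triangle (Suc s) k"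
proof -
  have "[s..<s + Suc k] = s # [Suc s..<Suc s + k]" by (simp add: upt_conv_Cons)
  then show ?thesis by (simp add: triangle_def)
qed

lemma set_triangle: "set (triangle s k) = {(p, q). s \<le> p \<and> p < q \<and> q < s + k}"
proof -
  have "set (triangle s k) = (\<Union>p\<in>{s..<s + k}. Pair p ` {Suc p..<s + k})"
    by (auto simp: triangle_def)
  then show ?thesis by fastforce
qed

lemma sorted_wrt_concat_pairs:
  assumes "sorted_wrt R ps" "\<And>p. p \<in> set ps \<Longrightarrow> sorted_wrt R' (qs p)"
  shows "sorted_wrt (\<lambda>x y. R (fst x) (fst y) \<or> fst x = fst y \<and> R' (snd x) (snd y))
    (concat (map (\<lambda>p. map (Pair p) (qs p)) ps))"
  using assms
proof (induction ps)
  case (Cons p ps)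
  then have "sorted_wrt R' (qs p)" by simp
  then have "sorted_wrt (\<lambda>x y. R p p \<or> R' x y) (qs p)" by (rule sorted_wrt_mono_rel[rotated]) simp
  then show ?case using Cons by (auto simp: sorted_wrt_append sorted_wrt_map)
qed simp

lemma filter_triangle:
  assumes "\<And>p. p \<in> set ps \<Longrightarrow> p < M"
  shows "filter (\<lambda>x. snd x \<noteq> M) (concat (map (\<lambda>p. map (Pair p) [Suc p..<Suc M]) ps)) =
      concat (map (\<lambda>p. map (Pair p) [Suc p..<M]) ps)"
    and "filter (\<lambda>x. \<not> snd x \<noteq> M) (concat (map (\<lambda>p. map (Pair p) [Suc p..<Suc M]) ps)) = map (\<lambda>p. (p, M)) ps"
proof -
  have "filter (\<lambda>x. snd x \<noteq> M) (map (Pair p) [Suc p..<Suc M]) = map (Pair p) [Suc p..<M]"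
    "filter (\<lambda>x. \<not> snd x \<noteq> M) (map (Pair p) [Suc p..<Suc M]) = [(p, M)]" if "p < M" for p
    using that by (auto simp: filter_empty_conv filter_id_conv)
  note * = this
  show "filter (\<lambda>x. snd x \<noteq> M) (concat (map (\<lambda>p. map (Pair p) [Suc p..<Suc M]) ps)) =
      concat (map (\<lambda>p. map (Pair p) [Suc p..<M]) ps)"
    using assms by (induction ps) (simp_all add: * del: upt_Suc)
  show "filter (\<lambda>x. \<not> snd x \<noteq> M) (concat (map (\<lambda>p. map (Pair p) [Suc p..<Suc M]) ps)) = map (\<lambda>p. (p, M)) ps"
    unfolding not_not using assms by (induction ps) (simp_all add: *[unfolded not_not] del: upt_Suc)
qed

text \<open>Through the common element, (x y) = (x c)(c y)(x c) reduces a transposition between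
  \<open>S\<close> and \<open>T\<close> to ones inside them.\<close>

lemma alternating_union:
  assumes "alternating S f" "alternating T f" "c \<in> S" "c \<in> T"
  shows "alternating (S \<union> T) f"
proof -
  have *: "f (Z \<circ> transpose x y) = - f Z" if "x \<in> S" "y \<in> T" "x \<noteq> y" for x y Z
  proof (cases "x = c \<or> y = c")
    case True
    then show ?thesis
      using that assms(3,4) alternatingD[OF assms(1), of x y Z] alternatingD[OF assms(2), of x y Z] by blast
  next
    case False
    then have xy: "x \<noteq> c" "c \<noteq> y" by auto
    have "Z \<circ> transpose x y = Z \<circ> transpose x c \<circ> transpose c y \<circ> transpose x c"
      using xy that by (auto simp: fun_eq_iff transpose_def)
    then show ?thesis
      by (simp only: alternatingD[OF assms(1) that(1) assms(3) xy(1)] alternatingD[OF assms(2,4) that(2) xy(2)] minus_minus)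
  qed
  have **: "f (Z \<circ> transpose x y) = - f Z" if "x \<in> T" "y \<in> S" "x \<noteq> y" for x y Z
    using *[of y x Z] that by (simp add: transpose_commute)
  show ?thesis
    unfolding alternating_def
  proof (intro ballI impI allI)
    fix x y and Z :: "nat \<Rightarrow> nat" assume "x \<in> S \<union> T" "y \<in> S \<union> T" "x \<noteq> y"
    then show "f (Z \<circ> transpose x y) = - f Z"
      using * ** alternatingD[OF assms(1)] alternatingD[OF assms(2)] by blast
  qed
qed

context
  fixes g :: lie_type and n N :: nat and e :: complex
  assumes g: "g = SP \<longrightarrow> even n"
begin

interpretation pair_operator "P_tilde_op g n" n by (rule pair_operator_P_tilde[OF g])

definition triangle_prod :: "nat \<Rightarrow> nat \<Rightarrow> tensor \<Rightarrow> tensor" where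
  "triangle_prod s k = R_product (P_tilde_op g n) (\<lambda>p q. e + of_nat p + of_nat q) (triangle s k)"

lemma triangle_prod_row:
  assumes w: "alternating {Suc s..<Suc s + k} w" "w \<in> tensor_space n N" and N: "{s..<s + Suc k} \<subseteq> {1..N}"
    and nz: "\<And>q. s < q \<Longrightarrow> q < s + Suc k \<Longrightarrow> e + of_nat s + of_nat q \<noteq> 0"
  shows "triangle_prod s (Suc k) w = triangle_prod (Suc s) k
    (\<lambda>I. w I - (\<Sum>q\<in>{Suc s..<Suc s + k}. P_tilde_op g n s q w I) / (e + of_nat s + of_nat (Suc s)))"
proof -
  have "s \<in> {1..N}" using subsetD[OF N, of s] by simp
  moreover have "{Suc s..<Suc s + k} \<subseteq> {1..N}" using N by auto
  ultimately have "fold (\<lambda>q. pair_R (P_tilde_op g n) s q (e + of_nat s + of_nat q)) [Suc s..<Suc s + k] w =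
    (\<lambda>I. w I - (\<Sum>q\<in>{Suc s..<Suc s + k}. P_tilde_op g n s q w I) / (e + of_nat s + of_nat (Suc s)))"
    using nz by (intro P_tilde_row[OF g w]) auto
  then show ?thesis
    unfolding triangle_prod_def triangle_Suc fold_append fold_map by (simp add: comp_def del: upt_Suc of_nat_Suc)
qed

text \<open>The factors of the last column can be postponed to the end: a factor (r, t) that follows
  (p, s + k) and lies outside this column has p < r < t < s + k, so the two are disjoint.\<close>

lemma triangle_prod_column:
  assumes v: "alternating {s..<s + k} (triangle_prod s k w)" and w: "w \<in> tensor_space n N"
    and N: "{s..<s + Suc k} \<subseteq> {1..N}"
    and nz: "\<And>p. s \<le> p \<Longrightarrow> p < s + k \<Longrightarrow> e + of_nat p + of_nat (s + k) \<noteq> 0"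
  shows "triangle_prod s (Suc k) w = (\<lambda>I. triangle_prod s k w I -
    (\<Sum>p\<in>{s..<s + k}. P_tilde_op g n (s + k) p (triangle_prod s k w) I) / (e + of_nat (s + k) + of_nat s))"
proof -
  let ?f = "\<lambda>(p, q). pair_R (P_tilde_op g n) p q (e + of_nat p + of_nat q)"
  have T: "triangle s (Suc k) = concat (map (\<lambda>p. map (Pair p) [Suc p..<Suc (s + k)]) [s..<s + k])"
    by (simp add: triangle_def)
  have "fold ?f (triangle s (Suc k)) w =
    fold ?f (filter (\<lambda>x. \<not> snd x \<noteq> s + k) (triangle s (Suc k))) (fold ?f (filter (\<lambda>x. snd x \<noteq> s + k) (triangle s (Suc k))) w)"
  proof (rule fold_filter_split)
    show "sorted_wrt (\<lambda>x y. fst x < fst y \<or> fst x = fst y \<and> snd x < snd y) (triangle s (Suc k))"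
      unfolding T by (rule sorted_wrt_concat_pairs) (auto simp del: upt_Suc)
    fix x y v assume xy: "x \<in> set (triangle s (Suc k))" "y \<in> set (triangle s (Suc k))"
      "fst x < fst y \<or> fst x = fst y \<and> snd x < snd y" "\<not> snd x \<noteq> s + k" "snd y \<noteq> s + k"
    obtain p q r t where [simp]: "x = (p, q)" "y = (r, t)" by force
    have "p \<noteq> q" "r \<noteq> t" "p \<noteq> r" "p \<noteq> t" "q \<noteq> r" "q \<noteq> t"
      using xy by (auto simp: set_triangle)
    then show "?f x (?f y v) = ?f y (?f x v)"
      by (auto intro!: pair_R_commute)
  qed
  also have "filter (\<lambda>x. snd x \<noteq> s + k) (triangle s (Suc k)) = triangle s k"
    unfolding T by (subst filter_triangle(1)) (auto simp: triangle_def)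
  also have "filter (\<lambda>x. \<not> snd x \<noteq> s + k) (triangle s (Suc k)) = map (\<lambda>p. (p, s + k)) [s..<s + k]"
    unfolding T by (rule filter_triangle(2)) auto
  finally have "triangle_prod s (Suc k) w =
      fold (\<lambda>p. pair_R (P_tilde_op g n) p (s + k) (e + of_nat p + of_nat (s + k))) [s..<s + k] (triangle_prod s k w)"
    unfolding triangle_prod_def by (simp add: fold_map comp_def)
  also have "\<dots> = (\<lambda>I. triangle_prod s k w I -
    (\<Sum>p\<in>{s..<s + k}. P_tilde_op g n (s + k) p (triangle_prod s k w) I) / (e + of_nat (s + k) + of_nat s))"
  proof (rule P_tilde_column[OF g v])
    show "triangle_prod s k w \<in> tensor_space n N"
      unfolding triangle_prod_def
      by (rule pair_R_fold_tensor_space[OF _ w]) (use N in \<open>auto simp: set_triangle subset_iff\<close>)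
    fix p assume "p \<in> {s..<s + k}"
    then show "e + of_nat (s + k) + of_nat p \<noteq> 0" using nz[of p] by (simp add: add_ac)
  qed (use N in \<open>auto simp: add_ac subset_iff\<close>)
  finally show ?thesis .
qed

text \<open>Splitting off the last column shows antisymmetry in all indices but the last, splitting
  off the first row in all but the first.\<close>

lemma triangle_prod_alternating:
  assumes "alternating {s..<s + k} w" "w \<in> tensor_space n N" and "{s..<s + k} \<subseteq> {1..N}"
    and "\<And>p q. s \<le> p \<Longrightarrow> p < q \<Longrightarrow> q < s + k \<Longrightarrow> e + of_nat p + of_nat q \<noteq> 0"
  shows "alternating {s..<s + k} (triangle_prod s k w)"
  using assms
proof (induction k arbitrary: s w)
  case (Suc k)
  have sub: "{s..<s + k} \<subseteq> {s..<s + Suc k}" "{Suc s..<Suc s + k} \<subseteq> {s..<s + Suc k}" by auto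
  have s: "s \<in> {1..N}" using subsetD[OF Suc.prems(3), of s] by simp
  have col: "alternating {s..<s + k} (triangle_prod s (Suc k) w)"
  proof -
    have v: "alternating {s..<s + k} (triangle_prod s k w)"
      using Suc.prems(3,4) by (intro Suc.IH alternating_subset[OF Suc.prems(1) sub(1)] Suc.prems(2)) auto
    then show ?thesis
      unfolding triangle_prod_column[OF v Suc.prems(2,3) Suc.prems(4), simplified]
      by (intro row_alternating) auto
  qed
  have row: "alternating {Suc s..<Suc s + k} (triangle_prod s (Suc k) w)"
  proof -
    have w': "alternating {Suc s..<Suc s + k} w" by (rule alternating_subset[OF Suc.prems(1) sub(2)])
    have e: "triangle_prod s (Suc k) w = triangle_prod (Suc s) k
        (\<lambda>I. w I - (\<Sum>q\<in>{Suc s..<Suc s + k}. P_tilde_op g n s q w I) / (e + of_nat s + of_nat (Suc s)))"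
      using Suc.prems(3,4) by (intro triangle_prod_row w' Suc.prems(2)) auto
    show ?thesis
      unfolding e using Suc.prems(3,4) s
      by (intro Suc.IH row_alternating row_tensor_space w' Suc.prems(2)) auto
  qed
  \<comment> \<open>The two index sets overlap only for k at least 2. With just two indices,
    antisymmetry follows from the symmetry of P_tilde.\<close>
  consider "k = 0" | "k = 1" | "k \<ge> 2" by linarith
  then show ?case
  proof cases
    case 1
    then show ?thesis by (simp add: alternating_def)
  next
    case 2
    have "triangle_prod s 2 w = pair_R (P_tilde_op g n) s (Suc s) (e + of_nat s + of_nat (Suc s)) w"
      by (simp add: triangle_prod_def triangle_Suc numeral_2_eq_2)
    moreover have "{s..<s + Suc 1} = {s, Suc s}" by auto
    ultimately show ?thesis
      using 2 Suc.prems(1) alternating_pair_R_same[of s "Suc s" w] by (simp add: numeral_2_eq_2)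
  next
    case 3
    then have "alternating ({s..<s + k} \<union> {Suc s..<Suc s + k}) (triangle_prod s (Suc k) w)"
      by (intro alternating_union[OF col row, of "Suc s"]) auto
    moreover have "{s..<s + k} \<union> {Suc s..<Suc s + k} = {s..<s + Suc k}" using 3 by auto
    ultimately show ?thesis by (simp only:)
  qed
qed (simp add: alternating_def)

text \<open>Row p involves, besides p, only the indices above p, and the earlier rows preserve
  antisymmetry in those.\<close>

lemma triangle_prod_rows:
  assumes "alternating {s..<s + k} w" "w \<in> tensor_space n N" and "{s..<s + k} \<subseteq> {1..N}"
    and "\<And>p q. s \<le> p \<Longrightarrow> p < q \<Longrightarrow> q < s + k \<Longrightarrow> e + of_nat p + of_nat q \<noteq> 0"
  shows "triangle_prod s k w = fold (\<lambda>p v I. v I - (\<Sum>q\<in>{Suc p..<s + k}. P_tilde_op g n p q v I) /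
    (e + of_nat p + of_nat (Suc p))) [s..<s + k] w"
  using assms
proof (induction k arbitrary: s w)
  case (Suc k)
  have sub: "{Suc s..<Suc s + k} \<subseteq> {s..<s + Suc k}" by auto
  have s: "s \<in> {1..N}" using subsetD[OF Suc.prems(3), of s] by simp
  have w': "alternating {Suc s..<Suc s + k} w" by (rule alternating_subset[OF Suc.prems(1) sub])
  let ?w = "\<lambda>I. w I - (\<Sum>q\<in>{Suc s..<Suc s + k}. P_tilde_op g n s q w I) / (e + of_nat s + of_nat (Suc s))"
  have "triangle_prod s (Suc k) w = triangle_prod (Suc s) k ?w"
    using Suc.prems(3,4) by (intro triangle_prod_row w' Suc.prems(2)) auto
  also have "\<dots> = fold (\<lambda>p v I. v I - (\<Sum>q\<in>{Suc p..<Suc s + k}. P_tilde_op g n p q v I) /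
    (e + of_nat p + of_nat (Suc p))) [Suc s..<Suc s + k] ?w"
    using Suc.prems(3,4) s
    by (intro Suc.IH row_alternating row_tensor_space w' Suc.prems(2)) auto
  also have "\<dots> = fold (\<lambda>p v I. v I - (\<Sum>q\<in>{Suc p..<s + Suc k}. P_tilde_op g n p q v I) /
    (e + of_nat p + of_nat (Suc p))) (s # [Suc s..<s + Suc k]) w"
    by (simp del: upt_Suc of_nat_Suc)
  also have "s # [Suc s..<s + Suc k] = [s..<s + Suc k]" by (simp add: upt_conv_Cons)
  finally show ?case .
qed (simp add: triangle_prod_def)

end

lemma triangle_prod_SO:
  assumes "alternating {s..<s + k} w"
  shows "triangle_prod SO n e s k w = w"
proof -
  have "R_product (P_tilde_op SO n) (\<lambda>p q. e + of_nat p + of_nat q) ps w = w"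
    if "set ps \<subseteq> set (triangle s k)" for ps
    using that
  proof (induction ps)
    case (Cons x ps)
    obtain p q where x: "x = (p, q)" by force
    then have "p \<in> {s..<s + k}" "q \<in> {s..<s + k}" "p \<noteq> q" using Cons.prems by (auto simp: set_triangle)
    then have "P_tilde_op SO n p q w = (\<lambda>I. 0)"
      using alternatingD[OF assms] by (intro P_tilde_alternating_SO) auto
    then show ?case using Cons by (simp add: x pair_R_def)
  qed simp
  then show ?thesis by (simp add: triangle_prod_def)
qed

text \<open>The denominators 1, ..., a are those of the rows at omega_a + omega_b = 0 and also those
  of the determinantal recursion, whose p-th term is the product of the first p rows.\<close>

lemma C_block_vanishing:
  assumes "g = SP \<longrightarrow> even n" "alternating {s..<s + a} w" "alternating {t..<t + b} w"
    and "{s..<s + a} \<inter> {t..<t + b} = {}" "{s..<s + a} \<subseteq> {1..N}" "{t..<t + b} \<subseteq> {1..N}"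
    and "n < a + b" "I \<in> multi_indices n N"
  shows "rows (P_tilde_op g n) [s..<s + a] {t..<t + b} (\<lambda>p. of_nat (Suc p - s)) w I = 0"
  by (rule det_vanishing[where W = "\<lambda>p. rows (P_tilde_op g n) [s..<s + p] {t..<t + b} (\<lambda>p. of_nat (Suc p - s)) w"
        and B = "{t..<t + b}" and s = s and a = a and N = N and w = w])
     (use assms in \<open>auto simp: rows_def Suc_diff_le\<close>)

text \<open>The Pfaffian builds the triangle by columns, whereas regularity is read off from its
  rows. Both are normal forms of the same \<open>triangle_prod\<close>.\<close>

lemma triangle_vanishing:
  assumes n: "even n" and w: "alternating {s..<s + k} w" "w \<in> tensor_space n N"
    and N: "{s..<s + k} \<subseteq> {1..N}" and "n < 2 * k" "I \<in> multi_indices n N"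
  shows "fold (\<lambda>p v I. v I - (\<Sum>q\<in>{Suc p..<s + k}. P_tilde_op SP n p q v I) / (2 * of_nat (Suc p - s))) [s..<s + k] w I = 0"
proof -
  \<comment> \<open>With this choice the column of s + q has denominator q + 1 and the row of p has
    denominator 2(p + 1 - s). The arguments of all factors are positive integers, so fusion is
    legitimate at this special point.\<close>
  let ?e = "1 - 2 * of_nat s :: complex"
  let ?W = "\<lambda>q. triangle_prod SP n ?e s q w"
  interpret pair_operator "P_tilde_op SP n" n by (rule pair_operator_P_tilde) (use n in simp)
  have g: "SP = SP \<longrightarrow> even n" using n by simp
  have d: "?e + of_nat p + of_nat q = of_nat (Suc (p + q) - 2 * s)" if "s \<le> p" "s \<le> q" for p q
    using that by (simp add: of_nat_diff)
  have nz: "?e + of_nat p + of_nat q \<noteq> 0" if "s \<le> p" "p < q" for p q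
    using that by (subst d) (auto simp del: of_nat_diff)
  have "?W k I = 0"
  proof (rule pfaffian_vanishing[OF w(1) N n _ _ assms(5,6)])
    show "?W 0 = w" by (simp add: triangle_prod_def[OF g])
    fix q assume q: "q < k"
    then have sub: "{s..<s + q} \<subseteq> {s..<s + k}" "{s..<s + Suc q} \<subseteq> {1..N}" using N by auto
    have v: "alternating {s..<s + q} (?W q)"
      using sub(2) by (intro triangle_prod_alternating[OF g] alternating_subset[OF w(1) sub(1)] nz) (use w(2) in auto)
    have "(\<Sum>p\<in>{s..<s + q}. P_tilde_op SP n (s + q) p (?W q) I) = (\<Sum>j<q. P_tilde_op SP n (s + j) (s + q) (?W q) I)" for I
      by (rule sum.reindex_bij_witness[of _ "\<lambda>j. s + j" "\<lambda>p. p - s"]) (auto simp: sym)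
    moreover have "?e + of_nat (s + q) + of_nat s = of_nat (Suc q)" by simp
    ultimately show "?W (Suc q) = (\<lambda>I. ?W q I - (\<Sum>j<q. P_tilde_op SP n (s + j) (s + q) (?W q) I) / of_nat (Suc q))"
      using triangle_prod_column[OF g v w(2) sub(2) nz] by (simp del: of_nat_Suc of_nat_add)
  qed
  moreover have "?W k = fold (\<lambda>p v I. v I - (\<Sum>q\<in>{Suc p..<s + k}. P_tilde_op SP n p q v I) / (?e + of_nat p + of_nat (Suc p))) [s..<s + k] w"
    by (rule triangle_prod_rows[OF g w N]) (use nz in auto)
  moreover have "\<dots> = fold (\<lambda>p v I. v I - (\<Sum>q\<in>{Suc p..<s + k}. P_tilde_op SP n p q v I) / (2 * of_nat (Suc p - s))) [s..<s + k] w"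
    by (rule fold_cong) (auto simp: of_nat_diff algebra_simps)
  ultimately show ?thesis by simp
qed

section \<open>Regular families of tensors\<close>

definition regular_family :: "nat \<Rightarrow> nat \<Rightarrow> nat \<Rightarrow> (nat \<Rightarrow> complex) \<Rightarrow> ((nat \<Rightarrow> complex) \<Rightarrow> tensor) \<Rightarrow> bool" where
  "regular_family m n N z0 F \<longleftrightarrow> (\<forall>I\<in>multi_indices n N. regular_at m (\<lambda>z. F z I) z0)"

lemma regular_family_cong:
  assumes "generically m (\<lambda>z. \<forall>I\<in>multi_indices n N. F z I = G z I)" "regular_family m n N z0 G"
  shows "regular_family m n N z0 F"
  unfolding regular_family_def
proof
  fix I assume I: "I \<in> multi_indices n N"
  have "generically m (\<lambda>z. F z I = G z I)"
    using assms(1) by (rule generically_mono) (use I in blast)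
  then show "regular_at m (\<lambda>z. F z I) z0"
    by (rule regular_at_cong) (use assms(2) I in \<open>simp add: regular_family_def\<close>)
qed

section \<open>Operators that do not depend on the parameters and preserve regularity\<close>

definition regular_op :: "nat \<Rightarrow> nat \<Rightarrow> nat \<Rightarrow> (nat \<Rightarrow> complex) \<Rightarrow> (tensor \<Rightarrow> tensor) \<Rightarrow> bool" where
  "regular_op m n N z0 A \<longleftrightarrow> (\<forall>F. regular_family m n N z0 F \<longrightarrow> regular_family m n N z0 (\<lambda>z. A (F z)))"

lemma regular_opD: "regular_op m n N z0 A \<Longrightarrow> regular_family m n N z0 F \<Longrightarrow> regular_family m n N z0 (\<lambda>z. A (F z))"
  by (simp add: regular_op_def)

lemma (in pair_operator) regular_op:
  assumes "p \<noteq> q" "p \<in> {1..N}" "q \<in> {1..N}"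
  shows "regular_op m n N z0 (Q p q)"
  unfolding regular_op_def regular_family_def
proof (intro allI impI ballI)
  fix F I assume F: "\<forall>I\<in>multi_indices n N. regular_at m (\<lambda>z. F z I) z0" and I: "I \<in> multi_indices n N"
  obtain c K where K: "K ` {1..n} \<subseteq> multi_indices n N" "\<And>v. Q p q v I = (\<Sum>x\<in>{1..n}. c x * v (K x))"
    using local[OF assms I] by blast
  show "regular_at m (\<lambda>z. Q p q (F z) I) z0"
    unfolding K(2) using F K(1) by (intro regular_at_sum regular_at_mult regular_at_const) blast
qed

lemma regular_op_sum:
  assumes "\<And>x. x \<in> X \<Longrightarrow> regular_op m n N z0 (A x)"
  shows "regular_op m n N z0 (\<lambda>v I. \<Sum>x\<in>X. A x v I)"
  unfolding regular_op_def regular_family_def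
proof (intro allI impI ballI)
  fix F I assume F: "\<forall>I\<in>multi_indices n N. regular_at m (\<lambda>z. F z I) z0" and I: "I \<in> multi_indices n N"
  show "regular_at m (\<lambda>z. \<Sum>x\<in>X. A x (F z) I) z0"
  proof (rule regular_at_sum)
    fix x assume "x \<in> X"
    then show "regular_at m (\<lambda>z. A x (F z) I) z0"
      using assms[unfolded regular_op_def regular_family_def] F I by blast
  qed
qed

lemma regular_op_divide: "regular_op m n N z0 A \<Longrightarrow> regular_op m n N z0 (\<lambda>v I. A v I / c)"
  unfolding regular_op_def regular_family_def
  using regular_at_mult[OF regular_at_const[of m "1 / c"]] by fastforce

lemma (in pair_operator) regular_op_pair_sum:
  assumes "p \<notin> T" "p \<in> {1..N}" "T \<subseteq> {1..N}"
  shows "regular_op m n N z0 (\<lambda>v I. \<Sum>q\<in>T. Q p q v I)"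
  using assms by (intro regular_op_sum regular_op) auto

lemma (in pair_operator) linear_pair_sum:
  "p \<notin> T \<Longrightarrow> linear_op (\<lambda>v I. \<Sum>q\<in>T. Q p q v I)"
  by (intro linear_op_sum_op linear) auto

lemma regular_family_fold:
  assumes "\<And>p. p \<in> set ps \<Longrightarrow> regular_op m n N z0 (S p)" "regular_family m n N z0 F"
    and "\<And>p. p \<in> set ps \<Longrightarrow> d p \<in> polyfun m" "\<And>p. p \<in> set ps \<Longrightarrow> d p z0 \<noteq> 0"
  shows "regular_family m n N z0 (\<lambda>z. fold (\<lambda>p v I. v I - S p v I / d p z) ps (F z))"
  using assms
proof (induction ps arbitrary: F)
  case (Cons p ps)
  have SF: "regular_family m n N z0 (\<lambda>z. S p (F z))"
    by (rule regular_opD[OF _ Cons.prems(2)]) (simp add: Cons.prems(1))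
  have "d p \<in> polyfun m" "d p z0 \<noteq> 0" using Cons.prems(3,4)[of p] by simp_all
  then have "regular_family m n N z0 (\<lambda>z I. F z I - S p (F z) I / d p z)"
    using Cons.prems(2) SF unfolding regular_family_def
    by (intro ballI regular_at_diff regular_at_divide) blast+
  then have "regular_family m n N z0 (\<lambda>z. fold (\<lambda>p v I. v I - S p v I / d p z) ps (\<lambda>I. F z I - S p (F z) I / d p z))"
    by (intro Cons.IH) (simp_all add: Cons.prems)
  then show ?case by simp
qed simp

text \<open>A product of factors e_p - h - S_p is its value at h = 0 plus h times a remainder.
  Constructing the remainder explicitly replaces a divisibility argument for rational
  functions.\<close>

lemma fold_expansion:
  assumes S: "\<And>p. p \<in> set ps \<Longrightarrow> linear_op (S p)" "\<And>p. p \<in> set ps \<Longrightarrow> regular_op m n N z0 (S p)"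
    and F: "regular_family m n N z0 F" and h: "h \<in> polyfun m"
  shows "regular_family m n N z0 (\<lambda>z. fold (\<lambda>p v I. e p * v I - S p v I) ps (F z)) \<and>
    (\<exists>D. regular_family m n N z0 D \<and> (\<forall>z I. fold (\<lambda>p v I. (e p - h z) * v I - S p v I) ps (F z) I =
      fold (\<lambda>p v I. e p * v I - S p v I) ps (F z) I + h z * D z I))"
  using S
proof (induction ps rule: rev_induct)
  case Nil
  have "regular_family m n N z0 (\<lambda>z I. 0)"
    by (auto simp: regular_family_def intro: regular_at_const)
  then show ?case using F by force
next
  case (snoc p ps)
  let ?G = "\<lambda>z. fold (\<lambda>p v I. e p * v I - S p v I) ps (F z)"
  let ?H = "\<lambda>z. fold (\<lambda>p v I. (e p - h z) * v I - S p v I) ps (F z)"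
  have lin: "linear_op (S p)" and reg: "regular_op m n N z0 (S p)"
    using snoc.prems by simp_all
  have "regular_family m n N z0 ?G \<and> (\<exists>D. regular_family m n N z0 D \<and> (\<forall>z I. ?H z I = ?G z I + h z * D z I))"
    by (rule snoc.IH) (simp_all add: snoc.prems)
  then obtain D where G: "regular_family m n N z0 ?G" and D: "regular_family m n N z0 D"
    and H: "\<And>z. ?H z = (\<lambda>I. ?G z I + h z * D z I)" by fast
  have SG: "regular_family m n N z0 (\<lambda>z. S p (?G z))" and SD: "regular_family m n N z0 (\<lambda>z. S p (D z))"
    using regular_opD[OF reg] G D by blast+
  have G': "regular_family m n N z0 (\<lambda>z I. e p * ?G z I - S p (?G z) I)"
    using G SG unfolding regular_family_def
    by (intro ballI regular_at_diff regular_at_mult regular_at_const) auto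
  \<comment> \<open>From ((e - h) - S)(G + hD) = (e - S)G + h((e - h)D - SD - G).\<close>
  let ?D = "\<lambda>z I. (e p - h z) * D z I - S p (D z) I - ?G z I"
  have "regular_family m n N z0 ?D"
    using G D SD unfolding regular_family_def
    by (intro ballI regular_at_diff regular_at_mult regular_at_const regular_at_polyfun[OF h]) blast+
  moreover have "(e p - h z) * ?H z I - S p (?H z) I = e p * ?G z I - S p (?G z) I + h z * ?D z I" for z I
  proof -
    have "S p (\<lambda>I. ?G z I + h z * D z I) = (\<lambda>I. S p (?G z) I + h z * S p (D z) I)"
      using linear_opD[OF lin, of 1 "?G z" "h z" "D z"] by simp
    then show ?thesis unfolding H by (simp add: algebra_simps)
  qed
  ultimately show ?case using G' by (auto intro!: exI[of _ ?D])
qed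

lemma fold_scale:
  assumes "\<And>p. p \<in> set ps \<Longrightarrow> linear_op (S p)" "\<And>p. p \<in> set ps \<Longrightarrow> e p \<noteq> 0"
  shows "fold (\<lambda>p v I. e p * v I - S p v I) ps w =
    (\<lambda>I. (\<Prod>p\<leftarrow>ps. e p) * fold (\<lambda>p v I. v I - S p v I / e p) ps w I)"
  using assms
proof (induction ps rule: rev_induct)
  case (snoc p ps)
  have "fold (\<lambda>p v I. e p * v I - S p v I) ps w =
      (\<lambda>I. (\<Prod>p\<leftarrow>ps. e p) * fold (\<lambda>p v I. v I - S p v I / e p) ps w I)"
    by (rule snoc.IH) (simp_all add: snoc.prems)
  moreover have "linear_op (S p)" "e p \<noteq> 0" using snoc.prems by simp_all
  ultimately show ?case
    by (simp add: linear_op_scale[OF \<open>linear_op (S p)\<close>] algebra_simps)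
qed simp

lemma polyfun_prod_list: "(\<And>p. p \<in> set ps \<Longrightarrow> d p \<in> polyfun m) \<Longrightarrow> (\<lambda>z. \<Prod>p\<leftarrow>ps. d p z) \<in> polyfun m"
  by (induction ps) (auto intro: polyfun_intros)

lemma generically_list_nonzero:
  assumes "\<And>p. p \<in> set ps \<Longrightarrow> d p \<in> polyfun m" "\<And>p. p \<in> set ps \<Longrightarrow> d p z0 \<noteq> 0"
  shows "generically m (\<lambda>z. \<forall>p\<in>set ps. d p z \<noteq> 0)"
  using assms by (intro generically_ball generically_nonzero[where z = z0]) auto

text \<open>After clearing denominators the value at h = 0 drops out by \<open>vanish\<close>. What
  is left is the remainder over the product of the e_p - h, which is nonzero at \<open>z0\<close>.
  In \<open>vanish\<close> the denominators are frozen at e_p while \<open>F z\<close> still varies,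
  so it can hold at generic \<open>z\<close> and not only where \<open>h\<close> is zero.\<close>

lemma regular_family_divide:
  assumes S: "\<And>p. p \<in> set ps \<Longrightarrow> linear_op (S p)" "\<And>p. p \<in> set ps \<Longrightarrow> regular_op m n N z0 (S p)"
    and F: "regular_family m n N z0 F" and h: "h \<in> polyfun m" "h z1 \<noteq> 0"
    and e: "\<And>p. p \<in> set ps \<Longrightarrow> e p \<noteq> 0" "\<And>p. p \<in> set ps \<Longrightarrow> e p - h z0 \<noteq> 0"
    and vanish: "generically m (\<lambda>z. \<forall>I\<in>multi_indices n N. fold (\<lambda>p v I. v I - S p v I / e p) ps (F z) I = 0)"
  shows "regular_family m n N z0 (\<lambda>z I. fold (\<lambda>p v I. v I - S p v I / (e p - h z)) ps (F z) I / h z)"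
proof -
  obtain D where D: "regular_family m n N z0 D" "\<And>z I. fold (\<lambda>p v I. (e p - h z) * v I - S p v I) ps (F z) I =
      fold (\<lambda>p v I. e p * v I - S p v I) ps (F z) I + h z * D z I"
    using fold_expansion[where S = S and ps = ps and e = e, OF S F h(1)] by blast
  let ?c = "\<lambda>z. \<Prod>p\<leftarrow>ps. e p - h z"
  have c: "?c \<in> polyfun m" using h(1) by (intro polyfun_prod_list polyfun_intros)
  have c0: "?c z0 \<noteq> 0" using e(2) by (auto simp: prod_list_zero_iff)
  have nz: "generically m (\<lambda>z. \<forall>p\<in>set ps. e p - h z \<noteq> 0)"
    using h(1) e(2) by (intro generically_list_nonzero[where ?z0.0 = z0]) (auto intro: polyfun_intros)
  show ?thesis
  proof (rule regular_family_cong)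
    show "regular_family m n N z0 (\<lambda>z I. D z I / ?c z)"
      using D(1) c c0 unfolding regular_family_def by (auto intro: regular_at_divide)
    have "generically m (\<lambda>z. (h z \<noteq> 0 \<and> (\<forall>p\<in>set ps. e p - h z \<noteq> 0)) \<and>
        (\<forall>I\<in>multi_indices n N. fold (\<lambda>p v I. v I - S p v I / e p) ps (F z) I = 0))"
      by (intro generically_conj nz vanish generically_nonzero[OF h])
    then show "generically m (\<lambda>z. \<forall>I\<in>multi_indices n N.
        fold (\<lambda>p v I. v I - S p v I / (e p - h z)) ps (F z) I / h z = D z I / ?c z)"
    proof (rule generically_mono, intro ballI)
      fix z I assume z: "(h z \<noteq> 0 \<and> (\<forall>p\<in>set ps. e p - h z \<noteq> 0)) \<and>
        (\<forall>I\<in>multi_indices n N. fold (\<lambda>p v I. v I - S p v I / e p) ps (F z) I = 0)" and I: "I \<in> multi_indices n N"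
      have "?c z * fold (\<lambda>p v I. v I - S p v I / (e p - h z)) ps (F z) I =
          fold (\<lambda>p v I. (e p - h z) * v I - S p v I) ps (F z) I"
        using S(1) z by (subst fold_scale) auto
      also have "\<dots> = h z * D z I"
        unfolding D(2) using S(1) e(1) z I by (subst fold_scale) auto
      finally have "?c z * fold (\<lambda>p v I. v I - S p v I / (e p - h z)) ps (F z) I = h z * D z I" .
      moreover have "?c z \<noteq> 0" using z by (auto simp: prod_list_zero_iff)
      ultimately show "fold (\<lambda>p v I. v I - S p v I / (e p - h z)) ps (F z) I / h z = D z I / ?c z"
        using z by (simp add: field_simps)
    qed
  qed
qed

lemma regular_family_scale:
  assumes "regular_family m n N z0 F" "regular_at m c z0"
  shows "regular_family m n N z0 (\<lambda>z I. c z * F z I)"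
  using assms by (auto simp: regular_family_def intro: regular_at_mult)

text \<open>The one dangerous denominator belongs to the row that acts first. By linearity its
  factor passes through the later rows and cancels it on the spot.\<close>

lemma regular_family_first_pole:
  assumes S: "\<And>p. p \<in> set (p0 # ps) \<Longrightarrow> linear_op (S p)" "\<And>p. p \<in> set (p0 # ps) \<Longrightarrow> regular_op m n N z0 (S p)"
    and F: "regular_family m n N z0 F"
    and d: "\<And>p. p \<in> set (p0 # ps) \<Longrightarrow> d p \<in> polyfun m" "\<And>p. p \<in> set ps \<Longrightarrow> d p z0 \<noteq> 0" "d p0 z1 \<noteq> 0"
  shows "regular_family m n N z0 (\<lambda>z I. d p0 z * fold (\<lambda>p v I. v I - S p v I / d p z) (p0 # ps) (F z) I)"
proof (rule regular_family_cong)
  let ?G = "\<lambda>z I. d p0 z * F z I - S p0 (F z) I"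
  have "regular_family m n N z0 (\<lambda>z. S p0 (F z))"
    by (rule regular_opD[OF _ F]) (simp add: S)
  moreover have "regular_at m (d p0) z0" by (intro regular_at_polyfun d(1)) simp
  ultimately have "regular_family m n N z0 ?G"
    using F unfolding regular_family_def
    by (intro ballI regular_at_diff regular_at_mult) blast+
  then show "regular_family m n N z0 (\<lambda>z. fold (\<lambda>p v I. v I - S p v I / d p z) ps (?G z))"
    using S d by (intro regular_family_fold) auto
  have "generically m (\<lambda>z. d p0 z \<noteq> 0)" using d by (intro generically_nonzero) auto
  then show "generically m (\<lambda>z. \<forall>I\<in>multi_indices n N.
      d p0 z * fold (\<lambda>p v I. v I - S p v I / d p z) (p0 # ps) (F z) I =
      fold (\<lambda>p v I. v I - S p v I / d p z) ps (?G z) I)"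
  proof (rule generically_mono, intro ballI)
    fix z I assume z: "d p0 z \<noteq> 0"
    let ?f = "fold (\<lambda>p v I. v I - S p v I / d p z) ps"
    have lin: "linear_op ?f"
      using S(1) by (intro linear_op_fold linear_op_minus_divide) auto
    have "?G z = (\<lambda>I. d p0 z * (F z I - S p0 (F z) I / d p0 z))"
      using z by (auto simp: fun_eq_iff field_simps)
    then have "?f (?G z) = (\<lambda>I. d p0 z * ?f (\<lambda>I. F z I - S p0 (F z) I / d p0 z) I)"
      using linear_op_scale[OF lin] by simp
    then show "d p0 z * fold (\<lambda>p v I. v I - S p v I / d p z) (p0 # ps) (F z) I = ?f (?G z) I"
      by simp
  qed
qed

section \<open>Regularity of the normalised blocks\<close>

text \<open>For a polynomial function this makes every level set a proper hypersurface.\<close>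

definition nonconstant :: "((nat \<Rightarrow> complex) \<Rightarrow> complex) \<Rightarrow> bool" where
  "nonconstant f \<longleftrightarrow> (\<forall>c. \<exists>z. f z \<noteq> c)"

lemma generically_neq:
  assumes "f \<in> polyfun m" "nonconstant f"
  shows "generically m (\<lambda>z. f z \<noteq> c)"
proof -
  obtain z where "f z \<noteq> c" using assms(2) unfolding nonconstant_def by blast
  then have "generically m (\<lambda>z. f z - c \<noteq> 0)"
    by (intro generically_nonzero[of "\<lambda>z. f z - c" m z] polyfun_intros assms(1)) auto
  then show ?thesis by (rule generically_mono) simp
qed

text \<open>If \<open>\<kappa> \<noteq> 0\<close>, the division by \<open>h\<close> is possible because the product of the rows vanishes where
  \<open>h\<close> does.\<close>

lemma regular_family_normalised:
  assumes S: "\<And>p. p \<in> set ps \<Longrightarrow> linear_op (S p)" "\<And>p. p \<in> set ps \<Longrightarrow> regular_op m n N z0 (S p)"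
    and F: "regular_family m n N z0 F" and h: "h \<in> polyfun m" "nonconstant h"
    and e: "\<And>p. p \<in> set ps \<Longrightarrow> e p \<noteq> 0" "\<And>p. p \<in> set ps \<Longrightarrow> e p - h z0 \<noteq> 0"
    and G: "generically m (\<lambda>z. G z = fold (\<lambda>p v I. v I - S p v I / (e p - h z)) ps (F z))"
    and c: "\<And>z. c z = (if C then h z / (h z + \<kappa>) else 1)"
    and vanish: "C \<Longrightarrow> \<kappa> \<noteq> 0 \<Longrightarrow>
      generically m (\<lambda>z. \<forall>I\<in>multi_indices n N. fold (\<lambda>p v I. v I - S p v I / e p) ps (F z) I = 0)"
  shows "regular_family m n N z0 (\<lambda>z I. G z I / c z)"
proof -
  let ?R = "\<lambda>z. fold (\<lambda>p v I. v I - S p v I / (e p - h z)) ps (F z)"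
  have gen: "generically m (\<lambda>z. G z = ?R z \<and> h z \<noteq> 0)"
    by (intro generically_conj G generically_neq[OF h])
  show ?thesis
  proof (cases "C \<and> \<kappa> \<noteq> 0")
    case True
    obtain z1 where z1: "h z1 \<noteq> 0" using h(2) unfolding nonconstant_def by blast
    have "regular_family m n N z0 (\<lambda>z I. (h z + \<kappa>) * (?R z I / h z))"
      using True
      by (intro regular_family_scale regular_family_divide[OF S F h(1) z1 e vanish] regular_at_polyfun polyfun_intros h(1)) auto
    then show ?thesis
      by (rule regular_family_cong[OF generically_mono[OF gen], rotated]) (use True in \<open>simp add: c\<close>)
  next
    \<comment> \<open>Either there is no normalising factor or it is h / h, which equals 1 off the
      hypersurface h = 0.\<close>
    case False
    have "regular_family m n N z0 ?R"
      by (rule regular_family_fold[OF S(2) F]) (assumption | rule e(2) | intro polyfun_intros h(1))+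
    then show ?thesis
      by (rule regular_family_cong[OF generically_mono[OF gen], rotated]) (use False in \<open>auto simp: c\<close>)
  qed
qed

lemma C_block_regular:
  assumes g: "g = SP \<longrightarrow> even n"
    and F: "regular_family m n N z0 F"
      "generically m (\<lambda>z. alternating {s..<s + a} (F z) \<and> alternating {t..<t + b} (F z) \<and> F z \<in> tensor_space n N)"
    and N: "{s..<s + a} \<inter> {t..<t + b} = {}" "{s..<s + a} \<subseteq> {1..N}" "{t..<t + b} \<subseteq> {1..N}"
    and h: "h \<in> polyfun m" "nonconstant h" "\<And>k. k \<ge> 1 \<Longrightarrow> h z0 \<noteq> of_nat k"
    and x: "\<And>z p q. p \<in> {s..<s + a} \<Longrightarrow> q \<in> {t..<t + b} \<Longrightarrow>
      x z p q = 1 - of_nat s - of_nat t - h z + of_nat p + of_nat q"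
    and c: "\<And>z. c z = (if a + b \<ge> n then h z / (h z + (of_nat n - of_nat a - of_nat b)) else 1)"
  shows "regular_family m n N z0 (\<lambda>z I.
    R_product (P_tilde_op g n) (x z) (List.product [s..<s + a] [t..<t + b]) (F z) I / c z)"
proof -
  interpret pair_operator "P_tilde_op g n" n by (rule pair_operator_P_tilde[OF g])
  let ?S = "\<lambda>p v I. \<Sum>q\<in>{t..<t + b}. P_tilde_op g n p q v I"
  \<comment> \<open>The position of p in its segment, hence one of 1, ..., a: the row is singular
    only at positive integers, which \<open>h z0\<close> avoids.\<close>
  let ?e = "\<lambda>p. of_nat (Suc p - s) :: complex"
  show ?thesis
  proof (rule regular_family_normalised[where S = ?S and e = ?e and ps = "[s..<s + a]", OF _ _ F(1) h(1,2) _ _ _ c])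
    fix p assume p: "p \<in> set [s..<s + a]"
    then show "linear_op (?S p)" "regular_op m n N z0 (?S p)"
      using N by (auto intro!: linear_pair_sum regular_op_pair_sum)
    have "1 \<le> Suc p - s" using p by auto
    then obtain k where k: "Suc p - s = k" "k \<ge> 1" by blast
    then show "?e p \<noteq> 0" "?e p - h z0 \<noteq> 0" unfolding k(1) using h(3)[of k] by auto
  next
    have "generically m (\<lambda>z. \<forall>p\<in>{s..<s + a}. \<forall>q\<in>{t..<t + b}. h z \<noteq> 1 - of_nat s - of_nat t + of_nat p + of_nat q)"
      by (intro generically_ball generically_neq[OF h(1,2)]; simp)
    from generically_conj[OF F(2) this]
    show "generically m (\<lambda>z. R_product (P_tilde_op g n) (x z) (List.product [s..<s + a] [t..<t + b]) (F z) =
        fold (\<lambda>p v I. v I - ?S p v I / (?e p - h z)) [s..<s + a] (F z))"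
    proof (rule generically_mono, elim conjE)
      fix z
      let ?y = "1 - of_nat s - of_nat t - h z"
      assume w: "alternating {s..<s + a} (F z)" "alternating {t..<t + b} (F z)" "F z \<in> tensor_space n N"
        and z: "\<forall>p\<in>{s..<s + a}. \<forall>q\<in>{t..<t + b}. h z \<noteq> 1 - of_nat s - of_nat t + of_nat p + of_nat q"
      have nz: "?y + of_nat p + of_nat q \<noteq> 0" if "p \<in> {s..<s + a}" "q \<in> {t..<t + b}" for p q
        using bspec[OF bspec[OF z that(1)] that(2)] by (auto simp: algebra_simps)
      have "R_product (P_tilde_op g n) (x z) (List.product [s..<s + a] [t..<t + b]) (F z) =
        R_product (P_tilde_op g n) (\<lambda>p q. ?y + of_nat p + of_nat q) (List.product [s..<s + a] [t..<t + b]) (F z)"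
        by (rule fold_cong) (auto simp: x)
      also have "\<dots> = rows (P_tilde_op g n) [s..<s + a] {t..<t + b} (\<lambda>p. ?y + of_nat p + of_nat t) (F z)"
        by (rule C_block(1)[OF g w N nz])
      also have "\<dots> = fold (\<lambda>p v I. v I - ?S p v I / (?e p - h z)) [s..<s + a] (F z)"
        unfolding rows_def by (rule fold_cong) (auto simp: of_nat_diff algebra_simps)
      finally show "R_product (P_tilde_op g n) (x z) (List.product [s..<s + a] [t..<t + b]) (F z) =
        fold (\<lambda>p v I. v I - ?S p v I / (?e p - h z)) [s..<s + a] (F z)" .
    qed
  next
    \<comment> \<open>For a + b = n the normalising factor is h / h; the pigeonhole argument needs
      the strict inequality.\<close>
    assume "n \<le> a + b" "of_nat n - of_nat a - of_nat b \<noteq> (0 :: complex)"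
    then have n: "n < a + b" by (cases "n = a + b") auto
    show "generically m (\<lambda>z. \<forall>I\<in>multi_indices n N. fold (\<lambda>p v I. v I - ?S p v I / ?e p) [s..<s + a] (F z) I = 0)"
      using F(2) by (rule generically_mono) (use C_block_vanishing[OF g _ _ N n] in \<open>simp add: rows_def\<close>)
  qed
qed

lemma triangle_regular:
  assumes n: "even n"
    and F: "regular_family m n N z0 F" "generically m (\<lambda>z. alternating {s..<s + k} (F z) \<and> F z \<in> tensor_space n N)"
    and N: "{s..<s + k} \<subseteq> {1..N}"
    and h: "h \<in> polyfun m" "nonconstant h" "\<And>k. k \<ge> 1 \<Longrightarrow> h z0 \<noteq> of_nat k"
    and x: "\<And>z p q. p \<in> {s..<s + k} \<Longrightarrow> q \<in> {s..<s + k} \<Longrightarrow>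
      x z p q = 1 - 2 * of_nat s - 2 * h z + of_nat p + of_nat q"
    and c: "\<And>z. c z = (if 2 * k \<ge> n then h z / (h z + (of_nat n / 2 - of_nat k)) else 1)"
  shows "regular_family m n N z0 (\<lambda>z I.
    R_product (P_tilde_op SP n) (x z) (triangle s k) (F z) I / c z)"
proof -
  have g: "SP = SP \<longrightarrow> even n" using n by simp
  interpret pair_operator "P_tilde_op SP n" n by (rule pair_operator_P_tilde[OF g])
  \<comment> \<open>In a triangle the row denominators are 2(e_p - h). The 2 goes into
    \<open>?S\<close>, so that the poles sit at h = e_p as for two segments.\<close>
  let ?S = "\<lambda>p v I. (\<Sum>q\<in>{Suc p..<s + k}. P_tilde_op SP n p q v I) / 2"
  let ?e = "\<lambda>p. of_nat (Suc p - s) :: complex"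
  show ?thesis
  proof (rule regular_family_normalised[where S = ?S and e = ?e and ps = "[s..<s + k]", OF _ _ F(1) h(1,2) _ _ _ c])
    fix p assume p: "p \<in> set [s..<s + k]"
    then have "p \<in> {1..N}" "{Suc p..<s + k} \<subseteq> {1..N}" "p \<notin> {Suc p..<s + k}"
      using N by (auto simp: subset_iff)
    then show "linear_op (?S p)" "regular_op m n N z0 (?S p)"
      by (auto intro!: linear_op_divide linear_pair_sum regular_op_divide regular_op_pair_sum simp del: atLeastLessThan_iff)
    have "1 \<le> Suc p - s" using p by auto
    then obtain k where k: "Suc p - s = k" "k \<ge> 1" by blast
    then show "?e p \<noteq> 0" "?e p - h z0 \<noteq> 0" unfolding k(1) using h(3)[of k] by auto
  next
    have "generically m (\<lambda>z. \<forall>p\<in>{s..<s + k}. \<forall>q\<in>{s..<s + k}. h z \<noteq> (1 - 2 * of_nat s + of_nat p + of_nat q) / 2)"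
      by (rule generically_ball, simp, rule generically_ball, simp, rule generically_neq[OF h(1,2)])
    from generically_conj[OF F(2) this]
    show "generically m (\<lambda>z. R_product (P_tilde_op SP n) (x z) (triangle s k) (F z) =
        fold (\<lambda>p v I. v I - ?S p v I / (?e p - h z)) [s..<s + k] (F z))"
    proof (rule generically_mono, elim conjE)
      fix z
      let ?y = "1 - 2 * of_nat s - 2 * h z"
      assume w: "alternating {s..<s + k} (F z)" "F z \<in> tensor_space n N"
        and z: "\<forall>p\<in>{s..<s + k}. \<forall>q\<in>{s..<s + k}. h z \<noteq> (1 - 2 * of_nat s + of_nat p + of_nat q) / 2"
      have "R_product (P_tilde_op SP n) (x z) (triangle s k) (F z) = triangle_prod SP n ?y s k (F z)"
        unfolding triangle_prod_def[OF g] by (rule fold_cong) (auto simp: x set_triangle)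
      also have "\<dots> = fold (\<lambda>p v I. v I - (\<Sum>q\<in>{Suc p..<s + k}. P_tilde_op SP n p q v I) / (?y + of_nat p + of_nat (Suc p))) [s..<s + k] (F z)"
      proof (rule triangle_prod_rows[OF g w N])
        fix p q assume "s \<le> p" "p < q" "q < s + k"
        then have "h z \<noteq> (1 - 2 * of_nat s + of_nat p + of_nat q) / 2" using z by simp
        then show "?y + of_nat p + of_nat q \<noteq> 0" by (auto simp: field_simps)
      qed
      also have "\<dots> = fold (\<lambda>p v I. v I - ?S p v I / (?e p - h z)) [s..<s + k] (F z)"
        by (rule fold_cong) (auto simp: of_nat_diff algebra_simps)
      finally show "R_product (P_tilde_op SP n) (x z) (triangle s k) (F z) =
        fold (\<lambda>p v I. v I - ?S p v I / (?e p - h z)) [s..<s + k] (F z)" .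
    qed
  next
    assume "n \<le> 2 * k" "of_nat n / 2 - of_nat k \<noteq> (0 :: complex)"
    then have "n < 2 * k" by (cases "n = 2 * k") auto
    then show "generically m (\<lambda>z. \<forall>I\<in>multi_indices n N. fold (\<lambda>p v I. v I - ?S p v I / ?e p) [s..<s + k] (F z) I = 0)"
      using generically_mono[OF F(2)] triangle_vanishing[OF n _ _ N] by (simp add: mult.commute)
  qed
qed

text \<open>The row denominators vanish at d = i - b for i = 1, ..., a, those of the columns at d =
  0, -1, ..., 1 - b. For a > b some rows are singular at positive integers, which the hypothesis on
  \<open>d z0\<close> permits, so columns are used. For a < b the columns would leave a pole at d =
  0 that \<open>c\<close> does not cancel, so rows are used.\<close>

lemma B_block_regular:
  assumes F: "regular_family m n N z0 F"
      "generically m (\<lambda>z. alternating {s..<s + a} (F z) \<and> alternating {t..<t + b} (F z) \<and> F z \<in> tensor_space n N)"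
    and N: "{s..<s + a} \<inter> {t..<t + b} = {}" "{s..<s + a} \<subseteq> {1..N}" "{t..<t + b} \<subseteq> {1..N}"
    and ab: "a \<ge> 1" "b \<ge> 1"
    and d: "d \<in> polyfun m" "nonconstant d" "\<And>k. k \<ge> 1 \<Longrightarrow> d z0 \<noteq> - of_nat k"
    and x: "\<And>z p q. p \<in> {s..<s + a} \<Longrightarrow> q \<in> {t..<t + b} \<Longrightarrow>
      x z p q = of_nat t - of_nat s - d z + of_nat p - of_nat q"
    and c: "\<And>z. c z = (if a \<le> b then (d z + of_nat b) / (d z + of_nat b - of_nat a) else (d z + of_nat b) / d z)"
  shows "regular_family m n N z0 (\<lambda>z I.
    R_product (P_op n) (x z) (List.product (rev [s..<s + a]) [t..<t + b]) (F z) I / c z)"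
proof -
  interpret pair_operator "P_op n" n by (rule pair_operator_P)
  let ?B = "\<lambda>z. R_product (P_op n) (x z) (List.product (rev [s..<s + a]) [t..<t + b]) (F z)"
  let ?r = "\<lambda>p z. of_nat (Suc p) - of_nat s - of_nat b - d z"
  let ?k = "\<lambda>q z. of_nat t - of_nat q - d z"
  have dne: "generically m (\<lambda>z. d z \<noteq> k)" for k by (rule generically_neq[OF d(1,2)])
  have gen: "generically m (\<lambda>z. (alternating {s..<s + a} (F z) \<and> alternating {t..<t + b} (F z) \<and> F z \<in> tensor_space n N) \<and>
      (\<forall>p\<in>{s..<s + a}. \<forall>q\<in>{t..<t + b}. d z \<noteq> of_nat t - of_nat s + of_nat p - of_nat q) \<and> d z + of_nat b \<noteq> 0)"
  proof (rule generically_conj[OF F(2) generically_conj])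
    show "generically m (\<lambda>z. d z + of_nat b \<noteq> 0)"
      using dne[of "- of_nat b"] by (rule generically_mono) (simp add: eq_neg_iff_add_eq_0)
  qed (intro generically_ball dne; simp)
  have block: "generically m (\<lambda>z. ?B z = rows (P_op n) (rev [s..<s + a]) {t..<t + b} (\<lambda>p. ?r p z) (F z) \<and>
      ?B z = rows (P_op n) [t..<t + b] {s..<s + a} (\<lambda>q. ?k q z) (F z) \<and> d z + of_nat b \<noteq> 0)"
    using gen
  proof (rule generically_mono)
    fix z
    let ?y = "of_nat t - of_nat s - d z"
    assume z: "(alternating {s..<s + a} (F z) \<and> alternating {t..<t + b} (F z) \<and> F z \<in> tensor_space n N) \<and>
      (\<forall>p\<in>{s..<s + a}. \<forall>q\<in>{t..<t + b}. d z \<noteq> of_nat t - of_nat s + of_nat p - of_nat q) \<and> d z + of_nat b \<noteq> 0"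
    then have w: "alternating {s..<s + a} (F z)" "alternating {t..<t + b} (F z)" "F z \<in> tensor_space n N" by auto
    have nz: "?y + of_nat p - of_nat q \<noteq> 0" if "p \<in> {s..<s + a}" "q \<in> {t..<t + b}" for p q
    proof -
      have "d z \<noteq> of_nat t - of_nat s + of_nat p - of_nat q" using z that by blast
      then show ?thesis by (auto simp: algebra_simps)
    qed
    have "?B z = R_product (P_op n) (\<lambda>p q. ?y + of_nat p - of_nat q) (List.product (rev [s..<s + a]) [t..<t + b]) (F z)"
      by (rule fold_cong) (auto simp: x)
    moreover have "rows (P_op n) (rev [s..<s + a]) {t..<t + b} (\<lambda>p. ?y + of_nat p + 1 - of_nat (t + b)) (F z) =
        rows (P_op n) (rev [s..<s + a]) {t..<t + b} (\<lambda>p. ?r p z) (F z)"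
      unfolding rows_def by (rule fold_cong) (auto simp: algebra_simps)
    moreover have "rows (P_op n) [t..<t + b] {s..<s + a} (\<lambda>q. ?y - of_nat q + of_nat s) (F z) =
        rows (P_op n) [t..<t + b] {s..<s + a} (\<lambda>q. ?k q z) (F z)"
      unfolding rows_def by (rule fold_cong) (auto simp: algebra_simps)
    ultimately show "?B z = rows (P_op n) (rev [s..<s + a]) {t..<t + b} (\<lambda>p. ?r p z) (F z) \<and>
      ?B z = rows (P_op n) [t..<t + b] {s..<s + a} (\<lambda>q. ?k q z) (F z) \<and> d z + of_nat b \<noteq> 0"
      using B_block(1)[OF w N nz] B_block(2)[OF w N nz] z by simp
  qed
  \<comment> \<open>Dividing by \<open>c\<close> multiplies by the critical denominator and by this
    factor, the signs cancelling. The factor is regular because \<open>d z0\<close> is not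
    -b.\<close>
  have db: "regular_at m (\<lambda>z. - 1 / (d z + of_nat b)) z0"
    using d(3)[of b] ab
    by (intro regular_at_divide regular_at_const polyfun_intros d(1)) (auto simp: eq_neg_iff_add_eq_0)
  have neg_scale: "y / (u / w) = - 1 / u * (- w * y)" for u w y :: complex by simp
  have kt: "?k t z = - d z" for z by simp
  show ?thesis
  proof (cases "a \<le> b")
    case True
    \<comment> \<open>The top row acts first. Its denominator vanishes at d = a - b and is, up to
      sign, the denominator of \<open>c\<close>; those of the other rows vanish at negative
      integers.\<close>
    let ?p0 = "s + a - 1" and ?ps = "rev [s..<s + a - 1]"
    let ?S = "\<lambda>p v I. \<Sum>q\<in>{t..<t + b}. P_op n p q v I"
    have ps: "rev [s..<s + a] = ?p0 # ?ps"
      using ab by (cases a) auto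
    have S: "linear_op (?S p)" "regular_op m n N z0 (?S p)" if "p \<in> set (?p0 # ?ps)" for p
      using that N unfolding ps[symmetric] by (auto intro!: linear_pair_sum regular_op_pair_sum)
    obtain z1 where z1: "d z1 \<noteq> of_nat a - of_nat b" using d(2) unfolding nonconstant_def by blast
    have r0: "?r ?p0 z = - (d z + of_nat b - of_nat a)" for z
      using ab by (simp add: of_nat_diff)
    have "regular_family m n N z0 (\<lambda>z I. ?r ?p0 z * fold (\<lambda>p v I. v I - ?S p v I / ?r p z) (?p0 # ?ps) (F z) I)"
    proof (rule regular_family_first_pole[OF S F(1)])
      fix p assume p: "p \<in> set ?ps"
      then have "- of_nat (b - (Suc p - s)) = (of_nat (Suc p) - of_nat s - of_nat b :: complex)"
        using True by (auto simp: of_nat_diff)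
      moreover have "b - (Suc p - s) \<ge> 1" using p True by auto
      ultimately show "?r p z0 \<noteq> 0"
        using d(3)[of "b - (Suc p - s)"] by (metis right_minus_eq)
    next
      show "?r ?p0 z1 \<noteq> 0" unfolding r0 using z1 by (auto simp: algebra_simps)
    qed (assumption | intro polyfun_intros d(1))+
    then have "regular_family m n N z0 (\<lambda>z I. (- 1 / (d z + of_nat b)) *
        (?r ?p0 z * rows (P_op n) (rev [s..<s + a]) {t..<t + b} (\<lambda>p. ?r p z) (F z) I))"
      unfolding ps rows_def by (rule regular_family_scale[OF _ db])
    then show ?thesis
    proof (rule regular_family_cong[OF generically_mono[OF block], rotated], intro ballI)
      fix z I
      assume z: "?B z = rows (P_op n) (rev [s..<s + a]) {t..<t + b} (\<lambda>p. ?r p z) (F z) \<and>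
        ?B z = rows (P_op n) [t..<t + b] {s..<s + a} (\<lambda>q. ?k q z) (F z) \<and> d z + of_nat b \<noteq> 0"
      then have "?B z I = rows (P_op n) (rev [s..<s + a]) {t..<t + b} (\<lambda>p. ?r p z) (F z) I" by metis
      then show "?B z I / c z = (- 1 / (d z + of_nat b)) *
        (?r ?p0 z * rows (P_op n) (rev [s..<s + a]) {t..<t + b} (\<lambda>p. ?r p z) (F z) I)"
        unfolding r0 c if_P[OF True] by (simp only: neg_scale)
    qed
  next
    case False
    let ?S = "\<lambda>q v I. \<Sum>p\<in>{s..<s + a}. P_op n q p v I"
    \<comment> \<open>The column of t acts first and is the only one singular at d = 0.\<close>
    have qs: "[t..<t + b] = t # [Suc t..<t + b]"
      using ab by (simp add: upt_conv_Cons)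
    have S: "linear_op (?S q)" "regular_op m n N z0 (?S q)" if "q \<in> set (t # [Suc t..<t + b])" for q
      using that N unfolding qs[symmetric] by (auto intro!: linear_pair_sum regular_op_pair_sum)
    obtain z1 where z1: "d z1 \<noteq> 0" using d(2) unfolding nonconstant_def by blast
    have "regular_family m n N z0 (\<lambda>z I. ?k t z * fold (\<lambda>q v I. v I - ?S q v I / ?k q z) (t # [Suc t..<t + b]) (F z) I)"
    proof (rule regular_family_first_pole[OF S F(1)])
      fix q assume q: "q \<in> set [Suc t..<t + b]"
      then have "- of_nat (q - t) = (of_nat t - of_nat q :: complex)" by (auto simp: of_nat_diff)
      moreover have "q - t \<ge> 1" using q by auto
      ultimately show "?k q z0 \<noteq> 0"
        using d(3)[of "q - t"] by (metis right_minus_eq)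
    next
      show "?k t z1 \<noteq> 0" using z1 by auto
    qed (assumption | intro polyfun_intros d(1))+
    then have "regular_family m n N z0 (\<lambda>z I. (- 1 / (d z + of_nat b)) *
        (?k t z * rows (P_op n) [t..<t + b] {s..<s + a} (\<lambda>q. ?k q z) (F z) I))"
      unfolding qs rows_def by (rule regular_family_scale[OF _ db])
    then show ?thesis
    proof (rule regular_family_cong[OF generically_mono[OF block], rotated], intro ballI)
      fix z I
      assume z: "?B z = rows (P_op n) (rev [s..<s + a]) {t..<t + b} (\<lambda>p. ?r p z) (F z) \<and>
        ?B z = rows (P_op n) [t..<t + b] {s..<s + a} (\<lambda>q. ?k q z) (F z) \<and> d z + of_nat b \<noteq> 0"
      then have "?B z I = rows (P_op n) [t..<t + b] {s..<s + a} (\<lambda>q. ?k q z) (F z) I" by metis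
      then show "?B z I / c z = (- 1 / (d z + of_nat b)) *
        (?k t z * rows (P_op n) [t..<t + b] {s..<s + a} (\<lambda>q. ?k q z) (F z) I)"
        unfolding kt c if_not_P[OF False] by (simp only: neg_scale)
    qed
  qed
qed

section \<open>Segments\<close>

definition lo :: "(nat \<Rightarrow> nat) \<Rightarrow> nat \<Rightarrow> nat" where
  "lo \<nu> a = psum \<nu> (a - 1) + 1"

abbreviation segment :: "(nat \<Rightarrow> nat) \<Rightarrow> nat \<Rightarrow> nat set" where
  "segment \<nu> a \<equiv> {lo \<nu> a..<lo \<nu> a + \<nu> a}"

abbreviation segment_list :: "(nat \<Rightarrow> nat) \<Rightarrow> nat \<Rightarrow> nat list" where
  "segment_list \<nu> a \<equiv> [lo \<nu> a..<lo \<nu> a + \<nu> a]"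

lemma psum_eq: "a \<ge> 1 \<Longrightarrow> psum \<nu> a = psum \<nu> (a - 1) + \<nu> a"
  unfolding psum_def by (cases a) auto

lemma psum_mono: "a \<le> b \<Longrightarrow> psum \<nu> a \<le> psum \<nu> b"
  unfolding psum_def by (rule sum_mono2) auto

lemma lo_add: "a \<ge> 1 \<Longrightarrow> lo \<nu> a + \<nu> a = psum \<nu> a + 1"
  using psum_eq[of a \<nu>] by (simp add: lo_def)

lemma upt_segment: "a \<ge> 1 \<Longrightarrow> [psum \<nu> (a - 1) + 1..<psum \<nu> a + 1] = segment_list \<nu> a"
  unfolding lo_add by (simp only: lo_def)

lemma seg_eqI:
  assumes "a \<ge> 1" "p \<in> segment \<nu> a"
  shows "seg \<nu> p = a"
  unfolding seg_def
proof (rule Least_equality)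
  show "p \<le> psum \<nu> a" using assms lo_add[OF assms(1), of \<nu>] by simp
  fix b assume "p \<le> psum \<nu> b"
  show "a \<le> b"
  proof (rule ccontr)
    assume "\<not> a \<le> b"
    then have "psum \<nu> b \<le> psum \<nu> (a - 1)" by (intro psum_mono) simp
    then show False using \<open>p \<le> psum \<nu> b\<close> assms(2) by (simp add: lo_def)
  qed
qed

lemma seg_mono:
  assumes "p \<le> q" "q \<le> psum \<nu> m"
  shows "seg \<nu> p \<le> seg \<nu> q"
proof -
  have "q \<le> psum \<nu> (seg \<nu> q)" unfolding seg_def using assms(2) by (rule LeastI)
  then show ?thesis unfolding seg_def[of \<nu> p] using assms(1) by (intro Least_le) simp
qed

lemma seg_bounds:
  assumes "p \<in> {1..psum \<nu> m}"
  shows "seg \<nu> p \<in> {1..m}" "p \<in> segment \<nu> (seg \<nu> p)"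
proof -
  have p: "p \<le> psum \<nu> (seg \<nu> p)" unfolding seg_def by (rule LeastI[of _ m]) (use assms in simp)
  have "seg \<nu> p \<le> m" unfolding seg_def by (rule Least_le) (use assms in simp)
  moreover have "seg \<nu> p \<noteq> 0"
  proof
    assume "seg \<nu> p = 0"
    then show False using p assms by (simp add: psum_def)
  qed
  ultimately show a: "seg \<nu> p \<in> {1..m}" by auto
  have "\<not> p \<le> psum \<nu> (seg \<nu> p - 1)"
    using a by (intro not_less_Least[of _ "\<lambda>a. p \<le> psum \<nu> a", folded seg_def]) auto
  then show "p \<in> segment \<nu> (seg \<nu> p)"
    using p lo_add[of "seg \<nu> p" \<nu>] a by (auto simp: lo_def)
qed

lemma seg_iff:
  assumes "p \<in> {1..psum \<nu> m}" "a \<in> {1..m}"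
  shows "seg \<nu> p = a \<longleftrightarrow> p \<in> segment \<nu> a"
  using seg_bounds[OF assms(1)] seg_eqI[of a p \<nu>] assms(2) by auto

lemma segment_subset:
  assumes "a \<in> {1..m}"
  shows "segment \<nu> a \<subseteq> {1..psum \<nu> m}"
  using lo_add[of a \<nu>] psum_mono[of a m \<nu>] assms by (auto simp: lo_def)

lemma segments_disjoint:
  assumes "a \<in> {1..m}" "b \<in> {1..m}" "a \<noteq> b"
  shows "segment \<nu> a \<inter> segment \<nu> b = {}"
  using seg_eqI[of a _ \<nu>] seg_eqI[of b _ \<nu>] assms by fastforce

lemma segments_less:
  assumes "a \<ge> 1" "a < b"
  shows "lo \<nu> a + \<nu> a \<le> lo \<nu> b"
  using lo_add[of a \<nu>] psum_mono[of a "b - 1" \<nu>] assms by (simp add: lo_def)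

lemma Lambda_space_iff:
  "v \<in> Lambda_space n m \<nu> \<longleftrightarrow> v \<in> tensor_space n (psum \<nu> m) \<and>
    (\<forall>a\<in>{1..m}. alternating (segment \<nu> a) v)"
proof (intro iffI conjI ballI)
  assume v: "v \<in> Lambda_space n m \<nu>"
  then show "v \<in> tensor_space n (psum \<nu> m)" by (simp add: Lambda_space_def)
  fix a assume a: "a \<in> {1..m}"
  have "seg \<nu> p = seg \<nu> q \<and> p \<in> {1..psum \<nu> m} \<and> q \<in> {1..psum \<nu> m}"
    if "p \<in> segment \<nu> a" "q \<in> segment \<nu> a" for p q
    using that segment_subset[OF a, of \<nu>] seg_eqI[of a _ \<nu>] a by auto
  then show "alternating (segment \<nu> a) v"
    using v unfolding Lambda_space_def alternating_def by blast
next
  assume v: "v \<in> tensor_space n (psum \<nu> m) \<and> (\<forall>a\<in>{1..m}. alternating (segment \<nu> a) v)"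
  have "v (I \<circ> transpose p q) = - v I"
    if "p \<in> {1..psum \<nu> m}" "q \<in> {1..psum \<nu> m}" "p \<noteq> q \<and> seg \<nu> p = seg \<nu> q" for p q I
    using that v seg_bounds[OF that(1)] seg_bounds[OF that(2)] alternatingD by metis
  then show "v \<in> Lambda_space n m \<nu>" using v by (simp add: Lambda_space_def del: o_apply)
qed

lemma spectral_eq:
  assumes "a \<ge> 1" "p \<in> segment \<nu> a"
  shows "spectral g \<nu> z p = z a + rho g a + 1 / 2 + of_nat (\<nu> a) - (of_nat p + 1 - of_nat (lo \<nu> a))"
proof -
  have "of_nat (p - psum \<nu> (a - 1)) = (of_nat p + 1 - of_nat (lo \<nu> a) :: complex)"
    using assms(2) by (simp add: lo_def of_nat_diff)
  then show ?thesis unfolding spectral_def Let_def seg_eqI[OF assms] by simp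
qed

section \<open>Decomposition of the products into blocks\<close>

lemma filter_upt_interval:
  assumes "\<And>p. i \<le> p \<Longrightarrow> p < j \<Longrightarrow> P p \<longleftrightarrow> s \<le> p \<and> p < t" "i \<le> s" "s \<le> t" "t \<le> j"
  shows "filter P [i..<j] = [s..<t]"
proof -
  have "[i..<j] = [i..<s] @ [s..<t] @ [t..<j]"
    using assms(2-4) upt_add_eq_append[of i s "j - s"] upt_add_eq_append[of s t "j - t"] by simp
  moreover have "filter P [i..<s] = []" "filter P [t..<j] = []" "filter P [s..<t] = [s..<t]"
    using assms by (auto simp: filter_empty_conv filter_id_conv)
  ultimately show ?thesis by simp
qed

lemma concat_map_filter: "concat (map (\<lambda>x. if P x then f x else []) xs) = concat (map f (filter P xs))"
  by (induction xs) auto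

lemma filter_concat_pairs:
  "filter (\<lambda>(p, q). k p = a \<and> l q = b) (concat (map (\<lambda>p. map (Pair p) (ys p)) xs)) =
    concat (map (\<lambda>p. map (Pair p) (filter (\<lambda>q. l q = b) (ys p))) (filter (\<lambda>p. k p = a) xs))"
proof -
  have "filter (\<lambda>(p, q). k p = a \<and> l q = b) (map (Pair p) (ys p)) =
      (if k p = a then map (Pair p) (filter (\<lambda>q. l q = b) (ys p)) else [])" for p
    by (simp add: filter_map comp_def)
  then show ?thesis by (induction xs) auto
qed

lemma C_pairs_eq: "C_pairs m \<nu> = concat (map (\<lambda>p. map (Pair p) [p + 1..<psum \<nu> m + 1]) [1..<psum \<nu> m + 1])"
  by (simp add: C_pairs_def)

lemma filter_segment:
  assumes "a \<in> {1..m}"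
  shows "filter (\<lambda>p. seg \<nu> p = a) [1..<psum \<nu> m + 1] = segment_list \<nu> a"
  using seg_iff[of _ \<nu> m a] segment_subset[OF assms, of \<nu>] assms lo_add[of a \<nu>] psum_mono[of a m \<nu>]
  by (intro filter_upt_interval) (auto simp: lo_def)

lemma C_pairs_block:
  assumes "a \<in> {1..m}" "b \<in> {1..m}" "a \<le> b"
  shows "filter (\<lambda>(p, q). seg \<nu> p = a \<and> seg \<nu> q = b) (C_pairs m \<nu>) =
    (if a = b then triangle (lo \<nu> a) (\<nu> a)
     else List.product (segment_list \<nu> a) (segment_list \<nu> b))"
proof -
  have b: "lo \<nu> b + \<nu> b \<le> psum \<nu> m + 1"
    using lo_add[of b \<nu>] psum_mono[of b m \<nu>] assms(2) by simp
  have "filter (\<lambda>q. seg \<nu> q = b) [p + 1..<psum \<nu> m + 1] =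
      (if a = b then [Suc p..<lo \<nu> a + \<nu> a] else (segment_list \<nu> b))"
    if p: "p \<in> segment \<nu> a" for p
  proof (cases "a = b")
    case True
    have "filter (\<lambda>q. seg \<nu> q = b) [p + 1..<psum \<nu> m + 1] = [p + 1..<lo \<nu> b + \<nu> b]"
      using seg_iff[of _ \<nu> m b] p b assms(2) True by (intro filter_upt_interval) auto
    then show ?thesis using True by simp
  next
    case False
    then have "p + 1 \<le> lo \<nu> b" using segments_less[of a b \<nu>] assms p by simp
    then have "filter (\<lambda>q. seg \<nu> q = b) [p + 1..<psum \<nu> m + 1] = segment_list \<nu> b"
      using seg_iff[of _ \<nu> m b] b assms(2) by (intro filter_upt_interval) auto
    then show ?thesis using False by simp
  qed
  then have "map (\<lambda>p. map (Pair p) (filter (\<lambda>q. seg \<nu> q = b) [p + 1..<psum \<nu> m + 1])) (segment_list \<nu> a) =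
    map (\<lambda>p. map (Pair p) (if a = b then [Suc p..<lo \<nu> a + \<nu> a] else (segment_list \<nu> b))) (segment_list \<nu> a)"
    by (intro map_cong refl arg_cong2[of _ _ _ _ map]) auto
  note blocks = this
  show ?thesis
    unfolding C_pairs_eq filter_concat_pairs filter_segment[OF assms(1)] blocks
    by (simp add: triangle_def product_concat_map del: upt_Suc)
qed

lemma set_reversed_segments: "set (reversed_segments m \<nu>) = {1..psum \<nu> m}"
proof -
  have "set (reversed_segments m \<nu>) = (\<Union>a\<in>{1..<m + 1}. set [psum \<nu> (a - 1) + 1..<psum \<nu> a + 1])"
    by (auto simp: reversed_segments_def simp del: upt_Suc)
  also have "\<dots> = (\<Union>a\<in>{1..m}. segment \<nu> a)"
  proof (rule SUP_cong)
    fix a assume "a \<in> {1..m}"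
    then have "a \<ge> 1" by simp
    then show "set [psum \<nu> (a - 1) + 1..<psum \<nu> a + 1] = segment \<nu> a"
      by (simp only: upt_segment set_upt)
  qed auto
  also have "\<dots> = {1..psum \<nu> m}"
    using segment_subset[of _ m \<nu>] seg_bounds[of _ \<nu> m] by blast
  finally show ?thesis .
qed

lemma filter_reversed_segments:
  assumes "b \<in> {1..m}"
  shows "filter (\<lambda>q. seg \<nu> q = b) (reversed_segments m \<nu>) = rev (segment_list \<nu> b)"
proof -
  have *: "filter (\<lambda>q. seg \<nu> q = b) (rev [psum \<nu> (a - 1) + 1..<psum \<nu> a + 1]) =
      (if a = b then rev (segment_list \<nu> a) else [])" if "a \<in> set [1..<m + 1]" for a
  proof -
    have a: "a \<ge> 1" using that by (auto simp del: upt_Suc)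
    then show ?thesis
      unfolding upt_segment[OF a] using seg_eqI[OF a, of _ \<nu>]
      by (auto simp: filter_empty_conv filter_id_conv simp del: upt_Suc)
  qed
  have "filter (\<lambda>q. seg \<nu> q = b) (reversed_segments m \<nu>) =
      concat (map (\<lambda>a. if a = b then rev (segment_list \<nu> a) else []) [1..<m + 1])"
    unfolding reversed_segments_def filter_concat map_map comp_def
    by (intro arg_cong[of _ _ concat] map_cong refl *)
  also have "\<dots> = rev (segment_list \<nu> b)"
  proof -
    have "filter (\<lambda>a. a = b) [1..<m + 1] = [b..<b + 1]"
      using assms by (intro filter_upt_interval) auto
    then show ?thesis unfolding concat_map_filter by simp
  qed
  finally show ?thesis .
qed

text \<open>The reversal inside a segment is invisible to \<open>seg\<close>, and comparing blocks
  needs no finer information.\<close>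

lemma sorted_wrt_reversed_segments:
  "sorted_wrt (\<lambda>q q'. seg \<nu> q \<le> seg \<nu> q') (reversed_segments m \<nu>)"
proof -
  have "sorted_wrt (\<lambda>q q'. seg \<nu> q \<le> seg \<nu> q') (concat (map (\<lambda>a. rev [psum \<nu> (a - 1) + 1..<psum \<nu> a + 1]) as))"
    if "sorted_wrt (<) as" "\<forall>a\<in>set as. a \<ge> 1" for as
    using that
  proof (induction as)
    case (Cons a as)
    have mem: "seg \<nu> q = c" if "q \<in> set [psum \<nu> (c - 1) + 1..<psum \<nu> c + 1]" "c \<ge> 1" for q c
      using that lo_add[of c \<nu>] by (intro seg_eqI) (auto simp: lo_def)
    have "sorted_wrt (\<lambda>q q'. seg \<nu> q \<le> seg \<nu> q') xs" if "\<forall>q\<in>set xs. seg \<nu> q = a" for xs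
      using that by (induction xs) auto
    then have "sorted_wrt (\<lambda>q q'. seg \<nu> q \<le> seg \<nu> q') (rev [psum \<nu> (a - 1) + 1..<psum \<nu> a + 1])"
      using mem[of _ a] Cons.prems by simp
    moreover have "seg \<nu> q \<le> seg \<nu> q'"
      if "q \<in> set [psum \<nu> (a - 1) + 1..<psum \<nu> a + 1]" "c \<in> set as" "q' \<in> set [psum \<nu> (c - 1) + 1..<psum \<nu> c + 1]" for q q' c
      using mem[OF that(1)] mem[OF that(3)] that(2) Cons.prems by fastforce
    ultimately show ?case using Cons by (auto simp: sorted_wrt_append simp del: set_upt upt_Suc)
  qed simp
  note sorted = this
  show ?thesis
    unfolding reversed_segments_def
    by (rule sorted) (auto simp: sorted_wrt_upt simp del: upt_Suc)
qed

lemma B_pairs_eq: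
  "B_pairs m \<nu> = concat (map (\<lambda>p. map (Pair p) (filter (\<lambda>q. p < q \<and> seg \<nu> p \<noteq> seg \<nu> q) (reversed_segments m \<nu>))) [1..<psum \<nu> m + 1])"
proof -
  have "concat (map (\<lambda>q. if P q then [(p, q)] else []) xs) = map (Pair p) (filter P xs)" for p :: nat and P and xs :: "nat list"
    by (induction xs) auto
  then show ?thesis by (simp add: B_pairs_def)
qed

lemma rev_product: "rev (List.product xs ys) = List.product (rev xs) (rev ys)"
proof -
  have "List.product (xs @ zs) ys = List.product xs ys @ List.product zs ys" for xs zs :: "'a list" and ys :: "'b list"
    by (induction xs) auto
  then show ?thesis by (induction xs) (auto simp: rev_map)
qed

text \<open>Reversing the list makes q ascend and p descend, the orders in which
  \<open>P_row\<close> and \<open>P_column\<close> fuse.\<close>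

lemma B_pairs_block:
  assumes "a \<in> {1..m}" "b \<in> {1..m}" "a < b"
  shows "filter (\<lambda>(p, q). seg \<nu> p = a \<and> seg \<nu> q = b) (rev (B_pairs m \<nu>)) =
    List.product (rev (segment_list \<nu> a)) (segment_list \<nu> b)"
proof -
  have "filter (\<lambda>q. seg \<nu> q = b) (filter (\<lambda>q. p < q \<and> seg \<nu> p \<noteq> seg \<nu> q) (reversed_segments m \<nu>)) = rev (segment_list \<nu> b)"
    if p: "p \<in> segment \<nu> a" for p
  proof -
    have "seg \<nu> p = a" using seg_eqI[OF _ p] assms by simp
    moreover have "p < q" if "q \<in> {1..psum \<nu> m}" "seg \<nu> q = b" for q
      using that seg_iff[OF that(1) assms(2)] segments_less[of a b \<nu>] assms p by simp
    ultimately have "filter (\<lambda>q. seg \<nu> q = b) (filter (\<lambda>q. p < q \<and> seg \<nu> p \<noteq> seg \<nu> q) (reversed_segments m \<nu>)) =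
        filter (\<lambda>q. seg \<nu> q = b) (reversed_segments m \<nu>)"
      unfolding filter_filter using assms(3) by (intro filter_cong) (auto simp: set_reversed_segments)
    then show ?thesis unfolding filter_reversed_segments[OF assms(2)] .
  qed
  then have "map (\<lambda>p. map (Pair p) (filter (\<lambda>q. seg \<nu> q = b) (filter (\<lambda>q. p < q \<and> seg \<nu> p \<noteq> seg \<nu> q) (reversed_segments m \<nu>)))) (segment_list \<nu> a) =
    map (\<lambda>p. map (Pair p) (rev (segment_list \<nu> b))) (segment_list \<nu> a)"
    by (intro map_cong refl arg_cong2[of _ _ _ _ map]) auto
  note blocks = this
  have "filter (\<lambda>(p, q). seg \<nu> p = a \<and> seg \<nu> q = b) (B_pairs m \<nu>) =
      List.product (segment_list \<nu> a) (rev (segment_list \<nu> b))"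
    unfolding B_pairs_eq filter_concat_pairs filter_segment[OF assms(1)] blocks product_concat_map ..
  then show ?thesis by (simp add: rev_product rev_filter[symmetric])
qed

text \<open>Blocks in the order in which \<open>fold\<close> applies them. A diagonal pair (a, a)
  stands for the triangle of one segment.\<close>

definition C_blocks :: "nat \<Rightarrow> (nat \<times> nat) list" where
  "C_blocks m = concat (map (\<lambda>a. map (Pair a) [a..<m + 1]) [1..<m + 1])"

text \<open>Reversed because the rightmost block of the product acts first. Diagonal pairs are
  absent, as \<open>B_pairs\<close> joins different segments only.\<close>

definition B_blocks :: "nat \<Rightarrow> (nat \<times> nat) list" where
  "B_blocks m = rev (concat (map (\<lambda>a. map (Pair a) [a + 1..<m + 1]) [1..<m + 1]))"

lemma set_C_blocks: "set (C_blocks m) = {(a, b). 1 \<le> a \<and> a \<le> b \<and> b \<le> m}"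
proof -
  have "set (C_blocks m) = (\<Union>a\<in>{1..<m + 1}. Pair a ` {a..<m + 1})" by (auto simp: C_blocks_def simp del: upt_Suc)
  then show ?thesis by fastforce
qed

lemma set_B_blocks: "set (B_blocks m) = {(a, b). 1 \<le> a \<and> a < b \<and> b \<le> m}"
proof -
  have "set (B_blocks m) = (\<Union>a\<in>{1..<m + 1}. Pair a ` {a + 1..<m + 1})" by (auto simp: B_blocks_def simp del: upt_Suc)
  then show ?thesis by fastforce
qed

abbreviation lex_less :: "nat \<times> nat \<Rightarrow> nat \<times> nat \<Rightarrow> bool" where
  "lex_less x y \<equiv> fst x < fst y \<or> fst x = fst y \<and> snd x < snd y"

lemma distinct_sorted_lex: "sorted_wrt lex_less xs \<Longrightarrow> distinct xs"
  by (induction xs) auto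

lemma sorted_C_blocks: "sorted_wrt lex_less (C_blocks m)"
  unfolding C_blocks_def by (rule sorted_wrt_concat_pairs) (auto simp del: upt_Suc)

lemma sorted_B_blocks: "sorted_wrt (\<lambda>x y. lex_less y x) (B_blocks m)"
  unfolding B_blocks_def sorted_wrt_rev
  by (rule sorted_wrt_concat_pairs) (auto simp del: upt_Suc)

text \<open>Two factors whose order disagrees with the order of their blocks have no tensor factor
  in common.\<close>

lemma C_fold_blocks:
  assumes "pair_operator Q n"
  shows "R_product Q x (C_pairs m \<nu>) v =
    fold (\<lambda>(a, b). R_product Q x
      (if a = b then triangle (lo \<nu> a) (\<nu> a)
       else List.product (segment_list \<nu> a) (segment_list \<nu> b))) (C_blocks m) v"
proof -
  interpret pair_operator Q n by (rule assms)
  let ?f = "\<lambda>(p, q). pair_R Q p q (x p q)" and ?key = "\<lambda>(p, q). (seg \<nu> p, seg \<nu> q)"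
  have C: "p \<in> {1..psum \<nu> m} \<and> q \<in> {1..psum \<nu> m} \<and> p < q" if "(p, q) \<in> set (C_pairs m \<nu>)" for p q
    using that by (auto simp: C_pairs_eq simp del: upt_Suc)
  have "fold ?f (C_pairs m \<nu>) v = fold (\<lambda>k. fold ?f (filter (\<lambda>x. ?key x = k) (C_pairs m \<nu>))) (C_blocks m) v"
  proof (rule fold_by_key[OF _ sorted_C_blocks distinct_sorted_lex[OF sorted_C_blocks]])
    show "sorted_wrt lex_less (C_pairs m \<nu>)"
      unfolding C_pairs_eq by (rule sorted_wrt_concat_pairs) (auto simp del: upt_Suc)
    show "?key ` set (C_pairs m \<nu>) \<subseteq> set (C_blocks m)"
    proof (clarify)
      fix p q assume "(p, q) \<in> set (C_pairs m \<nu>)"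
      from C[OF this] show "(seg \<nu> p, seg \<nu> q) \<in> set (C_blocks m)"
        using seg_bounds(1)[of p \<nu> m] seg_bounds(1)[of q \<nu> m] seg_mono[of p q \<nu> m]
        by (simp add: set_C_blocks)
    qed
    fix k l w assume kl: "k \<in> set (C_pairs m \<nu>)" "l \<in> set (C_pairs m \<nu>)" "lex_less k l" "lex_less (?key l) (?key k)"
    obtain p q r s where [simp]: "k = (p, q)" "l = (r, s)" by force
    have pq: "p \<in> {1..psum \<nu> m}" "q \<in> {1..psum \<nu> m}" "p < q" and rs: "r \<in> {1..psum \<nu> m}" "s \<in> {1..psum \<nu> m}" "r < s"
      using C kl by auto
    \<comment> \<open>With p = r the second indices would be ordered like their segments. So p < r,
      and the keys can disagree only through seg s < seg q.\<close>
    have "p < r"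
    proof (rule ccontr)
      assume "\<not> p < r"
      then have "p = r" "q < s" using kl(3) by auto
      then show False using kl(4) seg_mono[of q s \<nu> m] rs by auto
    qed
    moreover have "seg \<nu> s < seg \<nu> q" using kl(4) seg_mono[of p r \<nu> m] rs \<open>p < r\<close> by auto
    moreover have "seg \<nu> r \<le> seg \<nu> s" using seg_mono[of r s \<nu> m] rs by auto
    ultimately have "p \<noteq> q" "r \<noteq> s" "{p, q} \<inter> {r, s} = {}" using pq rs by auto
    then show "?f k (?f l w) = ?f l (?f k w)" by (simp add: pair_R_commute)
  qed
  also have "\<dots> = fold (\<lambda>(a, b). fold ?f (if a = b then triangle (lo \<nu> a) (\<nu> a)
       else List.product (segment_list \<nu> a) (segment_list \<nu> b))) (C_blocks m) v"
  proof (rule fold_cong[OF refl refl])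
    fix k assume k: "k \<in> set (C_blocks m)"
    obtain a b where ab: "k = (a, b)" by force
    have "filter (\<lambda>x. ?key x = k) (C_pairs m \<nu>) = filter (\<lambda>(p, q). seg \<nu> p = a \<and> seg \<nu> q = b) (C_pairs m \<nu>)"
      unfolding ab by (intro filter_cong) auto
    also have "\<dots> = (if a = b then triangle (lo \<nu> a) (\<nu> a)
       else List.product (segment_list \<nu> a) (segment_list \<nu> b))"
      by (rule C_pairs_block) (use k in \<open>auto simp: ab set_C_blocks\<close>)
    finally show "fold ?f (filter (\<lambda>x. ?key x = k) (C_pairs m \<nu>)) = (case k of (a, b) \<Rightarrow> fold ?f (if a = b then triangle (lo \<nu> a) (\<nu> a)
       else List.product (segment_list \<nu> a) (segment_list \<nu> b)))" by (simp add: ab)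
  qed
  finally show ?thesis .
qed

lemma B_fold_blocks:
  assumes "pair_operator Q n"
  shows "R_product Q x (rev (B_pairs m \<nu>)) v =
    fold (\<lambda>(a, b). R_product Q x
      (List.product (rev (segment_list \<nu> a)) (segment_list \<nu> b))) (B_blocks m) v"
proof -
  interpret pair_operator Q n by (rule assms)
  let ?f = "\<lambda>(p, q). pair_R Q p q (x p q)" and ?key = "\<lambda>(p, q). (seg \<nu> p, seg \<nu> q)"
  \<comment> \<open>Within a reversed segment the second indices run backwards, so only their
    segments are compared.\<close>
  let ?R = "\<lambda>k l. fst l < fst k \<or> fst l = fst k \<and> seg \<nu> (snd l) \<le> seg \<nu> (snd k)"
  have B: "p \<in> {1..psum \<nu> m} \<and> q \<in> {1..psum \<nu> m} \<and> p < q \<and> seg \<nu> p < seg \<nu> q" if "(p, q) \<in> set (rev (B_pairs m \<nu>))" for p q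
  proof -
    have "p \<in> {1..psum \<nu> m} \<and> q \<in> {1..psum \<nu> m} \<and> p < q \<and> seg \<nu> p \<noteq> seg \<nu> q"
      using that by (auto simp: B_pairs_eq set_reversed_segments simp del: upt_Suc)
    then show ?thesis using seg_mono[of p q \<nu> m] by auto
  qed
  have "fold ?f (rev (B_pairs m \<nu>)) v = fold (\<lambda>k. fold ?f (filter (\<lambda>x. ?key x = k) (rev (B_pairs m \<nu>)))) (B_blocks m) v"
  proof (rule fold_by_key[OF _ sorted_B_blocks])
    show "sorted_wrt ?R (rev (B_pairs m \<nu>))"
      unfolding B_pairs_eq sorted_wrt_rev
      by (rule sorted_wrt_concat_pairs[where R' = "\<lambda>q q'. seg \<nu> q \<le> seg \<nu> q'"])
         (auto intro: sorted_wrt_filter sorted_wrt_reversed_segments simp del: upt_Suc)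
    show "distinct (B_blocks m)"
      using distinct_sorted_lex[of "rev (B_blocks m)"] sorted_B_blocks[of m] by (simp add: sorted_wrt_rev)
    show "?key ` set (rev (B_pairs m \<nu>)) \<subseteq> set (B_blocks m)"
    proof (clarify)
      fix p q assume "(p, q) \<in> set (rev (B_pairs m \<nu>))"
      from B[OF this] show "(seg \<nu> p, seg \<nu> q) \<in> set (B_blocks m)"
        using seg_bounds(1)[of p \<nu> m] seg_bounds(1)[of q \<nu> m] by (simp add: set_B_blocks)
    qed
    fix k l w assume kl: "k \<in> set (rev (B_pairs m \<nu>))" "l \<in> set (rev (B_pairs m \<nu>))" "?R k l" "lex_less (?key k) (?key l)"
    obtain p q r s where [simp]: "k = (p, q)" "l = (r, s)" by force
    have pq: "p \<in> {1..psum \<nu> m}" "q \<in> {1..psum \<nu> m}" "p < q" "seg \<nu> p < seg \<nu> q"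
      and rs: "r \<in> {1..psum \<nu> m}" "s \<in> {1..psum \<nu> m}" "r < s" "seg \<nu> r < seg \<nu> s"
      using B[of p q] B[of r s] kl by simp_all
    \<comment> \<open>Equal first indices would force the blocks into the order of the list. So r <
      p; then p and r share a segment and seg q < seg s.\<close>
    have "r < p"
    proof (rule ccontr)
      assume "\<not> r < p"
      then have "p = r" "seg \<nu> s \<le> seg \<nu> q" using kl(3) by auto
      then show False using kl(4) by auto
    qed
    moreover have "seg \<nu> r = seg \<nu> p" "seg \<nu> q < seg \<nu> s"
      using kl(4) seg_mono[of r p \<nu> m] pq \<open>r < p\<close> by auto
    ultimately have "p \<noteq> q" "r \<noteq> s" "{p, q} \<inter> {r, s} = {}" using pq rs by auto
    then show "?f k (?f l w) = ?f l (?f k w)" by (simp add: pair_R_commute)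
  qed
  also have "\<dots> = fold (\<lambda>(a, b). fold ?f (List.product (rev (segment_list \<nu> a)) (segment_list \<nu> b))) (B_blocks m) v"
  proof (rule fold_cong[OF refl refl])
    fix k assume k: "k \<in> set (B_blocks m)"
    obtain a b where ab: "k = (a, b)" by force
    have "filter (\<lambda>x. ?key x = k) (rev (B_pairs m \<nu>)) = filter (\<lambda>(p, q). seg \<nu> p = a \<and> seg \<nu> q = b) (rev (B_pairs m \<nu>))"
      unfolding ab by (intro filter_cong) auto
    also have "\<dots> = List.product (rev (segment_list \<nu> a)) (segment_list \<nu> b)"
      by (rule B_pairs_block) (use k in \<open>auto simp: ab set_B_blocks\<close>)
    finally show "fold ?f (filter (\<lambda>x. ?key x = k) (rev (B_pairs m \<nu>))) =
        (case k of (a, b) \<Rightarrow> fold ?f (List.product (rev (segment_list \<nu> a)) (segment_list \<nu> b)))" by (simp add: ab)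
  qed
  finally show ?thesis .
qed

section \<open>Composition of the normalised blocks\<close>

text \<open>The coordinates of lambda + rho as functions of mu. All poles are level sets of these,
  of their sums or of their differences.\<close>

definition omega :: "lie_type \<Rightarrow> nat \<Rightarrow> (nat \<Rightarrow> nat) \<Rightarrow> nat \<Rightarrow> (nat \<Rightarrow> complex) \<Rightarrow> complex" where
  "omega g n \<nu> a z = lam n \<nu> z a + rho g a"

lemma omega_polyfun: "a \<in> {1..m} \<Longrightarrow> omega g n \<nu> a \<in> polyfun m"
proof -
  assume a: "a \<in> {1..m}"
  have "omega g n \<nu> a = (\<lambda>z. z a + (of_nat (\<nu> a) - of_nat n / 2 + rho g a))"
    by (simp add: fun_eq_iff omega_def lam_def)
  then show ?thesis using polyfun.add[OF polyfun.coord[OF a] polyfun.const] by simp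
qed

lemma nonconstant_omega: "nonconstant (omega g n \<nu> a)"
  and nonconstant_omega_add: "nonconstant (\<lambda>z. omega g n \<nu> a z + omega g n \<nu> b z)"
  and nonconstant_omega_diff: "a \<noteq> b \<Longrightarrow> nonconstant (\<lambda>z. omega g n \<nu> a z - omega g n \<nu> b z)"
proof -
  let ?k = "\<lambda>a. of_nat (\<nu> a) - of_nat n / 2 + rho g a :: complex"
  have o: "omega g n \<nu> a z = z a + ?k a" for a z by (simp add: omega_def lam_def)
  show "nonconstant (omega g n \<nu> a)"
    unfolding nonconstant_def o by (rule allI, rule_tac x = "\<lambda>_. c + 1 - ?k a" in exI) simp
  show "nonconstant (\<lambda>z. omega g n \<nu> a z + omega g n \<nu> b z)"
    unfolding nonconstant_def o by (rule allI, rule_tac x = "\<lambda>_. (c + 1 - ?k a - ?k b) / 2" in exI) (simp add: field_simps)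
  show "nonconstant (\<lambda>z. omega g n \<nu> a z - omega g n \<nu> b z)" if "a \<noteq> b"
    unfolding nonconstant_def o
    by (rule allI, rule_tac x = "\<lambda>i. if i = a then c + 1 - ?k a + ?k b else 0" in exI) (use that in simp)
qed

text \<open>The invariant passed from block to block: regularity at \<open>z0\<close>, and
  antisymmetry off a hypersurface, without which the next block could not be fused.\<close>

definition good_family :: "nat \<Rightarrow> nat \<Rightarrow> (nat \<Rightarrow> nat) \<Rightarrow> (nat \<Rightarrow> complex) \<Rightarrow> ((nat \<Rightarrow> complex) \<Rightarrow> tensor) \<Rightarrow> bool" where
  "good_family n m \<nu> z0 F \<longleftrightarrow>
     regular_family m n (psum \<nu> m) z0 F \<and> generically m (\<lambda>z. F z \<in> Lambda_space n m \<nu>)"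

lemma Lambda_space_scale: "v \<in> Lambda_space n m \<nu> \<Longrightarrow> (\<lambda>I. v I / c) \<in> Lambda_space n m \<nu>"
  by (simp add: Lambda_space_def tensor_space_def)

text \<open>Each block is normalised by its own scalar; linearity of the later blocks collects the
  scalars into one product.\<close>

lemma good_family_fold:
  assumes "\<And>k F. k \<in> set ks \<Longrightarrow> good_family n m \<nu> z0 F \<Longrightarrow> good_family n m \<nu> z0 (\<lambda>z I. A k z (F z) I / c k z)"
    and "\<And>k z. k \<in> set ks \<Longrightarrow> linear_op (A k z)"
    and "good_family n m \<nu> z0 F"
  shows "good_family n m \<nu> z0 (\<lambda>z I. fold (\<lambda>k. A k z) ks (F z) I / (\<Prod>k\<leftarrow>ks. c k z))"
  using assms
proof (induction ks arbitrary: F)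
  case (Cons k ks)
  have "good_family n m \<nu> z0 (\<lambda>z I. A k z (F z) I / c k z)"
    by (rule Cons.prems(1)[OF _ Cons.prems(3)]) simp
  then have "good_family n m \<nu> z0 (\<lambda>z I. fold (\<lambda>k. A k z) ks (\<lambda>I. A k z (F z) I / c k z) I / (\<Prod>k\<leftarrow>ks. c k z))"
    by (intro Cons.IH) (simp_all add: Cons.prems)
  moreover have "fold (\<lambda>k. A k z) ks (\<lambda>I. v I / c k z) = (\<lambda>I. fold (\<lambda>k. A k z) ks v I / c k z)" for v z
  proof -
    have "linear_op (fold (\<lambda>k. A k z) ks)" by (rule linear_op_fold) (simp add: Cons.prems)
    from linear_op_scale[OF this, of "1 / c k z" v] show ?thesis by simp
  qed
  ultimately show ?case by (simp add: divide_divide_eq_left)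
qed simp

lemma pair_R_fold_cong:
  assumes "\<And>p q. (p, q) \<in> set ps \<Longrightarrow> x p q = y p q"
  shows "R_product Q x ps v = R_product Q y ps v"
  by (rule fold_cong) (use assms in auto)

lemma set_product_segments:
  "set (List.product [s..<s + a] [t..<t + b]) = {s..<s + a} \<times> {t..<t + b}"
  "set (List.product (rev [s..<s + a]) [t..<t + b]) = {s..<s + a} \<times> {t..<t + b}"
  by auto

lemma (in pair_operator) linear_op_pair_R_fold:
  assumes "\<And>p q. (p, q) \<in> set ps \<Longrightarrow> p \<noteq> q"
  shows "linear_op (R_product Q x ps)"
proof (rule linear_op_fold)
  fix k assume k: "k \<in> set ps"
  obtain p q where pq: "k = (p, q)" by force
  show "linear_op (case k of (p, q) \<Rightarrow> pair_R Q p q (x p q))"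
    unfolding pq prod.case by (rule pair_R_linear) (use assms k pq in blast)
qed

text \<open>The segments other than a and b are disjoint from all factors of the block and keep
  their antisymmetry.\<close>

lemma (in pair_operator) Lambda_space_block:
  assumes v: "v \<in> Lambda_space n m \<nu>" and ab: "a \<in> {1..m}" "b \<in> {1..m}"
    and ps: "set ps \<subseteq> segment \<nu> a \<times> (segment \<nu> b)" "\<And>p q. (p, q) \<in> set ps \<Longrightarrow> p \<noteq> q"
    and alt: "alternating (segment \<nu> a) (R_product Q x ps v)"
      "alternating (segment \<nu> b) (R_product Q x ps v)"
  shows "R_product Q x ps v \<in> Lambda_space n m \<nu>"
  unfolding Lambda_space_iff
proof (intro conjI ballI)
  show "R_product Q x ps v \<in> tensor_space n (psum \<nu> m)"
  proof (rule pair_R_fold_tensor_space)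
    fix p q assume pq: "(p, q) \<in> set ps"
    then show "p \<noteq> q \<and> p \<in> {1..psum \<nu> m} \<and> q \<in> {1..psum \<nu> m}"
      using ps(1) ps(2)[OF pq] segment_subset[OF ab(1), of \<nu>] segment_subset[OF ab(2), of \<nu>] by blast
  qed (use v Lambda_space_iff in blast)
  fix c assume c: "c \<in> {1..m}"
  show "alternating (segment \<nu> c) (R_product Q x ps v)"
  proof (cases "c = a \<or> c = b")
    case False
    show ?thesis
    proof (rule alternating_pair_R_fold_disjoint)
      fix p q assume pq: "(p, q) \<in> set ps"
      then show "p \<noteq> q \<and> p \<notin> segment \<nu> c \<and> q \<notin> segment \<nu> c"
        using ps(1) ps(2)[OF pq] segments_disjoint[OF c ab(1), of \<nu>] segments_disjoint[OF c ab(2), of \<nu>] False by blast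
    qed (use v c Lambda_space_iff in blast)
  qed (use alt in auto)
qed

lemma good_familyD:
  assumes "good_family n m \<nu> z0 F" "a \<in> {1..m}" "b \<in> {1..m}"
  shows "regular_family m n (psum \<nu> m) z0 F"
    "generically m (\<lambda>z. alternating (segment \<nu> a) (F z) \<and> alternating (segment \<nu> b) (F z) \<and>
      F z \<in> tensor_space n (psum \<nu> m))"
  using assms(1) unfolding good_family_def Lambda_space_iff
  by (auto elim!: generically_mono simp: assms(2,3)[unfolded atLeastAtMost_iff One_nat_def])

text \<open>The shifts of the problem meet here: n is absorbed by the two n/2 in lambda, the rho and
  nu terms by omega, and the two halves together with the two index offsets leave the constant 1
  that puts the poles at positive integers.\<close>

lemma C_argument:
  assumes "a \<ge> 1" "b \<ge> 1" "p \<in> segment \<nu> a" "q \<in> segment \<nu> b"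
  shows "of_nat n - spectral g \<nu> z p - spectral g \<nu> z q =
    1 - of_nat (lo \<nu> a) - of_nat (lo \<nu> b) - (omega g n \<nu> a z + omega g n \<nu> b z) + of_nat p + of_nat q"
  unfolding spectral_eq[OF assms(1,3)] spectral_eq[OF assms(2,4)] omega_def lam_def
  by (simp add: algebra_simps)

lemma B_argument:
  assumes "a \<ge> 1" "b \<ge> 1" "p \<in> segment \<nu> a" "q \<in> segment \<nu> b"
  shows "spectral g \<nu> z q - spectral g \<nu> z p =
    of_nat (lo \<nu> b) - of_nat (lo \<nu> a) - (omega g n \<nu> a z - omega g n \<nu> b z) + of_nat p - of_nat q"
  unfolding spectral_eq[OF assms(1,3)] spectral_eq[OF assms(2,4)] omega_def lam_def
  by (simp add: algebra_simps)

lemma C_cross_step: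
  assumes g: "g = SP \<longrightarrow> even n" and ab: "a \<in> {1..m}" "b \<in> {1..m}" "a < b"
    and dom: "\<And>k. k \<ge> 1 \<Longrightarrow> omega g n \<nu> a z0 + omega g n \<nu> b z0 \<noteq> of_nat k"
    and F: "good_family n m \<nu> z0 F"
  shows "good_family n m \<nu> z0 (\<lambda>z I.
    R_product (P_tilde_op g n) (\<lambda>p q. of_nat n - spectral g \<nu> z p - spectral g \<nu> z q)
      (List.product (segment_list \<nu> a) (segment_list \<nu> b)) (F z) I /
    (if \<nu> a + \<nu> b \<ge> n then (lam n \<nu> z a + lam n \<nu> z b + rho g a + rho g b) / (z a + z b + rho g a + rho g b) else 1))"
    (is "good_family n m \<nu> z0 (\<lambda>z I. ?A z (F z) I / ?c z)")
proof -
  interpret pair_operator "P_tilde_op g n" n by (rule pair_operator_P_tilde[OF g])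
  let ?h = "\<lambda>z. omega g n \<nu> a z + omega g n \<nu> b z"
  let ?S = "segment \<nu> a" and ?T = "segment \<nu> b"
  have h: "?h \<in> polyfun m" "nonconstant ?h"
    using ab(3) by (intro polyfun_intros omega_polyfun ab nonconstant_omega_add)+
  have N: "?S \<inter> ?T = {}" "?S \<subseteq> {1..psum \<nu> m}" "?T \<subseteq> {1..psum \<nu> m}"
    using segments_disjoint[of a m b \<nu>] segment_subset[of a m \<nu>] segment_subset[of b m \<nu>] ab by blast+
  have x: "of_nat n - spectral g \<nu> z p - spectral g \<nu> z q = 1 - of_nat (lo \<nu> a) - of_nat (lo \<nu> b) - ?h z + of_nat p + of_nat q"
    if "p \<in> ?S" "q \<in> ?T" for z p q
    using ab that by (intro C_argument) auto
  \<comment> \<open>mu_a + mu_b + rho_a + rho_b = h + n - nu_a - nu_b.\<close>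
  have c: "?c z = (if \<nu> a + \<nu> b \<ge> n then ?h z / (?h z + (of_nat n - of_nat (\<nu> a) - of_nat (\<nu> b))) else 1)" for z
    by (simp add: omega_def lam_def algebra_simps)
  have "regular_family m n (psum \<nu> m) z0 (\<lambda>z I. ?A z (F z) I / ?c z)"
    by (rule C_block_regular[OF g good_familyD[OF F ab(1,2)] N h dom x c])
  moreover have "generically m (\<lambda>z. (\<lambda>I. ?A z (F z) I / ?c z) \<in> Lambda_space n m \<nu>)"
  proof -
    \<comment> \<open>The excluded hyperplanes are the poles of the single factors, where fusion
      breaks down.\<close>
    have "generically m (\<lambda>z. F z \<in> Lambda_space n m \<nu> \<and>
        (\<forall>p\<in>?S. \<forall>q\<in>?T. ?h z \<noteq> 1 - of_nat (lo \<nu> a) - of_nat (lo \<nu> b) + of_nat p + of_nat q))"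
      by (rule generically_conj, use F in \<open>simp add: good_family_def\<close>, (intro generically_ball generically_neq[OF h]; simp))
    then show ?thesis
    proof (rule generically_mono, intro Lambda_space_scale)
      fix z
      let ?e = "1 - of_nat (lo \<nu> a) - of_nat (lo \<nu> b) - ?h z"
      assume z: "F z \<in> Lambda_space n m \<nu> \<and>
        (\<forall>p\<in>?S. \<forall>q\<in>?T. ?h z \<noteq> 1 - of_nat (lo \<nu> a) - of_nat (lo \<nu> b) + of_nat p + of_nat q)"
      have w: "alternating ?S (F z)" "alternating ?T (F z)" "F z \<in> tensor_space n (psum \<nu> m)"
        using z ab by (auto simp: Lambda_space_iff)
      have nz: "?e + of_nat p + of_nat q \<noteq> 0" if "p \<in> ?S" "q \<in> ?T" for p q
      proof -
        have "?h z \<noteq> 1 - of_nat (lo \<nu> a) - of_nat (lo \<nu> b) + of_nat p + of_nat q" using z that by blast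
        then show ?thesis by (auto simp: algebra_simps)
      qed
      have A: "?A z (F z) = R_product (P_tilde_op g n) (\<lambda>p q. ?e + of_nat p + of_nat q)
          (List.product (segment_list \<nu> a) (segment_list \<nu> b)) (F z)"
        by (rule pair_R_fold_cong) (unfold set_product_segments mem_Times_iff fst_conv snd_conv, use x in blast)
      show "?A z (F z) \<in> Lambda_space n m \<nu>"
        unfolding A
      proof (rule Lambda_space_block[OF _ ab(1,2)])
        show "p \<noteq> q" if "(p, q) \<in> set (List.product (segment_list \<nu> a) (segment_list \<nu> b))" for p q
          using that N(1) unfolding set_product_segments by auto
      qed (use z C_block(2,3)[OF g w N nz] set_product_segments in blast)+
    qed
  qed
  ultimately show ?thesis unfolding good_family_def by blast
qed

lemma B_cross_step:
  assumes ab: "a \<in> {1..m}" "b \<in> {1..m}" "a < b" and \<nu>: "\<nu> a \<ge> 1" "\<nu> b \<ge> 1"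
    and dom: "\<And>k. k \<ge> 1 \<Longrightarrow> omega g n \<nu> a z0 - omega g n \<nu> b z0 \<noteq> - of_nat k"
    and F: "good_family n m \<nu> z0 F"
  shows "good_family n m \<nu> z0 (\<lambda>z I.
    R_product (P_op n) (\<lambda>p q. spectral g \<nu> z q - spectral g \<nu> z p)
      (List.product (rev (segment_list \<nu> a)) (segment_list \<nu> b)) (F z) I /
    (if \<nu> a \<le> \<nu> b
       then (lam n \<nu> z a - lam n \<nu> z b + rho g a - rho g b + of_nat (\<nu> b)) / (z a - z b + rho g a - rho g b)
       else (lam n \<nu> z a - lam n \<nu> z b + rho g a - rho g b + of_nat (\<nu> b)) / (lam n \<nu> z a - lam n \<nu> z b + rho g a - rho g b)))"
    (is "good_family n m \<nu> z0 (\<lambda>z I. ?A z (F z) I / ?c z)")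
proof -
  interpret pair_operator "P_op n" n by (rule pair_operator_P)
  let ?d = "\<lambda>z. omega g n \<nu> a z - omega g n \<nu> b z"
  let ?S = "segment \<nu> a" and ?T = "segment \<nu> b"
  have d: "?d \<in> polyfun m" "nonconstant ?d"
    using ab(3) by (intro polyfun_intros omega_polyfun ab nonconstant_omega_diff; simp)+
  have N: "?S \<inter> ?T = {}" "?S \<subseteq> {1..psum \<nu> m}" "?T \<subseteq> {1..psum \<nu> m}"
    using segments_disjoint[of a m b \<nu>] segment_subset[of a m \<nu>] segment_subset[of b m \<nu>] ab by blast+
  have x: "spectral g \<nu> z q - spectral g \<nu> z p = of_nat (lo \<nu> b) - of_nat (lo \<nu> a) - ?d z + of_nat p - of_nat q"
    if "p \<in> ?S" "q \<in> ?T" for z p q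
    using ab that by (intro B_argument) auto
  \<comment> \<open>mu_a - mu_b + rho_a - rho_b = d + nu_b - nu_a, up to sign the denominator of the
    top row.\<close>
  have c: "?c z = (if \<nu> a \<le> \<nu> b then (?d z + of_nat (\<nu> b)) / (?d z + of_nat (\<nu> b) - of_nat (\<nu> a)) else (?d z + of_nat (\<nu> b)) / ?d z)" for z
    by (simp add: omega_def lam_def algebra_simps)
  have "regular_family m n (psum \<nu> m) z0 (\<lambda>z I. ?A z (F z) I / ?c z)"
    by (rule B_block_regular[OF good_familyD[OF F ab(1,2)] N \<nu> d dom x c])
  moreover have "generically m (\<lambda>z. (\<lambda>I. ?A z (F z) I / ?c z) \<in> Lambda_space n m \<nu>)"
  proof -
    have "generically m (\<lambda>z. F z \<in> Lambda_space n m \<nu> \<and>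
        (\<forall>p\<in>?S. \<forall>q\<in>?T. ?d z \<noteq> of_nat (lo \<nu> b) - of_nat (lo \<nu> a) + of_nat p - of_nat q))"
      by (rule generically_conj, use F in \<open>simp add: good_family_def\<close>, (intro generically_ball generically_neq[OF d]; simp))
    then show ?thesis
    proof (rule generically_mono, intro Lambda_space_scale)
      fix z
      let ?e = "of_nat (lo \<nu> b) - of_nat (lo \<nu> a) - ?d z"
      assume z: "F z \<in> Lambda_space n m \<nu> \<and>
        (\<forall>p\<in>?S. \<forall>q\<in>?T. ?d z \<noteq> of_nat (lo \<nu> b) - of_nat (lo \<nu> a) + of_nat p - of_nat q)"
      have w: "alternating ?S (F z)" "alternating ?T (F z)" "F z \<in> tensor_space n (psum \<nu> m)"
        using z ab by (auto simp: Lambda_space_iff)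
      have nz: "?e + of_nat p - of_nat q \<noteq> 0" if "p \<in> ?S" "q \<in> ?T" for p q
      proof -
        have "?d z \<noteq> of_nat (lo \<nu> b) - of_nat (lo \<nu> a) + of_nat p - of_nat q" using z that by blast
        then show ?thesis by (auto simp: algebra_simps)
      qed
      have A: "?A z (F z) = R_product (P_op n) (\<lambda>p q. ?e + of_nat p - of_nat q)
          (List.product (rev (segment_list \<nu> a)) (segment_list \<nu> b)) (F z)"
        by (rule pair_R_fold_cong) (unfold set_product_segments mem_Times_iff fst_conv snd_conv, use x in blast)
      show "?A z (F z) \<in> Lambda_space n m \<nu>"
        unfolding A
      proof (rule Lambda_space_block[OF _ ab(1,2)])
        show "p \<noteq> q" if "(p, q) \<in> set (List.product (rev (segment_list \<nu> a)) (segment_list \<nu> b))" for p q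
          using that N(1) unfolding set_product_segments by auto
      qed (use z B_block(3,4)[OF w N nz] set_product_segments in blast)+
    qed
  qed
  ultimately show ?thesis unfolding good_family_def by blast
qed

lemma C_diagonal_step:
  assumes g: "g = SP \<longrightarrow> even n" and a: "a \<in> {1..m}"
    and dom: "\<And>k. g = SP \<Longrightarrow> k \<ge> 1 \<Longrightarrow> omega g n \<nu> a z0 \<noteq> of_nat k"
    and F: "good_family n m \<nu> z0 F"
  shows "good_family n m \<nu> z0 (\<lambda>z I.
    R_product (P_tilde_op g n) (\<lambda>p q. of_nat n - spectral g \<nu> z p - spectral g \<nu> z q)
      (triangle (lo \<nu> a) (\<nu> a)) (F z) I /
    (if g = SP then if 2 * \<nu> a \<ge> n then (lam n \<nu> z a + rho g a) / (z a + rho g a) else 1 else 1))"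
    (is "good_family n m \<nu> z0 (\<lambda>z I. ?A z (F z) I / ?c z)")
proof -
  interpret pair_operator "P_tilde_op g n" n by (rule pair_operator_P_tilde[OF g])
  let ?h = "omega g n \<nu> a"
  let ?S = "segment \<nu> a"
  have h: "?h \<in> polyfun m" "nonconstant ?h"
    using a by (auto intro: omega_polyfun nonconstant_omega)
  have N: "?S \<subseteq> {1..psum \<nu> m}" using segment_subset[of a m \<nu>] a by blast
  have x: "of_nat n - spectral g \<nu> z p - spectral g \<nu> z q = 1 - 2 * of_nat (lo \<nu> a) - 2 * ?h z + of_nat p + of_nat q"
    if "p \<in> ?S" "q \<in> ?S" for z p q
    using C_argument[of a a p \<nu> q n g z] a that by simp
  have tri: "set (triangle (lo \<nu> a) (\<nu> a)) \<subseteq> ?S \<times> ?S" "\<And>p q. (p, q) \<in> set (triangle (lo \<nu> a) (\<nu> a)) \<Longrightarrow> p \<noteq> q"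
    by (auto simp: set_triangle)
  have gen: "generically m (\<lambda>z. F z \<in> Lambda_space n m \<nu> \<and>
      (\<forall>p\<in>?S. \<forall>q\<in>?S. ?h z \<noteq> (1 - 2 * of_nat (lo \<nu> a) + of_nat p + of_nat q) / 2))"
    by (rule generically_conj, use F in \<open>simp add: good_family_def\<close>, (intro generically_ball generically_neq[OF h]; simp))
  have A: "?A z (F z) = triangle_prod g n (1 - 2 * of_nat (lo \<nu> a) - 2 * ?h z) (lo \<nu> a) (\<nu> a) (F z)" for z
    unfolding triangle_prod_def[OF g] by (rule pair_R_fold_cong) (use tri(1) x in blast)
  have "regular_family m n (psum \<nu> m) z0 (\<lambda>z I. ?A z (F z) I / ?c z)"
  proof (cases g)
    case SP
    have c: "?c z = (if 2 * \<nu> a \<ge> n then ?h z / (?h z + (of_nat n / 2 - of_nat (\<nu> a))) else 1)" for z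
      using SP by (simp add: omega_def lam_def algebra_simps)
    have alt: "generically m (\<lambda>z. alternating ?S (F z) \<and> F z \<in> tensor_space n (psum \<nu> m))"
      using good_familyD(2)[OF F a a] by (rule generically_mono) simp
    have n: "even n" using g SP by simp
    show ?thesis
      using triangle_regular[OF n good_familyD(1)[OF F a a] alt N h dom[OF SP] x c] unfolding SP .
  next
    \<comment> \<open>The block acts as the identity and its normalising factor is 1, which fits
      dominance imposing nothing on omega_a alone.\<close>
    case SO
    show ?thesis
    proof (rule regular_family_cong[OF _ good_familyD(1)[OF F a a]])
      show "generically m (\<lambda>z. \<forall>I\<in>multi_indices n (psum \<nu> m). ?A z (F z) I / ?c z = F z I)"
        using gen
      proof (rule generically_mono, intro ballI)
        fix z I assume "F z \<in> Lambda_space n m \<nu> \<and>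
          (\<forall>p\<in>?S. \<forall>q\<in>?S. ?h z \<noteq> (1 - 2 * of_nat (lo \<nu> a) + of_nat p + of_nat q) / 2)"
        then have "alternating ?S (F z)" using a by (auto simp: Lambda_space_iff)
        then show "?A z (F z) I / ?c z = F z I"
          unfolding A unfolding SO by (simp add: triangle_prod_SO)
      qed
    qed
  qed
  moreover have "generically m (\<lambda>z. (\<lambda>I. ?A z (F z) I / ?c z) \<in> Lambda_space n m \<nu>)"
    using gen
  proof (rule generically_mono, intro Lambda_space_scale)
    fix z
    let ?e = "1 - 2 * of_nat (lo \<nu> a) - 2 * ?h z"
    assume z: "F z \<in> Lambda_space n m \<nu> \<and>
      (\<forall>p\<in>?S. \<forall>q\<in>?S. ?h z \<noteq> (1 - 2 * of_nat (lo \<nu> a) + of_nat p + of_nat q) / 2)"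
    have w: "alternating ?S (F z)" "F z \<in> tensor_space n (psum \<nu> m)"
      using z a by (auto simp: Lambda_space_iff)
    have "alternating ?S (?A z (F z))"
      unfolding A
    proof (rule triangle_prod_alternating[OF g w N])
      fix p q assume "lo \<nu> a \<le> p" "p < q" "q < lo \<nu> a + \<nu> a"
      then have "?h z \<noteq> (1 - 2 * of_nat (lo \<nu> a) + of_nat p + of_nat q) / 2" using z by simp
      then show "?e + of_nat p + of_nat q \<noteq> 0" by (auto simp: field_simps)
    qed
    then show "?A z (F z) \<in> Lambda_space n m \<nu>"
      using z by (intro Lambda_space_block[OF _ a a tri]) auto
  qed
  ultimately show ?thesis unfolding good_family_def by blast
qed

lemma prod_C_blocks:
  fixes f h :: "nat \<Rightarrow> nat \<Rightarrow> complex"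
  shows "(\<Prod>(a, b)\<leftarrow>C_blocks m. if a = b then h a b else f a b) =
    (\<Prod>(a, b)\<in>{(a, b). 1 \<le> a \<and> a < b \<and> b \<le> m}. f a b) * (\<Prod>a\<in>{1..m}. h a a)"
proof -
  let ?U = "{(a, b). 1 \<le> a \<and> a < b \<and> b \<le> m}" and ?D = "(\<lambda>a. (a, a)) ` {1..m}"
  have fin: "finite ?U" by (rule finite_subset[of _ "{1..m} \<times> {1..m}"]) auto
  have U: "set (C_blocks m) = ?U \<union> ?D" "?U \<inter> ?D = {}"
    unfolding set_C_blocks by auto
  have "(\<Prod>(a, b)\<leftarrow>C_blocks m. if a = b then h a b else f a b) =
      (\<Prod>(a, b)\<in>?U \<union> ?D. if a = b then h a b else f a b)"
    unfolding U(1)[symmetric] by (rule prod.distinct_set_conv_list[symmetric, OF distinct_sorted_lex[OF sorted_C_blocks]])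
  also have "\<dots> = (\<Prod>(a, b)\<in>?U. if a = b then h a b else f a b) * (\<Prod>(a, b)\<in>?D. if a = b then h a b else f a b)"
    using U(2) fin by (intro prod.union_disjoint) auto
  also have "(\<Prod>(a, b)\<in>?U. if a = b then h a b else f a b) = (\<Prod>(a, b)\<in>?U. f a b)"
    by (intro prod.cong) auto
  also have "(\<Prod>(a, b)\<in>?D. if a = b then h a b else f a b) = (\<Prod>a\<in>{1..m}. h a a)"
    by (subst prod.reindex) (auto simp: inj_on_def)
  finally show ?thesis .
qed

theorem theorem3p4:
  fixes g :: lie_type and n m :: nat and \<nu> :: "nat \<Rightarrow> nat" and \<mu> :: "nat \<Rightarrow> complex"
  assumes "n \<ge> 2"
    and "g = SP \<Longrightarrow> even n"
    and "m \<ge> 1"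
    and "\<And>a. a \<in> {1..m} \<Longrightarrow> \<nu> a \<in> {1..n - 1}"
    and "dominant g m (\<lambda>a. lam n \<nu> \<mu> a + rho g a)"
  shows "regular_operator_at m (multi_indices n (psum \<nu> m)) (Lambda_space n m \<nu>) (J_op g n m \<nu>) \<mu>"
  unfolding regular_operator_at_def
proof (intro ballI)
  fix v I assume v: "v \<in> Lambda_space n m \<nu>" and I: "I \<in> multi_indices n (psum \<nu> m)"
  have g: "g = SP \<longrightarrow> even n" using assms(2) by simp
  interpret Pt: pair_operator "P_tilde_op g n" n by (rule pair_operator_P_tilde[OF g])
  interpret P: pair_operator "P_op n" n by (rule pair_operator_P)
  have dom: "omega g n \<nu> a \<mu> - omega g n \<nu> b \<mu> \<noteq> - of_nat k" "omega g n \<nu> a \<mu> + omega g n \<nu> b \<mu> \<noteq> of_nat k"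
    if "a \<in> {1..m}" "b \<in> {1..m}" "a < b" "k \<ge> 1" for a b k
    using assms(5) that unfolding dominant_def omega_def by blast+
  have domSP: "omega g n \<nu> a \<mu> \<noteq> of_nat k" if "a \<in> {1..m}" "g = SP" "k \<ge> 1" for a k
    using assms(5) that unfolding dominant_def omega_def by blast
  let ?AC = "\<lambda>(a, b) z. R_product (P_tilde_op g n) (\<lambda>p q. of_nat n - spectral g \<nu> z p - spectral g \<nu> z q)
    (if a = b then triangle (lo \<nu> a) (\<nu> a) else List.product (segment_list \<nu> a) (segment_list \<nu> b))"
  let ?AB = "\<lambda>(a, b) z. R_product (P_op n) (\<lambda>p q. spectral g \<nu> z q - spectral g \<nu> z p)
    (List.product (rev (segment_list \<nu> a)) (segment_list \<nu> b))"
  let ?gam = "\<lambda>z a b. if \<nu> a + \<nu> b \<ge> n then (lam n \<nu> z a + lam n \<nu> z b + rho g a + rho g b) / (z a + z b + rho g a + rho g b) else 1"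
  let ?del = "\<lambda>z a. if 2 * \<nu> a \<ge> n then (lam n \<nu> z a + rho g a) / (z a + rho g a) else 1"
  let ?bet = "\<lambda>z a b. if \<nu> a \<le> \<nu> b
       then (lam n \<nu> z a - lam n \<nu> z b + rho g a - rho g b + of_nat (\<nu> b)) / (z a - z b + rho g a - rho g b)
       else (lam n \<nu> z a - lam n \<nu> z b + rho g a - rho g b + of_nat (\<nu> b)) / (lam n \<nu> z a - lam n \<nu> z b + rho g a - rho g b)"
  let ?cC = "\<lambda>(a, b) z. if a = b then (if g = SP then ?del z a else 1) else ?gam z a b"
  let ?cB = "\<lambda>(a, b) z. ?bet z a b"
  have neq: "p \<noteq> q" if "p \<in> segment \<nu> a" "q \<in> segment \<nu> b" "1 \<le> a" "a < b" for p q a b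
    using segments_less[of a b \<nu>] that by simp
  have linC: "linear_op (?AC k z)" if "k \<in> set (C_blocks m)" for k z
  proof -
    obtain a b where ab: "k = (a, b)" by force
    have "linear_op (R_product (P_tilde_op g n) (\<lambda>p q. of_nat n - spectral g \<nu> z p - spectral g \<nu> z q)
        (if a = b then triangle (lo \<nu> a) (\<nu> a) else List.product (segment_list \<nu> a) (segment_list \<nu> b)))"
    proof (rule Pt.linear_op_pair_R_fold)
      fix p q assume "(p, q) \<in> set (if a = b then triangle (lo \<nu> a) (\<nu> a) else List.product (segment_list \<nu> a) (segment_list \<nu> b))"
      then show "p \<noteq> q"
        using neq[of p a q b] that by (auto simp: ab set_C_blocks set_triangle split: if_splits)
    qed
    then show ?thesis by (simp add: ab)
  qed
  have linB: "linear_op (?AB k z)" if "k \<in> set (B_blocks m)" for k z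
  proof -
    obtain a b where ab: "k = (a, b)" by force
    have "linear_op (R_product (P_op n) (\<lambda>p q. spectral g \<nu> z q - spectral g \<nu> z p)
        (List.product (rev (segment_list \<nu> a)) (segment_list \<nu> b)))"
    proof (rule P.linear_op_pair_R_fold)
      fix p q assume "(p, q) \<in> set (List.product (rev (segment_list \<nu> a)) (segment_list \<nu> b))"
      then show "p \<noteq> q"
        using neq[of p a q b] that by (auto simp: ab set_B_blocks)
    qed
    then show ?thesis by (simp add: ab)
  qed
  \<comment> \<open>A fixed vector is a constant family. C acts on it first, then B.\<close>
  have "good_family n m \<nu> \<mu> (\<lambda>z. v)"
    using v by (auto simp: good_family_def regular_family_def intro: regular_at_const generically_always)
  then have C: "good_family n m \<nu> \<mu> (\<lambda>z I. fold (\<lambda>k. ?AC k z) (C_blocks m) v I / (\<Prod>k\<leftarrow>C_blocks m. ?cC k z))"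
  proof (rule good_family_fold[rotated 2])
    fix k F assume k: "k \<in> set (C_blocks m)" and F: "good_family n m \<nu> \<mu> F"
    obtain a b where ab: "k = (a, b)" by force
    then have abm: "a \<in> {1..m}" "b \<in> {1..m}" "a \<le> b" using k by (auto simp: set_C_blocks)
    show "good_family n m \<nu> \<mu> (\<lambda>z I. ?AC k z (F z) I / ?cC k z)"
    proof (cases "a = b")
      case True
      then show ?thesis
        using C_diagonal_step[OF g abm(1) domSP[OF abm(1)] F] unfolding ab True[symmetric] by simp
    next
      case False
      then have "a < b" using abm(3) by simp
      then show ?thesis
        using C_cross_step[OF g abm(1,2) _ dom(2)[OF abm(1,2)] F] False by (simp add: ab)
    qed
  qed (rule linC)
  have "good_family n m \<nu> \<mu> (\<lambda>z I. fold (\<lambda>k. ?AB k z) (B_blocks m)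
      (\<lambda>I. fold (\<lambda>k. ?AC k z) (C_blocks m) v I / (\<Prod>k\<leftarrow>C_blocks m. ?cC k z)) I / (\<Prod>k\<leftarrow>B_blocks m. ?cB k z))"
  proof (rule good_family_fold[OF _ _ C])
    fix k F assume k: "k \<in> set (B_blocks m)" and F: "good_family n m \<nu> \<mu> F"
    obtain a b where ab: "k = (a, b)" by force
    then have abm: "a \<in> {1..m}" "b \<in> {1..m}" "a < b" using k by (auto simp: set_B_blocks)
    then have "\<nu> a \<ge> 1" "\<nu> b \<ge> 1" using assms(4)[of a] assms(4)[of b] by auto
    then show "good_family n m \<nu> \<mu> (\<lambda>z I. ?AB k z (F z) I / ?cB k z)"
      using B_cross_step[OF abm _ _ dom(1)[OF abm] F] by (simp add: ab)
  qed (rule linB)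
  then have "regular_at m (\<lambda>z. fold (\<lambda>k. ?AB k z) (B_blocks m)
      (\<lambda>I. fold (\<lambda>k. ?AC k z) (C_blocks m) v I / (\<Prod>k\<leftarrow>C_blocks m. ?cC k z)) I / (\<Prod>k\<leftarrow>B_blocks m. ?cB k z)) \<mu>"
    using I unfolding good_family_def regular_family_def by blast
  \<comment> \<open>Reassembly of the blocks and scalars into J. The identity holds at every
    \<open>z\<close>, also where a denominator vanishes, since it rests only on commuting factors
    and on linearity.\<close>
  moreover have "fold (\<lambda>k. ?AB k z) (B_blocks m)
      (\<lambda>I. fold (\<lambda>k. ?AC k z) (C_blocks m) v I / (\<Prod>k\<leftarrow>C_blocks m. ?cC k z)) I / (\<Prod>k\<leftarrow>B_blocks m. ?cB k z) =
    J_op g n m \<nu> z v I" for z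
  proof -
    have lin: "linear_op (fold (\<lambda>k. ?AB k z) (B_blocks m))" by (intro linear_op_fold linB)
    have B: "B_op g n m \<nu> z w = fold (\<lambda>k. ?AB k z) (B_blocks m) w" for w
      unfolding B_op_def ordered_prod_fold R_op_eq B_fold_blocks[OF pair_operator_P]
      by (rule fold_cong) auto
    have C: "C_op g n m \<nu> z w = fold (\<lambda>k. ?AC k z) (C_blocks m) w" for w
      unfolding C_op_def ordered_prod_fold rev_rev_ident R_tilde_op_eq C_fold_blocks[OF pair_operator_P_tilde[OF g]]
      by (rule fold_cong) auto
    have "(\<Prod>k\<leftarrow>C_blocks m. ?cC k z) = (\<Prod>(a, b)\<leftarrow>C_blocks m. if a = b then (if g = SP then ?del z a else 1) else ?gam z a b)"
      by (simp add: case_prod_unfold)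
    also have "\<dots> = gamma_fun g n m \<nu> z * (\<Prod>a\<in>{1..m}. if g = SP then ?del z a else 1)"
      unfolding prod_C_blocks gamma_fun_def Let_def ..
    also have "(\<Prod>a\<in>{1..m}. if g = SP then ?del z a else 1) = (if g = SP then delta_fun g n m \<nu> z else 1)"
    proof -
      have "(\<Prod>a\<in>{1..m}. if b then f a else 1) = (if b then \<Prod>a\<in>{1..m}. f a else 1)"
        for b and f :: "nat \<Rightarrow> complex" by simp
      then show ?thesis unfolding delta_fun_def Let_def .
    qed
    finally have cC: "(\<Prod>k\<leftarrow>C_blocks m. ?cC k z) = gamma_fun g n m \<nu> z * (if g = SP then delta_fun g n m \<nu> z else 1)" .
    have "distinct (B_blocks m)"
      using distinct_sorted_lex[of "rev (B_blocks m)"] sorted_B_blocks[of m] by (simp add: sorted_wrt_rev)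
    then have "(\<Prod>k\<leftarrow>B_blocks m. ?cB k z) = (\<Prod>k\<in>set (B_blocks m). ?cB k z)"
      by (rule prod.distinct_set_conv_list[symmetric])
    also have "\<dots> = beta_fun g n m \<nu> z"
      unfolding set_B_blocks beta_fun_def Let_def by (intro prod.cong) auto
    finally have cB: "(\<Prod>k\<leftarrow>B_blocks m. ?cB k z) = beta_fun g n m \<nu> z" .
    have "fold (\<lambda>k. ?AB k z) (B_blocks m) (\<lambda>I. fold (\<lambda>k. ?AC k z) (C_blocks m) v I / (\<Prod>k\<leftarrow>C_blocks m. ?cC k z)) =
        (\<lambda>I. fold (\<lambda>k. ?AB k z) (B_blocks m) (fold (\<lambda>k. ?AC k z) (C_blocks m) v) I / (\<Prod>k\<leftarrow>C_blocks m. ?cC k z))"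
      using linear_op_scale[OF lin, of "1 / (\<Prod>k\<leftarrow>C_blocks m. ?cC k z)"] by simp
    then show ?thesis
      unfolding J_op_def B C[symmetric] cC cB by (simp add: mult.assoc mult.commute)
  qed
  ultimately show "regular_at m (\<lambda>z. J_op g n m \<nu> z v I) \<mu>" by simp
qed

end
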